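(* Let $\mathbb D$ be a symmetric 2-rig doctrine and let $\mathbb D[1]$ be the free $\mathbb D$-rig on one generator $X$, with its standard derivative $F\mapsto F'$ and its substitution product $\circ$. For all objects $F,G$ of $\mathbb D[1]$ there is a canonical isomorphism $$(F\circ G)'\;\cong\;(F'\circ G)\otimes G'.$$
   Context: Fix an additive doctrine $\mathbb A$: a class of colimit shapes containing at least all finite discrete diagrams, given by the 2-monad on $\mathsf{Cat}$ whose algebras are the categories with all colimits of that class; functors preserving these colimits are called $\mathbb A$-cocontinuous. Coproducts are written $+$, the initial object $0$. For the corresponding symmetric 2-rig doctrine $\mathbb D$, a $\mathbb D$-rig is a symmetric monoidal category $(\mathcal R,\otimes,I)$ with all $\mathbb A$-colimits such that $\otimes$ preserves them in each variable separately; a morphism of $\mathbb D$-rigs is a strong symmetric monoidal $\mathbb A$-cocontinuous functor; 2-cells are monoidal natural transformations. $\mathbb D[1]$ is the free $\mathbb D$-rig on a single generator $X$: evaluation at $X$ gives an equivalence $\mathbb D\text{-}\mathsf{Rig}(\mathbb D[1],\mathcal R)\simeq\mathcal R$ for each $\mathbb D$-rig $\mathcal R$. When $\mathbb A$ is the doctrine of all small colimits, $\mathbb D[1]$ is the category of Joyal species $[\Sigma^{op},\mathsf{Set}]$ ($\Sigma$ the category of finite sets and bijections) with Day convolution; objects of $\mathbb D[1]$ are thought of as species. For $G\in\mathbb D[1]$, let $-\circ G:\mathbb D[1]\to\mathbb D[1]$ be the essentially unique $\mathbb D$-rig map sending $X$ to $G$. This defines the substitution product $\circ:\mathbb D[1]\times\mathbb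 D[1]\to\mathbb D[1]$ (the monoidal structure corresponding to composition of $\mathbb D$-rig endomorphisms of $\mathbb D[1]$), with unit $X$. For a $\mathbb D$-rig $\mathcal R$, $\mathcal R[\varepsilon]$ denotes the $\mathbb D$-rig with underlying category $\mathcal R\times\mathcal R$, unit $(I,0)$ and product $(A,M)\boxtimes(B,N)=(A\otimes B,\,A\otimes N+M\otimes B)$. The standard derivative $\partial:\mathbb D[1]\to\mathbb D[1]$, written $F'=\partial F$, is the second component of the essentially unique $\mathbb D$-rig map $\mathbb D[1]\to\mathbb D[1][\varepsilon]$ sending $X$ to $(X,I)$. *)

theory Defs
  imports "HOL-Library.FuncSet"
begin

section \<open>Categories, functors, natural transformations\<close>

text \<open>
  Categories have explicit carriers of objects and arrows; the values of the operations outside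
  these carriers are irrelevant.  Composition \<open>g \<cdot> f\<close> is written in applicative order.
\<close>

record ('o, 'a) cat =
  Obj :: "'o set"
  Arr :: "'a set"
  Dom :: "'a \<Rightarrow> 'o"
  Cod :: "'a \<Rightarrow> 'o"
  Ide :: "'o \<Rightarrow> 'a"
  Comp :: "'a \<Rightarrow> 'a \<Rightarrow> 'a"  (infixr "\<cdot>\<index>" 65)

definition hom :: "('o, 'a, 'm) cat_scheme \<Rightarrow> 'o \<Rightarrow> 'o \<Rightarrow> 'a set" where
  "hom C a b = {f \<in> Arr C. Dom C f = a \<and> Cod C f = b}"

locale category =
  fixes C :: "('o, 'a, 'm) cat_scheme" (structure)
  assumes dom_obj: "f \<in> Arr C \<Longrightarrow> Dom C f \<in> Obj C"
    and cod_obj: "f \<in> Arr C \<Longrightarrow> Cod C f \<in> Obj C"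
    and ide_hom: "a \<in> Obj C \<Longrightarrow> Ide C a \<in> hom C a a"
    and comp_hom: "\<lbrakk>f \<in> hom C a b; g \<in> hom C b c\<rbrakk> \<Longrightarrow> g \<cdot> f \<in> hom C a c"
    and comp_ide_left: "f \<in> hom C a b \<Longrightarrow> Ide C b \<cdot> f = f"
    and comp_ide_right: "f \<in> hom C a b \<Longrightarrow> f \<cdot> Ide C a = f"
    and comp_assoc: "\<lbrakk>f \<in> hom C a b; g \<in> hom C b c; h \<in> hom C c d\<rbrakk> \<Longrightarrow> (h \<cdot> g) \<cdot> f = h \<cdot> (g \<cdot> f)"

definition iso_between :: "('o, 'a, 'm) cat_scheme \<Rightarrow> 'a \<Rightarrow> 'o \<Rightarrow> 'o \<Rightarrow> bool" where
  "iso_between C f a b \<longleftrightarrow>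
     f \<in> hom C a b \<and> (\<exists>g \<in> hom C b a. g \<cdot>\<^bsub>C\<^esub> f = Ide C a \<and> f \<cdot>\<^bsub>C\<^esub> g = Ide C b)"

definition inverse_arr :: "('o, 'a, 'm) cat_scheme \<Rightarrow> 'a \<Rightarrow> 'a" where
  "inverse_arr C f =
     (THE g. g \<in> hom C (Cod C f) (Dom C f) \<and>
        g \<cdot>\<^bsub>C\<^esub> f = Ide C (Dom C f) \<and> f \<cdot>\<^bsub>C\<^esub> g = Ide C (Cod C f))"

record ('o, 'a, 'p, 'q) fctr =
  fobj :: "'o \<Rightarrow> 'p"
  farr :: "'a \<Rightarrow> 'q"

locale is_functor = C: category C + D: category D
  for C :: "('o, 'a, 'm) cat_scheme" and D :: "('p, 'q, 'n) cat_scheme"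
    and F :: "('o, 'a, 'p, 'q, 'l) fctr_scheme" +
  assumes fobj_obj: "a \<in> Obj C \<Longrightarrow> fobj F a \<in> Obj D"
    and farr_hom: "f \<in> hom C a b \<Longrightarrow> farr F f \<in> hom D (fobj F a) (fobj F b)"
    and farr_ide: "a \<in> Obj C \<Longrightarrow> farr F (Ide C a) = Ide D (fobj F a)"
    and farr_comp: "\<lbrakk>f \<in> hom C a b; g \<in> hom C b c\<rbrakk> \<Longrightarrow>
          farr F (g \<cdot>\<^bsub>C\<^esub> f) = farr F g \<cdot>\<^bsub>D\<^esub> farr F f"

definition id_fctr :: "('o, 'a, 'o, 'a) fctr" where
  "id_fctr = \<lparr>fobj = (\<lambda>a. a), farr = (\<lambda>f. f)\<rparr>"

definition comp_fctr ::
  "('p, 'q, 'r, 's, 'k) fctr_scheme \<Rightarrow> ('o, 'a, 'p, 'q, 'l) fctr_scheme \<Rightarrow> ('o, 'a, 'r, 's) fctr"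
where
  "comp_fctr K H = \<lparr>fobj = (\<lambda>a. fobj K (fobj H a)), farr = (\<lambda>f. farr K (farr H f))\<rparr>"

text \<open>
  Transformations are families indexed by exactly the objects of the source category
  (extensionality), so that equality of transformations is equality of HOL functions.
\<close>

definition nat_trans ::
  "('o, 'a, 'm) cat_scheme \<Rightarrow> ('p, 'q, 'n) cat_scheme \<Rightarrow>
   ('o, 'a, 'p, 'q, 'k) fctr_scheme \<Rightarrow> ('o, 'a, 'p, 'q, 'l) fctr_scheme \<Rightarrow> ('o \<Rightarrow> 'q) \<Rightarrow> bool"
where
  "nat_trans C D F G \<alpha> \<longleftrightarrow>
     \<alpha> \<in> extensional (Obj C) \<and>
     (\<forall>a\<in>Obj C. \<alpha> a \<in> hom D (fobj F a) (fobj G a)) \<and>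
     (\<forall>a\<in>Obj C. \<forall>b\<in>Obj C. \<forall>f\<in>hom C a b. \<alpha> b \<cdot>\<^bsub>D\<^esub> farr F f = farr G f \<cdot>\<^bsub>D\<^esub> \<alpha> a)"

definition nat_iso ::
  "('o, 'a, 'm) cat_scheme \<Rightarrow> ('p, 'q, 'n) cat_scheme \<Rightarrow>
   ('o, 'a, 'p, 'q, 'k) fctr_scheme \<Rightarrow> ('o, 'a, 'p, 'q, 'l) fctr_scheme \<Rightarrow> ('o \<Rightarrow> 'q) \<Rightarrow> bool"
where
  "nat_iso C D F G \<alpha> \<longleftrightarrow>
     nat_trans C D F G \<alpha> \<and> (\<forall>a\<in>Obj C. iso_between D (\<alpha> a) (fobj F a) (fobj G a))"

definition equivalence_of_categories ::
  "('o, 'a, 'm) cat_scheme \<Rightarrow> ('p, 'q, 'n) cat_scheme \<Rightarrow>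
   ('o, 'a, 'p, 'q, 'l) fctr_scheme \<Rightarrow> bool"
where
  "equivalence_of_categories C D F \<longleftrightarrow>
     is_functor C D F \<and>
     (\<exists>(K :: ('p, 'q, 'o, 'a) fctr) \<eta> \<theta>.
        is_functor D C K \<and>
        nat_iso C C id_fctr (comp_fctr K F) \<eta> \<and>
        nat_iso D D (comp_fctr F K) id_fctr \<theta>)"


section \<open>Colimits and additive doctrines\<close>

definition is_cocone ::
  "('j, 'k, 'm) cat_scheme \<Rightarrow> ('o, 'a, 'n) cat_scheme \<Rightarrow> ('j, 'k, 'o, 'a, 'l) fctr_scheme \<Rightarrow>
   'o \<Rightarrow> ('j \<Rightarrow> 'a) \<Rightarrow> bool"
where
  "is_cocone J C P c \<kappa> \<longleftrightarrow>
     c \<in> Obj C \<and>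
     (\<forall>j\<in>Obj J. \<kappa> j \<in> hom C (fobj P j) c) \<and>
     (\<forall>u\<in>Arr J. \<kappa> (Cod J u) \<cdot>\<^bsub>C\<^esub> farr P u = \<kappa> (Dom J u))"

definition is_colimit ::
  "('j, 'k, 'm) cat_scheme \<Rightarrow> ('o, 'a, 'n) cat_scheme \<Rightarrow> ('j, 'k, 'o, 'a, 'l) fctr_scheme \<Rightarrow>
   'o \<Rightarrow> ('j \<Rightarrow> 'a) \<Rightarrow> bool"
where
  "is_colimit J C P c \<kappa> \<longleftrightarrow>
     is_cocone J C P c \<kappa> \<and>
     (\<forall>c' \<kappa>'. is_cocone J C P c' \<kappa>' \<longrightarrow>
        (\<exists>!h. h \<in> hom C c c' \<and> (\<forall>j\<in>Obj J. h \<cdot>\<^bsub>C\<^esub> \<kappa> j = \<kappa>' j)))"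

text \<open>
  An additive doctrine is represented by its class \<open>\<A>\<close> of shapes.  That \<open>\<A>\<close> contains the finite
  discrete shapes is required up to isomorphism: one discrete shape of each finite cardinality.
\<close>

definition finite_discrete :: "nat \<Rightarrow> ('j, 'k, 'm) cat_scheme \<Rightarrow> bool" where
  "finite_discrete n J \<longleftrightarrow>
     category J \<and> Arr J = Ide J ` Obj J \<and> finite (Obj J) \<and> card (Obj J) = n"

definition additive_doctrine :: "('j, 'k) cat set \<Rightarrow> bool" where
  "additive_doctrine \<A> \<longleftrightarrow>
     (\<forall>J\<in>\<A>. category J) \<and> (\<forall>n. \<exists>J\<in>\<A>. finite_discrete n J)"

definition has_colimits :: "('j, 'k) cat set \<Rightarrow> ('o, 'a, 'm) cat_scheme \<Rightarrow> bool" where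
  "has_colimits \<A> C \<longleftrightarrow>
     (\<forall>J\<in>\<A>. \<forall>P :: ('j, 'k, 'o, 'a) fctr. is_functor J C P \<longrightarrow> (\<exists>c \<kappa>. is_colimit J C P c \<kappa>))"

definition cocontinuous ::
  "('j, 'k) cat set \<Rightarrow> ('o, 'a, 'm) cat_scheme \<Rightarrow> ('p, 'q, 'n) cat_scheme \<Rightarrow>
   ('o, 'a, 'p, 'q, 'l) fctr_scheme \<Rightarrow> bool"
where
  "cocontinuous \<A> C D F \<longleftrightarrow>
     is_functor C D F \<and>
     (\<forall>J\<in>\<A>. \<forall>(P :: ('j, 'k, 'o, 'a) fctr) c \<kappa>.
        is_functor J C P \<and> is_colimit J C P c \<kappa> \<longrightarrow>
        is_colimit J D (comp_fctr F P) (fobj F c) (\<lambda>j. farr F (\<kappa> j)))"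


section \<open>Symmetric monoidal categories\<close>

text \<open>
  \<open>\<otimes>\<close> and \<open>\<odot>\<close> are the actions of the tensor product on objects and on arrows.  Orientations:
  \<open>Assoc C a b c : (a \<otimes> b) \<otimes> c \<rightarrow> a \<otimes> (b \<otimes> c)\<close>, \<open>Lun C a : \<one> \<otimes> a \<rightarrow> a\<close>, \<open>Run C a : a \<otimes> \<one> \<rightarrow> a\<close>,
  \<open>Swap C a b : a \<otimes> b \<rightarrow> b \<otimes> a\<close>.
\<close>

record ('o, 'a) smcat = "('o, 'a) cat" +
  Tensor :: "'o \<Rightarrow> 'o \<Rightarrow> 'o"  (infixr "\<otimes>\<index>" 70)
  TensorA :: "'a \<Rightarrow> 'a \<Rightarrow> 'a"  (infixr "\<odot>\<index>" 70)
  Unit :: "'o"  ("\<one>\<index>")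
  Assoc :: "'o \<Rightarrow> 'o \<Rightarrow> 'o \<Rightarrow> 'a"
  Lun :: "'o \<Rightarrow> 'a"
  Run :: "'o \<Rightarrow> 'a"
  Swap :: "'o \<Rightarrow> 'o \<Rightarrow> 'a"

locale symmetric_monoidal_category = category C
  for C :: "('o, 'a, 'm) smcat_scheme" (structure) +
  assumes unit_obj: "\<one> \<in> Obj C"
    and tensor_obj: "\<lbrakk>a \<in> Obj C; b \<in> Obj C\<rbrakk> \<Longrightarrow> a \<otimes> b \<in> Obj C"
    and tensor_hom: "\<lbrakk>f \<in> hom C a a'; g \<in> hom C b b'\<rbrakk> \<Longrightarrow> f \<odot> g \<in> hom C (a \<otimes> b) (a' \<otimes> b')"
    and tensor_ide: "\<lbrakk>a \<in> Obj C; b \<in> Obj C\<rbrakk> \<Longrightarrow> Ide C a \<odot> Ide C b = Ide C (a \<otimes> b)"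
    and tensor_comp: "\<lbrakk>f \<in> hom C a a'; f' \<in> hom C a' a''; g \<in> hom C b b'; g' \<in> hom C b' b''\<rbrakk> \<Longrightarrow>
          (f' \<cdot> f) \<odot> (g' \<cdot> g) = (f' \<odot> g') \<cdot> (f \<odot> g)"
    and assoc_iso: "\<lbrakk>a \<in> Obj C; b \<in> Obj C; c \<in> Obj C\<rbrakk> \<Longrightarrow>
          iso_between C (Assoc C a b c) ((a \<otimes> b) \<otimes> c) (a \<otimes> (b \<otimes> c))"
    and assoc_nat: "\<lbrakk>f \<in> hom C a a'; g \<in> hom C b b'; h \<in> hom C c c'\<rbrakk> \<Longrightarrow>
          Assoc C a' b' c' \<cdot> ((f \<odot> g) \<odot> h) = (f \<odot> (g \<odot> h)) \<cdot> Assoc C a b c"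
    and lun_iso: "a \<in> Obj C \<Longrightarrow> iso_between C (Lun C a) (\<one> \<otimes> a) a"
    and lun_nat: "f \<in> hom C a a' \<Longrightarrow> Lun C a' \<cdot> (Ide C \<one> \<odot> f) = f \<cdot> Lun C a"
    and run_iso: "a \<in> Obj C \<Longrightarrow> iso_between C (Run C a) (a \<otimes> \<one>) a"
    and run_nat: "f \<in> hom C a a' \<Longrightarrow> Run C a' \<cdot> (f \<odot> Ide C \<one>) = f \<cdot> Run C a"
    and swap_hom: "\<lbrakk>a \<in> Obj C; b \<in> Obj C\<rbrakk> \<Longrightarrow> Swap C a b \<in> hom C (a \<otimes> b) (b \<otimes> a)"
    and swap_nat: "\<lbrakk>f \<in> hom C a a'; g \<in> hom C b b'\<rbrakk> \<Longrightarrow>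
          Swap C a' b' \<cdot> (f \<odot> g) = (g \<odot> f) \<cdot> Swap C a b"
    and swap_swap: "\<lbrakk>a \<in> Obj C; b \<in> Obj C\<rbrakk> \<Longrightarrow> Swap C b a \<cdot> Swap C a b = Ide C (a \<otimes> b)"
    and pentagon: "\<lbrakk>a \<in> Obj C; b \<in> Obj C; c \<in> Obj C; d \<in> Obj C\<rbrakk> \<Longrightarrow>
          (Ide C a \<odot> Assoc C b c d) \<cdot> Assoc C a (b \<otimes> c) d \<cdot> (Assoc C a b c \<odot> Ide C d)
            = Assoc C a b (c \<otimes> d) \<cdot> Assoc C (a \<otimes> b) c d"
    and triangle: "\<lbrakk>a \<in> Obj C; b \<in> Obj C\<rbrakk> \<Longrightarrow>
          (Ide C a \<odot> Lun C b) \<cdot> Assoc C a \<one> b = Run C a \<odot> Ide C b"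
    and hexagon: "\<lbrakk>a \<in> Obj C; b \<in> Obj C; c \<in> Obj C\<rbrakk> \<Longrightarrow>
          Assoc C b c a \<cdot> Swap C a (b \<otimes> c) \<cdot> Assoc C a b c
            = (Ide C b \<odot> Swap C a c) \<cdot> Assoc C b a c \<cdot> (Swap C a b \<odot> Ide C c)"

text \<open>
  The structure arrows of a strong monoidal functor \<open>H\<close> are \<open>munit H : \<one> \<rightarrow> H \<one>\<close> and
  \<open>mmult H a b : H a \<otimes> H b \<rightarrow> H (a \<otimes> b)\<close>.
\<close>

record ('o, 'a, 'p, 'q) mfctr = "('o, 'a, 'p, 'q) fctr" +
  munit :: "'q"
  mmult :: "'o \<Rightarrow> 'o \<Rightarrow> 'q"

locale symmetric_monoidal_functor =
  C: symmetric_monoidal_category C + D: symmetric_monoidal_category D + is_functor C D H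
  for C :: "('o, 'a, 'm) smcat_scheme" and D :: "('p, 'q, 'n) smcat_scheme"
    and H :: "('o, 'a, 'p, 'q, 'l) mfctr_scheme" +
  assumes munit_iso: "iso_between D (munit H) \<one>\<^bsub>D\<^esub> (fobj H \<one>\<^bsub>C\<^esub>)"
    and mmult_iso: "\<lbrakk>a \<in> Obj C; b \<in> Obj C\<rbrakk> \<Longrightarrow>
          iso_between D (mmult H a b) (fobj H a \<otimes>\<^bsub>D\<^esub> fobj H b) (fobj H (a \<otimes>\<^bsub>C\<^esub> b))"
    and mmult_nat: "\<lbrakk>f \<in> hom C a a'; g \<in> hom C b b'\<rbrakk> \<Longrightarrow>
          mmult H a' b' \<cdot>\<^bsub>D\<^esub> (farr H f \<odot>\<^bsub>D\<^esub> farr H g) = farr H (f \<odot>\<^bsub>C\<^esub> g) \<cdot>\<^bsub>D\<^esub> mmult H a b"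
    and mmult_assoc: "\<lbrakk>a \<in> Obj C; b \<in> Obj C; c \<in> Obj C\<rbrakk> \<Longrightarrow>
          farr H (Assoc C a b c) \<cdot>\<^bsub>D\<^esub> mmult H (a \<otimes>\<^bsub>C\<^esub> b) c \<cdot>\<^bsub>D\<^esub> (mmult H a b \<odot>\<^bsub>D\<^esub> Ide D (fobj H c))
            = mmult H a (b \<otimes>\<^bsub>C\<^esub> c) \<cdot>\<^bsub>D\<^esub> (Ide D (fobj H a) \<odot>\<^bsub>D\<^esub> mmult H b c)
                \<cdot>\<^bsub>D\<^esub> Assoc D (fobj H a) (fobj H b) (fobj H c)"
    and mmult_lun: "a \<in> Obj C \<Longrightarrow>
          farr H (Lun C a) \<cdot>\<^bsub>D\<^esub> mmult H \<one>\<^bsub>C\<^esub> a \<cdot>\<^bsub>D\<^esub> (munit H \<odot>\<^bsub>D\<^esub> Ide D (fobj H a)) = Lun D (fobj H a)"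
    and mmult_run: "a \<in> Obj C \<Longrightarrow>
          farr H (Run C a) \<cdot>\<^bsub>D\<^esub> mmult H a \<one>\<^bsub>C\<^esub> \<cdot>\<^bsub>D\<^esub> (Ide D (fobj H a) \<odot>\<^bsub>D\<^esub> munit H) = Run D (fobj H a)"
    and mmult_swap: "\<lbrakk>a \<in> Obj C; b \<in> Obj C\<rbrakk> \<Longrightarrow>
          farr H (Swap C a b) \<cdot>\<^bsub>D\<^esub> mmult H a b = mmult H b a \<cdot>\<^bsub>D\<^esub> Swap D (fobj H a) (fobj H b)"

definition monoidal_trans ::
  "('o, 'a, 'm) smcat_scheme \<Rightarrow> ('p, 'q, 'n) smcat_scheme \<Rightarrow>
   ('o, 'a, 'p, 'q, 'k) mfctr_scheme \<Rightarrow> ('o, 'a, 'p, 'q, 'l) mfctr_scheme \<Rightarrow> ('o \<Rightarrow> 'q) \<Rightarrow> bool"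
where
  "monoidal_trans C D H K \<alpha> \<longleftrightarrow>
     nat_trans C D H K \<alpha> \<and>
     \<alpha> \<one>\<^bsub>C\<^esub> \<cdot>\<^bsub>D\<^esub> munit H = munit K \<and>
     (\<forall>a\<in>Obj C. \<forall>b\<in>Obj C.
        \<alpha> (a \<otimes>\<^bsub>C\<^esub> b) \<cdot>\<^bsub>D\<^esub> mmult H a b = mmult K a b \<cdot>\<^bsub>D\<^esub> (\<alpha> a \<odot>\<^bsub>D\<^esub> \<alpha> b))"

definition id_mfctr :: "('o, 'a, 'm) smcat_scheme \<Rightarrow> ('o, 'a, 'o, 'a) mfctr" where
  "id_mfctr C =
     \<lparr>fobj = (\<lambda>a. a), farr = (\<lambda>f. f), munit = Ide C \<one>\<^bsub>C\<^esub>, mmult = (\<lambda>a b. Ide C (a \<otimes>\<^bsub>C\<^esub> b))\<rparr>"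

text \<open>\<open>comp_mfctr E K H\<close> is \<open>K\<close> after \<open>H\<close>, where \<open>E\<close> is the target category of \<open>K\<close>.\<close>

definition comp_mfctr ::
  "('r, 's, 'n) smcat_scheme \<Rightarrow> ('p, 'q, 'r, 's) mfctr \<Rightarrow> ('o, 'a, 'p, 'q) mfctr \<Rightarrow>
   ('o, 'a, 'r, 's) mfctr"
where
  "comp_mfctr E K H =
     \<lparr>fobj = (\<lambda>a. fobj K (fobj H a)),
      farr = (\<lambda>f. farr K (farr H f)),
      munit = farr K (munit H) \<cdot>\<^bsub>E\<^esub> munit K,
      mmult = (\<lambda>a b. farr K (mmult H a b) \<cdot>\<^bsub>E\<^esub> mmult K (fobj H a) (fobj H b))\<rparr>"


section \<open>Rigs for the symmetric doctrine of an additive doctrine\<close>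

definition tensor_left :: "('o, 'a, 'm) smcat_scheme \<Rightarrow> 'o \<Rightarrow> ('o, 'a, 'o, 'a) fctr" where
  "tensor_left R a = \<lparr>fobj = (\<lambda>b. a \<otimes>\<^bsub>R\<^esub> b), farr = (\<lambda>f. Ide R a \<odot>\<^bsub>R\<^esub> f)\<rparr>"

definition tensor_right :: "('o, 'a, 'm) smcat_scheme \<Rightarrow> 'o \<Rightarrow> ('o, 'a, 'o, 'a) fctr" where
  "tensor_right R a = \<lparr>fobj = (\<lambda>b. b \<otimes>\<^bsub>R\<^esub> a), farr = (\<lambda>f. f \<odot>\<^bsub>R\<^esub> Ide R a)\<rparr>"

definition rig :: "('j, 'k) cat set \<Rightarrow> ('o, 'a) smcat \<Rightarrow> bool" where
  "rig \<A> R \<longleftrightarrow>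
     symmetric_monoidal_category R \<and> has_colimits \<A> R \<and>
     (\<forall>a\<in>Obj R. cocontinuous \<A> R R (tensor_left R a) \<and> cocontinuous \<A> R R (tensor_right R a))"

definition rig_map ::
  "('j, 'k) cat set \<Rightarrow> ('o, 'a) smcat \<Rightarrow> ('p, 'q) smcat \<Rightarrow> ('o, 'a, 'p, 'q) mfctr \<Rightarrow> bool"
where
  "rig_map \<A> R S H \<longleftrightarrow>
     rig \<A> R \<and> rig \<A> S \<and> symmetric_monoidal_functor R S H \<and> cocontinuous \<A> R S H"

text \<open>The category of rig maps from \<open>R\<close> to \<open>S\<close> and monoidal natural transformations.\<close>

definition rig_hom ::
  "('j, 'k) cat set \<Rightarrow> ('o, 'a) smcat \<Rightarrow> ('p, 'q) smcat \<Rightarrow>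
   (('o, 'a, 'p, 'q) mfctr,
    ('o, 'a, 'p, 'q) mfctr \<times> ('o, 'a, 'p, 'q) mfctr \<times> ('o \<Rightarrow> 'q)) cat"
where
  "rig_hom \<A> R S =
     \<lparr>Obj = {H. rig_map \<A> R S H},
      Arr = {(H, K, \<alpha>). rig_map \<A> R S H \<and> rig_map \<A> R S K \<and> monoidal_trans R S H K \<alpha>},
      Dom = (\<lambda>(H, K, \<alpha>). H),
      Cod = (\<lambda>(H, K, \<alpha>). K),
      Ide = (\<lambda>H. (H, H, \<lambda>a\<in>Obj R. Ide S (fobj H a))),
      Comp = (\<lambda>(K, L, \<beta>) (H, K', \<alpha>). (H, L, \<lambda>a\<in>Obj R. \<beta> a \<cdot>\<^bsub>S\<^esub> \<alpha> a))\<rparr>"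

definition evaluation ::
  "'o \<Rightarrow>
   (('o, 'a, 'p, 'q) mfctr,
    ('o, 'a, 'p, 'q) mfctr \<times> ('o, 'a, 'p, 'q) mfctr \<times> ('o \<Rightarrow> 'q), 'p, 'q) fctr"
where
  "evaluation X = \<lparr>fobj = (\<lambda>H. fobj H X), farr = (\<lambda>(H, K, \<alpha>). \<alpha> X)\<rparr>"

text \<open>
  \<open>R\<close> is the free rig on the object \<open>X\<close>.  HOL cannot quantify over types inside a formula, so the
  universal property is relative to the rigs with objects in \<open>'p\<close> and arrows in \<open>'q\<close>; the last
  argument only records these two types.
\<close>

definition free_rig_on ::
  "('j, 'k) cat set \<Rightarrow> ('o, 'a) smcat \<Rightarrow> 'o \<Rightarrow> ('p \<times> 'q) itself \<Rightarrow> bool"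
where
  "free_rig_on \<A> R X _ \<longleftrightarrow>
     rig \<A> R \<and> X \<in> Obj R \<and>
     (\<forall>S :: ('p, 'q) smcat. rig \<A> S \<longrightarrow>
        equivalence_of_categories (rig_hom \<A> R S) S (evaluation X))"


section \<open>The rig of dual numbers\<close>

definition is_initial :: "('o, 'a, 'm) cat_scheme \<Rightarrow> 'o \<Rightarrow> bool" where
  "is_initial C z \<longleftrightarrow> z \<in> Obj C \<and> (\<forall>c\<in>Obj C. \<exists>!f. f \<in> hom C z c)"

definition is_coproduct ::
  "('o, 'a, 'm) cat_scheme \<Rightarrow> 'o \<Rightarrow> 'o \<Rightarrow> 'o \<Rightarrow> 'a \<Rightarrow> 'a \<Rightarrow> bool"
where
  "is_coproduct C a b s i j \<longleftrightarrow>
     s \<in> Obj C \<and> i \<in> hom C a s \<and> j \<in> hom C b s \<and>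
     (\<forall>c\<in>Obj C. \<forall>f\<in>hom C a c. \<forall>g\<in>hom C b c.
        \<exists>!h. h \<in> hom C s c \<and> h \<cdot>\<^bsub>C\<^esub> i = f \<and> h \<cdot>\<^bsub>C\<^esub> j = g)"

text \<open>
  \<open>zero\<close>, \<open>plus\<close>, \<open>inl\<close>, \<open>inr\<close> are a choice of initial object and of binary coproducts with
  injections.
\<close>

definition zero :: "('o, 'a, 'm) cat_scheme \<Rightarrow> 'o" where
  "zero C = (SOME z. is_initial C z)"

definition from_initial :: "('o, 'a, 'm) cat_scheme \<Rightarrow> 'o \<Rightarrow> 'o \<Rightarrow> 'a" where
  "from_initial C z c = (THE f. f \<in> hom C z c)"

definition coproduct :: "('o, 'a, 'm) cat_scheme \<Rightarrow> 'o \<Rightarrow> 'o \<Rightarrow> 'o \<times> 'a \<times> 'a" where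
  "coproduct C a b = (SOME (s, i, j). is_coproduct C a b s i j)"

definition plus :: "('o, 'a, 'm) cat_scheme \<Rightarrow> 'o \<Rightarrow> 'o \<Rightarrow> 'o" where
  "plus C a b = fst (coproduct C a b)"

definition inl :: "('o, 'a, 'm) cat_scheme \<Rightarrow> 'o \<Rightarrow> 'o \<Rightarrow> 'a" where
  "inl C a b = fst (snd (coproduct C a b))"

definition inr :: "('o, 'a, 'm) cat_scheme \<Rightarrow> 'o \<Rightarrow> 'o \<Rightarrow> 'a" where
  "inr C a b = snd (snd (coproduct C a b))"

text \<open>\<open>copair C f g\<close> is the arrow \<open>[f, g] : a + b \<rightarrow> c\<close> for \<open>f : a \<rightarrow> c\<close> and \<open>g : b \<rightarrow> c\<close>.\<close>

definition copair :: "('o, 'a, 'm) cat_scheme \<Rightarrow> 'a \<Rightarrow> 'a \<Rightarrow> 'a" where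
  "copair C f g =
     (THE h. h \<in> hom C (plus C (Dom C f) (Dom C g)) (Cod C f) \<and>
        h \<cdot>\<^bsub>C\<^esub> inl C (Dom C f) (Dom C g) = f \<and> h \<cdot>\<^bsub>C\<^esub> inr C (Dom C f) (Dom C g) = g)"

definition plusA :: "('o, 'a, 'm) cat_scheme \<Rightarrow> 'a \<Rightarrow> 'a \<Rightarrow> 'a" where
  "plusA C f g =
     copair C (inl C (Cod C f) (Cod C g) \<cdot>\<^bsub>C\<^esub> f) (inr C (Cod C f) (Cod C g) \<cdot>\<^bsub>C\<^esub> g)"

text \<open>The canonical arrow \<open>a \<otimes> c + b \<otimes> c \<rightarrow> (a + b) \<otimes> c\<close>, invertible in a rig.\<close>

definition distr :: "('o, 'a, 'm) smcat_scheme \<Rightarrow> 'o \<Rightarrow> 'o \<Rightarrow> 'o \<Rightarrow> 'a" where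
  "distr R a b c = copair R (inl R a b \<odot>\<^bsub>R\<^esub> Ide R c) (inr R a b \<odot>\<^bsub>R\<^esub> Ide R c)"

text \<open>
  \<open>R[\<epsilon>]\<close>: the category \<open>R \<times> R\<close> with \<open>(A, M) \<boxtimes> (B, N) = (A \<otimes> B, A \<otimes> N + M \<otimes> B)\<close> and unit \<open>(\<one>, 0)\<close>.
  The second components of the structure isomorphisms are the canonical comparisons
  \<^item> \<open>(A \<otimes> B) \<otimes> P + (A \<otimes> N + M \<otimes> B) \<otimes> C \<rightarrow> A \<otimes> (B \<otimes> P + N \<otimes> C) + M \<otimes> (B \<otimes> C)\<close>,
  \<^item> \<open>\<one> \<otimes> M + 0 \<otimes> A \<rightarrow> M\<close> and \<open>A \<otimes> 0 + M \<otimes> \<one> \<rightarrow> M\<close>,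
  \<^item> \<open>A \<otimes> N + M \<otimes> B \<rightarrow> B \<otimes> M + N \<otimes> A\<close>,
  given summand by summand by the associators, unitors and symmetries of \<open>R\<close>; the objects
  \<open>0 \<otimes> A\<close> and \<open>A \<otimes> 0\<close> are initial.
\<close>

definition dual_numbers :: "('o, 'a) smcat \<Rightarrow> ('o \<times> 'o, 'a \<times> 'a) smcat" where
  "dual_numbers R =
     \<lparr>Obj = Obj R \<times> Obj R,
      Arr = Arr R \<times> Arr R,
      Dom = (\<lambda>(f, m). (Dom R f, Dom R m)),
      Cod = (\<lambda>(f, m). (Cod R f, Cod R m)),
      Ide = (\<lambda>(A, M). (Ide R A, Ide R M)),
      Comp = (\<lambda>(g, n) (f, m). (g \<cdot>\<^bsub>R\<^esub> f, n \<cdot>\<^bsub>R\<^esub> m)),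
      Tensor = (\<lambda>(A, M) (B, N). (A \<otimes>\<^bsub>R\<^esub> B, plus R (A \<otimes>\<^bsub>R\<^esub> N) (M \<otimes>\<^bsub>R\<^esub> B))),
      TensorA = (\<lambda>(f, m) (g, n). (f \<odot>\<^bsub>R\<^esub> g, plusA R (f \<odot>\<^bsub>R\<^esub> n) (m \<odot>\<^bsub>R\<^esub> g))),
      Unit = (\<one>\<^bsub>R\<^esub>, zero R),
      Assoc = (\<lambda>(A, M) (B, N) (C, P).
        (Assoc R A B C,
         (let U = plus R (B \<otimes>\<^bsub>R\<^esub> P) (N \<otimes>\<^bsub>R\<^esub> C);
              left = inl R (A \<otimes>\<^bsub>R\<^esub> U) (M \<otimes>\<^bsub>R\<^esub> (B \<otimes>\<^bsub>R\<^esub> C));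
              right = inr R (A \<otimes>\<^bsub>R\<^esub> U) (M \<otimes>\<^bsub>R\<^esub> (B \<otimes>\<^bsub>R\<^esub> C))
          in copair R
               (left \<cdot>\<^bsub>R\<^esub> (Ide R A \<odot>\<^bsub>R\<^esub> inl R (B \<otimes>\<^bsub>R\<^esub> P) (N \<otimes>\<^bsub>R\<^esub> C)) \<cdot>\<^bsub>R\<^esub> Assoc R A B P)
               (copair R
                  (left \<cdot>\<^bsub>R\<^esub> (Ide R A \<odot>\<^bsub>R\<^esub> inr R (B \<otimes>\<^bsub>R\<^esub> P) (N \<otimes>\<^bsub>R\<^esub> C)) \<cdot>\<^bsub>R\<^esub> Assoc R A N C)
                  (right \<cdot>\<^bsub>R\<^esub> Assoc R M B C)
                \<cdot>\<^bsub>R\<^esub> inverse_arr R (distr R (A \<otimes>\<^bsub>R\<^esub> N) (M \<otimes>\<^bsub>R\<^esub> B) C))))),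
      Lun = (\<lambda>(A, M). (Lun R A, copair R (Lun R M) (from_initial R (zero R \<otimes>\<^bsub>R\<^esub> A) M))),
      Run = (\<lambda>(A, M). (Run R A, copair R (from_initial R (A \<otimes>\<^bsub>R\<^esub> zero R) M) (Run R M))),
      Swap = (\<lambda>(A, M) (B, N).
        (Swap R A B,
         copair R
           (inr R (B \<otimes>\<^bsub>R\<^esub> M) (N \<otimes>\<^bsub>R\<^esub> A) \<cdot>\<^bsub>R\<^esub> Swap R A N)
           (inl R (B \<otimes>\<^bsub>R\<^esub> M) (N \<otimes>\<^bsub>R\<^esub> A) \<cdot>\<^bsub>R\<^esub> Swap R M B)))\<rparr>"

definition dual_proj :: "('o, 'a) smcat \<Rightarrow> ('o \<times> 'o, 'a \<times> 'a, 'o, 'a) mfctr" where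
  "dual_proj R =
     \<lparr>fobj = fst, farr = fst, munit = Ide R \<one>\<^bsub>R\<^esub>, mmult = (\<lambda>p q. Ide R (fst p \<otimes>\<^bsub>R\<^esub> fst q))\<rparr>"

text \<open>
  For a rig map \<open>H : R \<rightarrow> S\<close> and an object \<open>Q\<close> of \<open>S\<close>, the map \<open>R[\<epsilon>] \<rightarrow> S[\<epsilon>]\<close> with
  \<open>(A, M) \<mapsto> (H A, H M \<otimes> Q)\<close>.  The second component of its multiplicativity constraint,
  \<open>H A \<otimes> (H N \<otimes> Q) + (H M \<otimes> Q) \<otimes> H B \<rightarrow> H (A \<otimes> N + M \<otimes> B) \<otimes> Q\<close>,
  is induced by that of \<open>H\<close>, moving \<open>Q\<close> past \<open>H B\<close> by the symmetry.
\<close>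

definition dual_extension ::
  "('o, 'a) smcat \<Rightarrow> ('p, 'q) smcat \<Rightarrow> ('o, 'a, 'p, 'q) mfctr \<Rightarrow> 'p \<Rightarrow>
   ('o \<times> 'o, 'a \<times> 'a, 'p \<times> 'p, 'q \<times> 'q) mfctr"
where
  "dual_extension R S H Q =
     \<lparr>fobj = (\<lambda>(A, M). (fobj H A, fobj H M \<otimes>\<^bsub>S\<^esub> Q)),
      farr = (\<lambda>(f, m). (farr H f, farr H m \<odot>\<^bsub>S\<^esub> Ide S Q)),
      munit = (munit H, from_initial S (zero S) (fobj H (zero R) \<otimes>\<^bsub>S\<^esub> Q)),
      mmult = (\<lambda>(A, M) (B, N).
        (mmult H A B,
         copair S
           (((farr H (inl R (A \<otimes>\<^bsub>R\<^esub> N) (M \<otimes>\<^bsub>R\<^esub> B)) \<cdot>\<^bsub>S\<^esub> mmult H A N) \<odot>\<^bsub>S\<^esub> Ide S Q)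
             \<cdot>\<^bsub>S\<^esub> inverse_arr S (Assoc S (fobj H A) (fobj H N) Q))
           (((farr H (inr R (A \<otimes>\<^bsub>R\<^esub> N) (M \<otimes>\<^bsub>R\<^esub> B)) \<cdot>\<^bsub>S\<^esub> mmult H M B) \<odot>\<^bsub>S\<^esub> Ide S Q)
             \<cdot>\<^bsub>S\<^esub> inverse_arr S (Assoc S (fobj H M) (fobj H B) Q)
             \<cdot>\<^bsub>S\<^esub> (Ide S (fobj H M) \<odot>\<^bsub>S\<^esub> Swap S Q (fobj H B))
             \<cdot>\<^bsub>S\<^esub> Assoc S (fobj H M) Q (fobj H B))))\<rparr>"


section \<open>Substitution\<close>

text \<open>
  A substitution product on \<open>R\<close> is a choice, for every object \<open>G\<close>, of a rig map \<open>S G\<close>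
  (the functor \<open>- \<circ> G\<close>) and of an isomorphism \<open>s G : X \<circ> G \<rightarrow> G\<close>.
\<close>

definition substitution_product ::
  "('j, 'k) cat set \<Rightarrow> ('o, 'a) smcat \<Rightarrow> 'o \<Rightarrow>
   ('o \<Rightarrow> ('o, 'a, 'o, 'a) mfctr) \<Rightarrow> ('o \<Rightarrow> 'a) \<Rightarrow> bool"
where
  "substitution_product \<A> R X S s \<longleftrightarrow>
     (\<forall>G\<in>Obj R. rig_map \<A> R R (S G) \<and> iso_between R (s G) (fobj (S G) X) G)"

definition subst :: "('o \<Rightarrow> ('o, 'a, 'o, 'a) mfctr) \<Rightarrow> 'o \<Rightarrow> 'o \<Rightarrow> 'o" where
  "subst S F G = fobj (S G) F"

text \<open>
  For \<open>g : G \<rightarrow> G'\<close>, the monoidal transformation \<open>- \<circ> g\<close> is the one whose component at \<open>X\<close>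
  is \<open>g\<close> up to the isomorphisms \<open>X \<circ> G \<cong> G\<close> and \<open>X \<circ> G' \<cong> G'\<close>.
\<close>

definition subst_trans ::
  "('o, 'a) smcat \<Rightarrow> 'o \<Rightarrow> ('o \<Rightarrow> ('o, 'a, 'o, 'a) mfctr) \<Rightarrow> ('o \<Rightarrow> 'a) \<Rightarrow> 'a \<Rightarrow> 'o \<Rightarrow> 'a"
where
  "subst_trans R X S s g =
     (THE \<alpha>. monoidal_trans R R (S (Dom R g)) (S (Cod R g)) \<alpha> \<and>
        s (Cod R g) \<cdot>\<^bsub>R\<^esub> \<alpha> X = g \<cdot>\<^bsub>R\<^esub> s (Dom R g))"

definition substA ::
  "('o, 'a) smcat \<Rightarrow> 'o \<Rightarrow> ('o \<Rightarrow> ('o, 'a, 'o, 'a) mfctr) \<Rightarrow> ('o \<Rightarrow> 'a) \<Rightarrow> 'a \<Rightarrow> 'a \<Rightarrow> 'a"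
where
  "substA R X S s f g = subst_trans R X S s g (Cod R f) \<cdot>\<^bsub>R\<^esub> farr (S (Dom R g)) f"


section \<open>The standard derivative and the chain rule\<close>

text \<open>
  The standard derivative is given by a rig map \<open>T : R \<rightarrow> R[\<epsilon>]\<close> with an isomorphism
  \<open>t : T X \<rightarrow> (X, \<one>)\<close>.
\<close>

definition standard_derivation ::
  "('j, 'k) cat set \<Rightarrow> ('o, 'a) smcat \<Rightarrow> 'o \<Rightarrow>
   ('o, 'a, 'o \<times> 'o, 'a \<times> 'a) mfctr \<Rightarrow> 'a \<times> 'a \<Rightarrow> bool"
where
  "standard_derivation \<A> R X T t \<longleftrightarrow>
     rig_map \<A> R (dual_numbers R) T \<and>
     iso_between (dual_numbers R) t (fobj T X) (X, \<one>\<^bsub>R\<^esub>)"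

definition deriv :: "('o, 'a, 'o \<times> 'o, 'a \<times> 'a) mfctr \<Rightarrow> 'o \<Rightarrow> 'o" where
  "deriv T F = snd (fobj T F)"

definition derivA :: "('o, 'a, 'o \<times> 'o, 'a \<times> 'a) mfctr \<Rightarrow> 'a \<Rightarrow> 'a" where
  "derivA T f = snd (farr T f)"

text \<open>
  The first component of \<open>T\<close> sends \<open>X\<close> to \<open>X\<close> up to isomorphism, so it is canonically isomorphic to
  the identity rig map.
\<close>

definition first_component_trans ::
  "('o, 'a) smcat \<Rightarrow> 'o \<Rightarrow> ('o, 'a, 'o \<times> 'o, 'a \<times> 'a) mfctr \<Rightarrow> 'a \<times> 'a \<Rightarrow> 'o \<Rightarrow> 'a"
where
  "first_component_trans R X T t =
     (THE \<tau>. monoidal_trans R R (comp_mfctr R (dual_proj R) T) (id_mfctr R) \<tau> \<and> \<tau> X = fst t)"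

text \<open>
  Canonicity of a family \<open>\<phi> F : (F \<circ> G)' \<rightarrow> (F' \<circ> G) \<otimes> G'\<close>, for fixed \<open>G\<close>.  Both sides are second
  components of rig maps \<open>R \<rightarrow> R[\<epsilon>]\<close> in \<open>F\<close>: of \<open>F \<mapsto> T (F \<circ> G)\<close>, and of \<open>T\<close> followed by
  \<open>(A, M) \<mapsto> (A \<circ> G, (M \<circ> G) \<otimes> G')\<close>.  The family \<open>\<phi>\<close> is canonical if, together with the identification
  of the first components with \<open>F \<circ> G\<close>, it is a monoidal transformation between these rig maps, and
  at \<open>X\<close> it becomes the identity of \<open>G'\<close> under
  \<open>X \<circ> G \<cong> G\<close> and \<open>(X' \<circ> G) \<otimes> G' \<cong> (\<one> \<circ> G) \<otimes> G' \<cong> \<one> \<otimes> G' \<cong> G'\<close>.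
\<close>

definition canonical_chain_rule ::
  "('o, 'a) smcat \<Rightarrow> 'o \<Rightarrow> ('o \<Rightarrow> ('o, 'a, 'o, 'a) mfctr) \<Rightarrow> ('o \<Rightarrow> 'a) \<Rightarrow>
   ('o, 'a, 'o \<times> 'o, 'a \<times> 'a) mfctr \<Rightarrow> 'a \<times> 'a \<Rightarrow> 'o \<Rightarrow> ('o \<Rightarrow> 'a) \<Rightarrow> bool"
where
  "canonical_chain_rule R X S s T t G \<phi> \<longleftrightarrow>
     (let \<tau> = first_component_trans R X T t in
      monoidal_trans R (dual_numbers R)
        (comp_mfctr (dual_numbers R) T (S G))
        (comp_mfctr (dual_numbers R) (dual_extension R R (S G) (deriv T G)) T)
        (\<lambda>F\<in>Obj R. (inverse_arr R (farr (S G) (\<tau> F)) \<cdot>\<^bsub>R\<^esub> \<tau> (subst S F G), \<phi> F))) \<and>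
     Lun R (deriv T G)
       \<cdot>\<^bsub>R\<^esub> (inverse_arr R (munit (S G)) \<odot>\<^bsub>R\<^esub> Ide R (deriv T G))
       \<cdot>\<^bsub>R\<^esub> (farr (S G) (snd t) \<odot>\<^bsub>R\<^esub> Ide R (deriv T G))
       \<cdot>\<^bsub>R\<^esub> \<phi> X
     = derivA T (s G)"

end

theory Submission
  imports Defs
begin

text \<open>
  Fix \<open>G\<close>.  Both sides of the chain rule, as functors of \<open>F\<close>, are second components of rig maps from
  \<open>R\<close> to the dual numbers \<open>R[\<epsilon>]\<close>: the left side of \<open>F \<mapsto> T (F \<circ> G)\<close>, and the right side of \<open>T\<close>
  followed by \<open>(A, M) \<mapsto> (A \<circ> G, (M \<circ> G) \<otimes> G')\<close>.  Both maps send the generator \<open>X\<close> to an object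
  isomorphic to \<open>(G, G')\<close>.  As \<open>R\<close> is free on \<open>X\<close>, evaluation at \<open>X\<close> is fully faithful on rig maps and
  monoidal transformations, so this isomorphism at \<open>X\<close> is the value of exactly one monoidal
  transformation, and its inverse is the value of an inverse transformation
  (\<open>free_rig_lift\<close>, \<open>free_rig_invertible\<close>).  The second component of that transformation is the chain
  rule isomorphism.  Its uniqueness, its naturality in \<open>G\<close> and the shape of its first component
  all follow in the same way, by comparing two monoidal transformations at \<open>X\<close> only.

  The one thing that freeness does not give is that \<open>(A, M) \<mapsto> (H A, H M \<otimes> Q)\<close> is a rig map between
  dual numbers for every rig map \<open>H\<close> and every object \<open>Q\<close>.  This is proved in two steps.  The functor
  \<open>K = H - \<otimes> Q\<close> carries a left and a right action of \<open>H\<close>, the right one moving \<open>Q\<close> to the outside by the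
  symmetry; that the actions are compatible is pure coherence in a symmetric monoidal category
  (\<open>assoc_inverse_assoc\<close>, \<open>assoc_move_inverse\<close>, \<open>assoc_move_move\<close>, \<open>dual_extension_dual_functor\<close>).
  And for any cocontinuous \<open>K\<close> with two such actions, \<open>(A, M) \<mapsto> (H A, K M)\<close> is a rig map, because each
  axiom of a monoidal functor, restricted to one summand of the tensor product \<open>A \<otimes> N + M \<otimes> B\<close>, is one
  axiom of the actions, or is trivial as the summand is initial (locale \<open>dual_functor\<close>).
\<close>

section \<open>Arrows, isomorphisms and functors\<close>

text \<open>An arrow determines its source and target, so this form of invertibility can serve as a premise of
  rewrite rules, where \<open>iso_between\<close> would leave the two objects undetermined.\<close>

definition invertible :: "('o, 'a, 'm) cat_scheme \<Rightarrow> 'a \<Rightarrow> bool" where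
  "invertible C f \<longleftrightarrow> iso_between C f (Dom C f) (Cod C f)"

lemma in_hom: "f \<in> hom C a b \<longleftrightarrow> f \<in> Arr C \<and> Dom C f = a \<and> Cod C f = b"
  by (simp add: hom_def)

lemma iso_between_iff: "iso_between C f a b \<longleftrightarrow> f \<in> hom C a b \<and> invertible C f"
  by (auto simp: invertible_def iso_between_def in_hom)

text \<open>The axioms are restated with premises about \<open>Dom\<close> and \<open>Cod\<close> in place of membership in hom sets.  The
  intermediate objects of a composite then do not have to be guessed, and the simplifier checks
  composability by computing sources and targets.\<close>

context category
begin

lemmas [simp] = dom_obj cod_obj

lemma ide_simps [simp]:
  assumes "a \<in> Obj C"
  shows "Ide C a \<in> Arr C" "Dom C (Ide C a) = a" "Cod C (Ide C a) = a"
  using ide_hom[OF assms] by (auto simp: in_hom)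

lemma comp_simps [simp]:
  assumes "f \<in> Arr C" "g \<in> Arr C" "Cod C f = Dom C g"
  shows "g \<cdot> f \<in> Arr C" "Dom C (g \<cdot> f) = Dom C f" "Cod C (g \<cdot> f) = Cod C g"
  using comp_hom[of f "Dom C f" "Dom C g" g "Cod C g"] assms by (auto simp: in_hom)

lemma comp_ide [simp]:
  "f \<in> Arr C \<Longrightarrow> Dom C f = a \<Longrightarrow> f \<cdot> Ide C a = f"
  "f \<in> Arr C \<Longrightarrow> Cod C f = a \<Longrightarrow> Ide C a \<cdot> f = f"
  using comp_ide_right[of f a] comp_ide_left[of f _ a] by (auto simp: in_hom)

lemma assoc_right [simp]:
  "f \<in> Arr C \<Longrightarrow> g \<in> Arr C \<Longrightarrow> h \<in> Arr C \<Longrightarrow> Cod C f = Dom C g \<Longrightarrow> Cod C g = Dom C h \<Longrightarrow>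
   (h \<cdot> g) \<cdot> f = h \<cdot> (g \<cdot> f)"
  by (rule comp_assoc[of f "Dom C f" "Cod C f" g "Cod C g" h "Cod C h"]) (auto simp: in_hom)

text \<open>Composites are normalised to the right, so an equation between composites of two arrows matches a
  longer composite only in this form.\<close>

lemma rewrite_prefix:
  "g \<cdot> f = k \<Longrightarrow> f \<in> Arr C \<Longrightarrow> g \<in> Arr C \<Longrightarrow> x \<in> Arr C \<Longrightarrow> Cod C x = Dom C f \<Longrightarrow> Cod C f = Dom C g \<Longrightarrow>
   g \<cdot> (f \<cdot> x) = k \<cdot> x"
  using assoc_right[of x f g] by simp

lemma inverse_unique:
  assumes "f \<in> hom C a b" "g \<in> hom C b a" "g \<cdot> f = Ide C a" "f \<cdot> g = Ide C b"
  shows "inverse_arr C f = g"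
proof -
  have uniq: "g' = g" if "g' \<in> hom C b a" "g' \<cdot> f = Ide C a" for g'
  proof -
    have "g' = g' \<cdot> (f \<cdot> g)"
      using that assms(4) by (simp add: in_hom)
    also have "\<dots> = (g' \<cdot> f) \<cdot> g"
      by (rule assoc_right[symmetric]) (use that assms(1,2) in \<open>auto simp: in_hom\<close>)
    also have "\<dots> = g"
      using that assms(2) by (simp add: in_hom)
    finally show ?thesis .
  qed
  have ab: "Dom C f = a" "Cod C f = b"
    using assms(1) by (simp_all add: in_hom)
  show ?thesis
    unfolding inverse_arr_def ab by (rule the_equality) (use assms uniq in blast)+
qed

lemma invertibleI:
  assumes "f \<in> hom C a b" "g \<in> hom C b a" "g \<cdot> f = Ide C a" "f \<cdot> g = Ide C b"
  shows "invertible C f" "inverse_arr C f = g"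
proof -
  have ab: "Dom C f = a" "Cod C f = b"
    using assms(1) by (simp_all add: in_hom)
  show "invertible C f"
    unfolding invertible_def iso_between_def ab using assms by blast
  show "inverse_arr C f = g"
    by (rule inverse_unique[OF assms])
qed

lemma invertible_simps [simp]:
  assumes "invertible C f"
  shows "f \<in> Arr C" "inverse_arr C f \<in> Arr C"
    "Dom C (inverse_arr C f) = Cod C f" "Cod C (inverse_arr C f) = Dom C f"
    "inverse_arr C f \<cdot> f = Ide C (Dom C f)" "f \<cdot> inverse_arr C f = Ide C (Cod C f)"
proof -
  obtain g where f: "f \<in> hom C (Dom C f) (Cod C f)"
    and g: "g \<in> hom C (Cod C f) (Dom C f)" "g \<cdot> f = Ide C (Dom C f)" "f \<cdot> g = Ide C (Cod C f)"
    using assms by (auto simp: invertible_def iso_between_def)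
  have "inverse_arr C f = g"
    using inverse_unique[OF f g] .
  with f g show "f \<in> Arr C" "inverse_arr C f \<in> Arr C"
    "Dom C (inverse_arr C f) = Cod C f" "Cod C (inverse_arr C f) = Dom C f"
    "inverse_arr C f \<cdot> f = Ide C (Dom C f)" "f \<cdot> inverse_arr C f = Ide C (Cod C f)"
    unfolding in_hom by metis+
qed

lemma invertible_cancel [simp]:
  assumes "invertible C f" "x \<in> Arr C"
  shows "Cod C x = Dom C f \<Longrightarrow> inverse_arr C f \<cdot> (f \<cdot> x) = x"
    and "Cod C x = Cod C f \<Longrightarrow> f \<cdot> (inverse_arr C f \<cdot> x) = x"
proof -
  show "inverse_arr C f \<cdot> (f \<cdot> x) = x" if "Cod C x = Dom C f"
    using rewrite_prefix[OF invertible_simps(5)[OF assms(1)], of x] assms that by simp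
  show "f \<cdot> (inverse_arr C f \<cdot> x) = x" if "Cod C x = Cod C f"
    using rewrite_prefix[OF invertible_simps(6)[OF assms(1)], of x] assms that by simp
qed

lemma invertible_inverse [simp]: "invertible C f \<Longrightarrow> invertible C (inverse_arr C f)"
  by (rule invertibleI[where g = f]) (auto simp: in_hom)

lemma invertible_ide [simp]: "a \<in> Obj C \<Longrightarrow> invertible C (Ide C a)"
  by (rule invertibleI[where g = "Ide C a"]) (auto simp: in_hom)

lemma invertible_comp [simp]:
  "invertible C f \<Longrightarrow> invertible C g \<Longrightarrow> Cod C f = Dom C g \<Longrightarrow> invertible C (g \<cdot> f)"
  by (rule invertibleI[where g = "inverse_arr C f \<cdot> inverse_arr C g"]) (auto simp: in_hom)

lemma mono_cancel:
  assumes "invertible C f" "f \<cdot> x = f \<cdot> y" "x \<in> Arr C" "y \<in> Arr C" "Cod C x = Dom C f" "Cod C y = Dom C f"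
  shows "x = y"
proof -
  have "inverse_arr C f \<cdot> (f \<cdot> x) = x" "inverse_arr C f \<cdot> (f \<cdot> y) = y"
    using assms(1,3-) by simp_all
  then show ?thesis
    unfolding assms(2) by simp
qed

lemma epi_cancel:
  assumes "invertible C f" "x \<cdot> f = y \<cdot> f" "x \<in> Arr C" "y \<in> Arr C" "Dom C x = Cod C f" "Dom C y = Cod C f"
  shows "x = y"
proof -
  have "(x \<cdot> f) \<cdot> inverse_arr C f = x" "(y \<cdot> f) \<cdot> inverse_arr C f = y"
    using assms(1,3-) by simp_all
  then show ?thesis
    unfolding assms(2) by simp
qed

lemma move_left:
  assumes "invertible C f" "f \<cdot> x = y" "x \<in> Arr C" "Cod C x = Dom C f"
  shows "x = inverse_arr C f \<cdot> y"
  using assms by auto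

lemma comp_eq_iff:
  assumes "invertible C f" "x \<in> Arr C" "Cod C x = Dom C f" "y \<in> Arr C" "Cod C y = Cod C f"
  shows "f \<cdot> x = y \<longleftrightarrow> x = inverse_arr C f \<cdot> y"
proof
  show "x = inverse_arr C f \<cdot> y" if "f \<cdot> x = y"
    using move_left[OF assms(1) that assms(2,3)] .
  show "f \<cdot> x = y" if "x = inverse_arr C f \<cdot> y"
    unfolding that using assms(1,4,5) by simp
qed

end

context is_functor
begin

lemma farr_simps [simp]:
  assumes "f \<in> Arr C"
  shows "farr F f \<in> Arr D" "Dom D (farr F f) = fobj F (Dom C f)" "Cod D (farr F f) = fobj F (Cod C f)"
  using farr_hom[of f "Dom C f" "Cod C f"] assms by (auto simp: in_hom)

lemmas [simp] = fobj_obj farr_ide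

lemma farr_comp' [simp]:
  "f \<in> Arr C \<Longrightarrow> g \<in> Arr C \<Longrightarrow> Cod C f = Dom C g \<Longrightarrow> farr F (g \<cdot>\<^bsub>C\<^esub> f) = farr F g \<cdot>\<^bsub>D\<^esub> farr F f"
  by (rule farr_comp[of f "Dom C f" "Cod C f" g "Cod C g"]) (auto simp: in_hom)

lemma farr_invertible [simp]:
  assumes "invertible C f"
  shows "invertible D (farr F f)"
proof (rule D.invertibleI[of _ "fobj F (Dom C f)" "fobj F (Cod C f)" "farr F (inverse_arr C f)"])
  have "farr F (inverse_arr C f \<cdot>\<^bsub>C\<^esub> f) = farr F (inverse_arr C f) \<cdot>\<^bsub>D\<^esub> farr F f"
    "farr F (f \<cdot>\<^bsub>C\<^esub> inverse_arr C f) = farr F f \<cdot>\<^bsub>D\<^esub> farr F (inverse_arr C f)"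
    by (rule farr_comp'; simp add: assms)+
  then show "farr F (inverse_arr C f) \<cdot>\<^bsub>D\<^esub> farr F f = Ide D (fobj F (Dom C f))"
    "farr F f \<cdot>\<^bsub>D\<^esub> farr F (inverse_arr C f) = Ide D (fobj F (Cod C f))"
    using assms by simp_all
qed (simp_all add: assms in_hom)

end

section \<open>Equivalences of categories are fully faithful\<close>

lemma (in category) nat_iso_component:
  assumes "nat_iso B C F G \<alpha>" "a \<in> Obj B"
  shows "invertible C (\<alpha> a)" "Dom C (\<alpha> a) = fobj F a" "Cod C (\<alpha> a) = fobj G a"
  using assms by (auto simp: nat_iso_def iso_between_iff in_hom)

lemma nat_trans_natural:
  assumes "nat_trans C D F G \<alpha>" "category C" "f \<in> Arr C"
  shows "\<alpha> (Cod C f) \<cdot>\<^bsub>D\<^esub> farr F f = farr G f \<cdot>\<^bsub>D\<^esub> \<alpha> (Dom C f)"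
proof -
  interpret category C by fact
  have "f \<in> hom C (Dom C f) (Cod C f)" "Dom C f \<in> Obj C" "Cod C f \<in> Obj C"
    using assms by (auto simp: in_hom)
  then show ?thesis
    using assms unfolding nat_trans_def by blast
qed

lemma equivalence_faithful:
  assumes "is_functor C D F" "is_functor D C K" "nat_iso C C id_fctr (comp_fctr K F) \<eta>"
    and "f \<in> hom C a b" "g \<in> hom C a b" "farr F f = farr F g"
  shows "f = g"
proof -
  interpret F: is_functor C D F by fact
  interpret K: is_functor D C K by fact
  have ab: "a \<in> Obj C" "b \<in> Obj C" "f \<in> Arr C" "g \<in> Arr C" "Dom C f = a" "Cod C f = b" "Dom C g = a" "Cod C g = b"
    using assms by (auto simp: in_hom)
  have nt: "nat_trans C C id_fctr (comp_fctr K F) \<eta>"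
    using assms by (auto simp: nat_iso_def)
  have "\<eta> b \<cdot>\<^bsub>C\<^esub> f = \<eta> b \<cdot>\<^bsub>C\<^esub> g"
    using nat_trans_natural[OF nt F.C.category_axioms, of f] nat_trans_natural[OF nt F.C.category_axioms, of g]
      assms ab by (simp add: id_fctr_def comp_fctr_def)
  then show ?thesis
    using F.C.nat_iso_component[OF assms(3)] ab F.C.mono_cancel[of "\<eta> b" f g] by (simp add: id_fctr_def)
qed

text \<open>The preimage of \<open>f\<close> is \<open>K f\<close> conjugated by the unit \<open>\<eta>\<close>.  It is mapped to \<open>f\<close> because its image and \<open>f\<close>
  agree after \<open>K\<close>, which is faithful by the same argument with the counit in place of the unit.\<close>

lemma equivalence_fully_faithful:
  fixes C :: "('o, 'a, 'm) cat_scheme" and D :: "('p, 'q, 'n) cat_scheme"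
    and F :: "('o, 'a, 'p, 'q, 'l) fctr_scheme"
  assumes "equivalence_of_categories C D F" "a \<in> Obj C" "b \<in> Obj C" "f \<in> hom D (fobj F a) (fobj F b)"
  shows "\<exists>!h. h \<in> hom C a b \<and> farr F h = f"
proof -
  obtain K :: "('p, 'q, 'o, 'a) fctr" and \<eta> \<theta> where F: "is_functor C D F" and K: "is_functor D C K"
    and \<eta>: "nat_iso C C id_fctr (comp_fctr K F) \<eta>" and \<theta>: "nat_iso D D (comp_fctr F K) id_fctr \<theta>"
    using assms(1) unfolding equivalence_of_categories_def by blast
  interpret F: is_functor C D F by fact
  interpret K: is_functor D C K by fact
  note \<eta>c [simp] = F.C.nat_iso_component[OF \<eta>, unfolded id_fctr_def comp_fctr_def, simplified]
  note \<theta>c [simp] = F.D.nat_iso_component[OF \<theta>, unfolded id_fctr_def comp_fctr_def, simplified]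
  have n\<eta>: "nat_trans C C id_fctr (comp_fctr K F) \<eta>" and n\<theta>: "nat_trans D D (comp_fctr F K) id_fctr \<theta>"
    using \<eta> \<theta> by (auto simp: nat_iso_def)
  have f: "f \<in> Arr D" "Dom D f = fobj F a" "Cod D f = fobj F b"
    using assms(4) by (auto simp: in_hom)
  \<comment> \<open>Naturality of the counit recovers an arrow from its image under \<open>K\<close>.\<close>
  have K_faithful: "u = v" if "u \<in> hom D x y" "v \<in> hom D x y" "farr K u = farr K v" for u v x y
  proof -
    have xy: "x \<in> Obj D" "y \<in> Obj D" "u \<in> Arr D" "v \<in> Arr D" "Dom D u = x" "Cod D u = y" "Dom D v = x" "Cod D v = y"
      using that by (auto simp: in_hom)
    have "u \<cdot>\<^bsub>D\<^esub> \<theta> x = v \<cdot>\<^bsub>D\<^esub> \<theta> x"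
      using nat_trans_natural[OF n\<theta> F.D.category_axioms, of u]
        nat_trans_natural[OF n\<theta> F.D.category_axioms, of v] that xy
      by (simp add: id_fctr_def comp_fctr_def)
    then show ?thesis
      using xy F.D.epi_cancel[of "\<theta> x" u v] by simp
  qed
  define h where "h = inverse_arr C (\<eta> b) \<cdot>\<^bsub>C\<^esub> (farr K f \<cdot>\<^bsub>C\<^esub> \<eta> a)"
  have h: "h \<in> Arr C" "Dom C h = a" "Cod C h = b"
    using assms f by (simp_all add: h_def)
  have "farr K (farr F h) \<cdot>\<^bsub>C\<^esub> \<eta> a = \<eta> b \<cdot>\<^bsub>C\<^esub> h"
    using nat_trans_natural[OF n\<eta> F.C.category_axioms, of h] h by (simp add: id_fctr_def comp_fctr_def)
  also have "\<dots> = farr K f \<cdot>\<^bsub>C\<^esub> \<eta> a"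
    using assms f by (simp add: h_def)
  finally have "farr K (farr F h) = farr K f"
    using assms f h F.C.epi_cancel[of "\<eta> a" "farr K (farr F h)" "farr K f"] by simp
  then have "farr F h = f"
    using K_faithful[of "farr F h" "fobj F a" "fobj F b" f] h f by (simp add: in_hom)
  moreover have "h \<in> hom C a b"
    using h by (simp add: in_hom)
  ultimately show ?thesis
    using equivalence_faithful[OF F K \<eta>] by blast
qed

section \<open>Coherence in symmetric monoidal categories\<close>

text \<open>The canonical arrow \<open>(m \<otimes> q) \<otimes> b \<rightarrow> (m \<otimes> b) \<otimes> q\<close> of a symmetric monoidal category.\<close>

definition move :: "('o, 'a, 'm) smcat_scheme \<Rightarrow> 'o \<Rightarrow> 'o \<Rightarrow> 'o \<Rightarrow> 'a" where
  "move C m q b = inverse_arr C (Assoc C m b q) \<cdot>\<^bsub>C\<^esub> (Ide C m \<odot>\<^bsub>C\<^esub> Swap C q b) \<cdot>\<^bsub>C\<^esub> Assoc C m q b"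

context symmetric_monoidal_category
begin

lemmas [simp] = unit_obj tensor_obj tensor_ide

lemma tensorA_simps [simp]:
  assumes "f \<in> Arr C" "g \<in> Arr C"
  shows "f \<odot> g \<in> Arr C" "Dom C (f \<odot> g) = Dom C f \<otimes> Dom C g" "Cod C (f \<odot> g) = Cod C f \<otimes> Cod C g"
  using tensor_hom[of f "Dom C f" "Cod C f" g "Dom C g" "Cod C g"] assms by (auto simp: in_hom)

lemma interchange [simp]:
  "f \<in> Arr C \<Longrightarrow> f' \<in> Arr C \<Longrightarrow> g \<in> Arr C \<Longrightarrow> g' \<in> Arr C \<Longrightarrow> Cod C f = Dom C f' \<Longrightarrow> Cod C g = Dom C g' \<Longrightarrow>
   (f' \<odot> g') \<cdot> (f \<odot> g) = (f' \<cdot> f) \<odot> (g' \<cdot> g)"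
  by (rule tensor_comp[symmetric]) (auto simp: in_hom)

lemma interchange_prefix [simp]:
  "f \<in> Arr C \<Longrightarrow> f' \<in> Arr C \<Longrightarrow> g \<in> Arr C \<Longrightarrow> g' \<in> Arr C \<Longrightarrow> Cod C f = Dom C f' \<Longrightarrow> Cod C g = Dom C g' \<Longrightarrow>
   x \<in> Arr C \<Longrightarrow> Cod C x = Dom C f \<otimes> Dom C g \<Longrightarrow>
   (f' \<odot> g') \<cdot> ((f \<odot> g) \<cdot> x) = ((f' \<cdot> f) \<odot> (g' \<cdot> g)) \<cdot> x"
  by (rule rewrite_prefix[OF interchange]) simp_all

lemma tensor_invertible [simp]:
  assumes "invertible C f" "invertible C g"
  shows "invertible C (f \<odot> g)" "inverse_arr C (f \<odot> g) = inverse_arr C f \<odot> inverse_arr C g"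
  by (rule invertibleI[of "f \<odot> g" "Dom C (f \<odot> g)" "Cod C (f \<odot> g)" "inverse_arr C f \<odot> inverse_arr C g"];
      simp add: assms in_hom)+

lemma unitor_simps [simp]:
  assumes "a \<in> Obj C"
  shows "invertible C (Lun C a)" "Dom C (Lun C a) = \<one> \<otimes> a" "Cod C (Lun C a) = a"
    "invertible C (Run C a)" "Dom C (Run C a) = a \<otimes> \<one>" "Cod C (Run C a) = a"
  using lun_iso[of a] run_iso[of a] assms by (auto simp: iso_between_iff in_hom)

lemma swap_simps [simp]:
  assumes "a \<in> Obj C" "b \<in> Obj C"
  shows "Swap C a b \<in> Arr C" "Dom C (Swap C a b) = a \<otimes> b" "Cod C (Swap C a b) = b \<otimes> a"
  using swap_hom[of a b] assms by (auto simp: in_hom)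

lemma assoc_simps [simp]:
  assumes "a \<in> Obj C" "b \<in> Obj C" "c \<in> Obj C"
  shows "invertible C (Assoc C a b c)" "Dom C (Assoc C a b c) = (a \<otimes> b) \<otimes> c"
    "Cod C (Assoc C a b c) = a \<otimes> (b \<otimes> c)"
  using assoc_iso[OF assms] by (auto simp: iso_between_iff in_hom)

lemma swap_invertible [simp]:
  assumes "a \<in> Obj C" "b \<in> Obj C"
  shows "invertible C (Swap C a b)" "inverse_arr C (Swap C a b) = Swap C b a"
  by (rule invertibleI[of "Swap C a b" "a \<otimes> b" "b \<otimes> a" "Swap C b a"];
      simp add: assms in_hom swap_swap)+

lemma swap_swap_simps [simp]:
  "a \<in> Obj C \<Longrightarrow> b \<in> Obj C \<Longrightarrow> Swap C b a \<cdot> Swap C a b = Ide C (a \<otimes> b)"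
  "a \<in> Obj C \<Longrightarrow> b \<in> Obj C \<Longrightarrow> x \<in> Arr C \<Longrightarrow> Cod C x = a \<otimes> b \<Longrightarrow> Swap C b a \<cdot> (Swap C a b \<cdot> x) = x"
  using swap_swap[of a b] rewrite_prefix[OF swap_swap, of a b x] by simp_all

lemma assoc_natural:
  "f \<in> Arr C \<Longrightarrow> g \<in> Arr C \<Longrightarrow> h \<in> Arr C \<Longrightarrow>
   Assoc C (Cod C f) (Cod C g) (Cod C h) \<cdot> ((f \<odot> g) \<odot> h) = (f \<odot> (g \<odot> h)) \<cdot> Assoc C (Dom C f) (Dom C g) (Dom C h)"
  by (rule assoc_nat) (auto simp: in_hom)

lemma swap_natural:
  "f \<in> Arr C \<Longrightarrow> g \<in> Arr C \<Longrightarrow>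
   Swap C (Cod C f) (Cod C g) \<cdot> (f \<odot> g) = (g \<odot> f) \<cdot> Swap C (Dom C f) (Dom C g)"
  by (rule swap_nat) (auto simp: in_hom)

lemma lun_natural: "f \<in> Arr C \<Longrightarrow> Lun C (Cod C f) \<cdot> (Ide C \<one> \<odot> f) = f \<cdot> Lun C (Dom C f)"
  by (rule lun_nat) (auto simp: in_hom)

lemma run_natural: "f \<in> Arr C \<Longrightarrow> Run C (Cod C f) \<cdot> (f \<odot> Ide C \<one>) = f \<cdot> Run C (Dom C f)"
  by (rule run_nat) (auto simp: in_hom)

lemma assoc_inverse_natural:
  assumes "f \<in> Arr C" "g \<in> Arr C" "h \<in> Arr C"
  shows "inverse_arr C (Assoc C (Cod C f) (Cod C g) (Cod C h)) \<cdot> (f \<odot> (g \<odot> h))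
    = ((f \<odot> g) \<odot> h) \<cdot> inverse_arr C (Assoc C (Dom C f) (Dom C g) (Dom C h))"
proof (rule mono_cancel[of "Assoc C (Cod C f) (Cod C g) (Cod C h)"])
  show "Assoc C (Cod C f) (Cod C g) (Cod C h) \<cdot> (inverse_arr C (Assoc C (Cod C f) (Cod C g) (Cod C h)) \<cdot> (f \<odot> (g \<odot> h)))
    = Assoc C (Cod C f) (Cod C g) (Cod C h) \<cdot> (((f \<odot> g) \<odot> h) \<cdot> inverse_arr C (Assoc C (Dom C f) (Dom C g) (Dom C h)))"
    using assms by (simp add: rewrite_prefix[OF assoc_natural])
qed (use assms in simp_all)

lemma unit_tensor_faithful:
  assumes "f \<in> Arr C" "g \<in> Arr C" "Dom C f = Dom C g" "Cod C f = Cod C g"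
  shows "Ide C \<one> \<odot> f = Ide C \<one> \<odot> g \<Longrightarrow> f = g" and "f \<odot> Ide C \<one> = g \<odot> Ide C \<one> \<Longrightarrow> f = g"
proof -
  show "f = g" if "Ide C \<one> \<odot> f = Ide C \<one> \<odot> g"
  proof (rule epi_cancel[of "Lun C (Dom C f)"])
    show "f \<cdot> Lun C (Dom C f) = g \<cdot> Lun C (Dom C f)"
      unfolding lun_natural[OF assms(1), symmetric]
      using lun_natural[OF assms(2)] by (simp only: that assms(3,4))
  qed (use assms in simp_all)
  show "f = g" if "f \<odot> Ide C \<one> = g \<odot> Ide C \<one>"
  proof (rule epi_cancel[of "Run C (Dom C f)"])
    show "f \<cdot> Run C (Dom C f) = g \<cdot> Run C (Dom C f)"
      unfolding run_natural[OF assms(1), symmetric]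
      using run_natural[OF assms(2)] by (simp only: that assms(3,4))
  qed (use assms in simp_all)
qed

text \<open>Kelly's argument: after tensoring with the unit, which is faithful, the pentagon for \<open>\<one>, \<one>, x, y\<close>
  reduces the claim to two instances of the triangle.\<close>

lemma lun_tensor:
  assumes [simp]: "x \<in> Obj C" "y \<in> Obj C"
  shows "Lun C (x \<otimes> y) \<cdot> Assoc C \<one> x y = Lun C x \<odot> Ide C y"
proof (rule unit_tensor_faithful(1))
  have n: "Assoc C \<one> x y \<cdot> ((Ide C \<one> \<odot> Lun C x) \<odot> Ide C y) = (Ide C \<one> \<odot> (Lun C x \<odot> Ide C y)) \<cdot> Assoc C \<one> (\<one> \<otimes> x) y"
    using assoc_natural[of "Ide C \<one>" "Lun C x" "Ide C y"] by simp
  let ?I = "Ide C \<one>" and ?e = "Assoc C \<one> (\<one> \<otimes> x) y \<cdot> (Assoc C \<one> \<one> x \<odot> Ide C y)"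
  show "?I \<odot> (Lun C (x \<otimes> y) \<cdot> Assoc C \<one> x y) = ?I \<odot> (Lun C x \<odot> Ide C y)"
  proof (rule epi_cancel[of ?e])
    have "(?I \<odot> (Lun C (x \<otimes> y) \<cdot> Assoc C \<one> x y)) \<cdot> ?e = (?I \<odot> Lun C (x \<otimes> y)) \<cdot> ((?I \<odot> Assoc C \<one> x y) \<cdot> ?e)"
      by simp
    also have "\<dots> = (?I \<odot> Lun C (x \<otimes> y)) \<cdot> (Assoc C \<one> \<one> (x \<otimes> y) \<cdot> Assoc C (\<one> \<otimes> \<one>) x y)"
      by (simp only: pentagon assms unit_obj)
    also have "\<dots> = (Run C \<one> \<odot> Ide C (x \<otimes> y)) \<cdot> Assoc C (\<one> \<otimes> \<one>) x y"
      by (subst rewrite_prefix[OF triangle]) simp_all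
    also have "\<dots> = Assoc C \<one> x y \<cdot> ((Run C \<one> \<odot> Ide C x) \<odot> Ide C y)"
      using assoc_natural[of "Run C \<one>" "Ide C x" "Ide C y"] by simp
    also have "\<dots> = Assoc C \<one> x y \<cdot> (((?I \<odot> Lun C x) \<odot> Ide C y) \<cdot> (Assoc C \<one> \<one> x \<odot> Ide C y))"
      by (simp flip: triangle)
    also have "\<dots> = (?I \<odot> (Lun C x \<odot> Ide C y)) \<cdot> ?e"
      by (simp add: rewrite_prefix[OF n] del: interchange interchange_prefix)
    finally show "(?I \<odot> (Lun C (x \<otimes> y) \<cdot> Assoc C \<one> x y)) \<cdot> ?e = (?I \<odot> (Lun C x \<odot> Ide C y)) \<cdot> ?e" .
  qed simp_all
qed simp_all

text \<open>The mirror image of \<open>lun_tensor\<close>.\<close>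

lemma run_tensor:
  assumes [simp]: "x \<in> Obj C" "y \<in> Obj C"
  shows "(Ide C x \<odot> Run C y) \<cdot> Assoc C x y \<one> = Run C (x \<otimes> y)"
proof (rule unit_tensor_faithful(2))
  have n: "Assoc C x y \<one> \<cdot> ((Ide C x \<odot> Run C y) \<odot> Ide C \<one>) = (Ide C x \<odot> (Run C y \<odot> Ide C \<one>)) \<cdot> Assoc C x (y \<otimes> \<one>) \<one>"
    using assoc_natural[of "Ide C x" "Run C y" "Ide C \<one>"] by simp
  have n': "(Ide C x \<odot> (Ide C y \<odot> Lun C \<one>)) \<cdot> Assoc C x y (\<one> \<otimes> \<one>) = Assoc C x y \<one> \<cdot> (Ide C (x \<otimes> y) \<odot> Lun C \<one>)"
    using assoc_natural[of "Ide C x" "Ide C y" "Lun C \<one>"] by simp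
  let ?I = "Ide C \<one>" and ?m = "Assoc C x y \<one>"
  show "((Ide C x \<odot> Run C y) \<cdot> Assoc C x y \<one>) \<odot> ?I = Run C (x \<otimes> y) \<odot> ?I"
  proof (rule mono_cancel[of ?m])
    have "?m \<cdot> (((Ide C x \<odot> Run C y) \<cdot> ?m) \<odot> ?I) = ?m \<cdot> (((Ide C x \<odot> Run C y) \<odot> ?I) \<cdot> (?m \<odot> ?I))"
      by simp
    also have "\<dots> = (Ide C x \<odot> (Run C y \<odot> ?I)) \<cdot> (Assoc C x (y \<otimes> \<one>) \<one> \<cdot> (?m \<odot> ?I))"
      by (simp add: rewrite_prefix[OF n] del: interchange interchange_prefix)
    also have "\<dots> = (Ide C x \<odot> (Ide C y \<odot> Lun C \<one>)) \<cdot> ((Ide C x \<odot> Assoc C y \<one> \<one>) \<cdot> (Assoc C x (y \<otimes> \<one>) \<one> \<cdot> (?m \<odot> ?I)))"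
      by (simp flip: triangle)
    also have "\<dots> = (Ide C x \<odot> (Ide C y \<odot> Lun C \<one>)) \<cdot> (Assoc C x y (\<one> \<otimes> \<one>) \<cdot> Assoc C (x \<otimes> y) \<one> \<one>)"
      by (simp only: pentagon assms unit_obj)
    also have "\<dots> = ?m \<cdot> (Ide C (x \<otimes> y) \<odot> Lun C \<one>) \<cdot> Assoc C (x \<otimes> y) \<one> \<one>"
      by (simp add: rewrite_prefix[OF n'])
    also have "\<dots> = ?m \<cdot> (Run C (x \<otimes> y) \<odot> ?I)"
      by (simp only: triangle assms unit_obj tensor_obj)
    finally show "?m \<cdot> (((Ide C x \<odot> Run C y) \<cdot> ?m) \<odot> ?I) = ?m \<cdot> (Run C (x \<otimes> y) \<odot> ?I)" .
  qed simp_all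
qed simp_all


text \<open>The hexagon for \<open>x, \<one>, \<one>\<close>, followed by the left unit constraint, becomes this equation tensored
  with \<open>\<one>\<close>, up to a symmetry on the left of both sides that is cancelled.\<close>

lemma lun_swap:
  assumes [simp]: "x \<in> Obj C"
  shows "Lun C x \<cdot> Swap C x \<one> = Run C x"
proof (rule unit_tensor_faithful(2))
  let ?I = "Ide C \<one>"
  have n1: "Lun C (\<one> \<otimes> x) \<cdot> (?I \<odot> Swap C x \<one>) = Swap C x \<one> \<cdot> Lun C (x \<otimes> \<one>)"
    using lun_natural[of "Swap C x \<one>"] by simp
  have n2: "(Lun C \<one> \<odot> Ide C x) \<cdot> Swap C x (\<one> \<otimes> \<one>) = Swap C x \<one> \<cdot> (Ide C x \<odot> Lun C \<one>)"
    using swap_natural[of "Ide C x" "Lun C \<one>"] by simp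
  show "(Lun C x \<cdot> Swap C x \<one>) \<odot> ?I = Run C x \<odot> ?I"
  proof (rule mono_cancel[of "Swap C x \<one>"])
    have "Swap C x \<one> \<cdot> ((Lun C x \<cdot> Swap C x \<one>) \<odot> ?I) = Swap C x \<one> \<cdot> ((Lun C x \<odot> ?I) \<cdot> (Swap C x \<one> \<odot> ?I))"
      by simp
    also have "\<dots> = Swap C x \<one> \<cdot> ((Lun C (x \<otimes> \<one>) \<cdot> Assoc C \<one> x \<one>) \<cdot> (Swap C x \<one> \<odot> ?I))"
      by (simp only: lun_tensor assms unit_obj)
    also have "\<dots> = Lun C (\<one> \<otimes> x) \<cdot> ((?I \<odot> Swap C x \<one>) \<cdot> (Assoc C \<one> x \<one> \<cdot> (Swap C x \<one> \<odot> ?I)))"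
      by (simp add: rewrite_prefix[OF n1])
    also have "\<dots> = Lun C (\<one> \<otimes> x) \<cdot> (Assoc C \<one> \<one> x \<cdot> (Swap C x (\<one> \<otimes> \<one>) \<cdot> Assoc C x \<one> \<one>))"
      by (simp only: hexagon assms unit_obj)
    also have "\<dots> = (Lun C \<one> \<odot> Ide C x) \<cdot> (Swap C x (\<one> \<otimes> \<one>) \<cdot> Assoc C x \<one> \<one>)"
      by (simp add: rewrite_prefix[OF lun_tensor])
    also have "\<dots> = Swap C x \<one> \<cdot> ((Ide C x \<odot> Lun C \<one>) \<cdot> Assoc C x \<one> \<one>)"
      by (simp add: rewrite_prefix[OF n2])
    also have "\<dots> = Swap C x \<one> \<cdot> (Run C x \<odot> ?I)"
      by (simp only: triangle assms unit_obj)
    finally show "Swap C x \<one> \<cdot> ((Lun C x \<cdot> Swap C x \<one>) \<odot> ?I) = Swap C x \<one> \<cdot> (Run C x \<odot> ?I)" .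
  qed simp_all
qed simp_all

lemma move_simps [simp]:
  assumes "m \<in> Obj C" "q \<in> Obj C" "b \<in> Obj C"
  shows "invertible C (move C m q b)" "Dom C (move C m q b) = (m \<otimes> q) \<otimes> b" "Cod C (move C m q b) = (m \<otimes> b) \<otimes> q"
  using assms by (simp_all add: move_def)

lemma move_natural:
  assumes [simp]: "f \<in> Arr C" "g \<in> Arr C" "h \<in> Arr C"
  shows "move C (Cod C f) (Cod C g) (Cod C h) \<cdot> ((f \<odot> g) \<odot> h) = ((f \<odot> h) \<odot> g) \<cdot> move C (Dom C f) (Dom C g) (Dom C h)"
proof -
  have s: "Swap C (Cod C g) (Cod C h) \<cdot> (g \<odot> h) = (h \<odot> g) \<cdot> Swap C (Dom C g) (Dom C h)"
    using swap_natural[of g h] by simp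
  have i: "((f \<odot> h) \<odot> g) \<cdot> (inverse_arr C (Assoc C (Dom C f) (Dom C h) (Dom C g)))
    = inverse_arr C (Assoc C (Cod C f) (Cod C h) (Cod C g)) \<cdot> (f \<odot> (h \<odot> g))"
    using assoc_inverse_natural[of f h g] by simp
  show ?thesis
    by (simp add: move_def assoc_natural rewrite_prefix[OF i] s)
qed

text \<open>This and the next lemmas are the coherence laws of the actions \<open>a \<otimes> (n \<otimes> q) \<rightarrow> (a \<otimes> n) \<otimes> q\<close> and
  \<open>(m \<otimes> q) \<otimes> b \<rightarrow> (m \<otimes> b) \<otimes> q\<close> on objects of the form \<open>n \<otimes> q\<close>.  Here both factors act from the left, and
  the law is the pentagon, rewritten for inverse associators.\<close>

lemma assoc_inverse_assoc:
  assumes [simp]: "a \<in> Obj C" "b \<in> Obj C" "p \<in> Obj C" "q \<in> Obj C"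
  shows "(Assoc C a b p \<odot> Ide C q) \<cdot> inverse_arr C (Assoc C (a \<otimes> b) p q)
    = inverse_arr C (Assoc C a (b \<otimes> p) q) \<cdot> (Ide C a \<odot> inverse_arr C (Assoc C b p q)) \<cdot> Assoc C a b (p \<otimes> q)"
proof (rule epi_cancel[of "Assoc C (a \<otimes> b) p q"])
  have "(inverse_arr C (Assoc C a (b \<otimes> p) q) \<cdot> (Ide C a \<odot> inverse_arr C (Assoc C b p q)) \<cdot> Assoc C a b (p \<otimes> q)) \<cdot> Assoc C (a \<otimes> b) p q
    = inverse_arr C (Assoc C a (b \<otimes> p) q) \<cdot> (Ide C a \<odot> inverse_arr C (Assoc C b p q)) \<cdot> (Assoc C a b (p \<otimes> q) \<cdot> Assoc C (a \<otimes> b) p q)"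
    by simp
  also have "\<dots> = Assoc C a b p \<odot> Ide C q"
    by (simp flip: pentagon)
  finally show "((Assoc C a b p \<odot> Ide C q) \<cdot> inverse_arr C (Assoc C (a \<otimes> b) p q)) \<cdot> Assoc C (a \<otimes> b) p q =
    (inverse_arr C (Assoc C a (b \<otimes> p) q) \<cdot> (Ide C a \<odot> inverse_arr C (Assoc C b p q)) \<cdot> Assoc C a b (p \<otimes> q)) \<cdot> Assoc C (a \<otimes> b) p q"
    by simp
qed simp_all

text \<open>The actions from the two sides commute: two pentagons, joined by naturality of the associator in
  the symmetry of \<open>q\<close> and \<open>d\<close>.\<close>

lemma assoc_move_inverse:
  assumes [simp]: "a \<in> Obj C" "n \<in> Obj C" "d \<in> Obj C" "q \<in> Obj C"
  shows "(Assoc C a n d \<odot> Ide C q) \<cdot> move C (a \<otimes> n) q d \<cdot> (inverse_arr C (Assoc C a n q) \<odot> Ide C d)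
    = inverse_arr C (Assoc C a (n \<otimes> d) q) \<cdot> (Ide C a \<odot> move C n q d) \<cdot> Assoc C a (n \<otimes> q) d"
proof -
  have "Assoc C a n (q \<otimes> d) \<cdot> (Assoc C (a \<otimes> n) q d \<cdot> (inverse_arr C (Assoc C a n q) \<odot> Ide C d))
    = (Ide C a \<odot> Assoc C n q d) \<cdot> Assoc C a (n \<otimes> q) d"
    by (simp add: rewrite_prefix[OF pentagon[symmetric]])
  then have h1: "Assoc C (a \<otimes> n) q d \<cdot> (inverse_arr C (Assoc C a n q) \<odot> Ide C d)
    = inverse_arr C (Assoc C a n (q \<otimes> d)) \<cdot> ((Ide C a \<odot> Assoc C n q d) \<cdot> Assoc C a (n \<otimes> q) d)"
    by (intro move_left) simp_all
  have h2: "(Ide C (a \<otimes> n) \<odot> Swap C q d) \<cdot> inverse_arr C (Assoc C a n (q \<otimes> d))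
    = inverse_arr C (Assoc C a n (d \<otimes> q)) \<cdot> (Ide C a \<odot> (Ide C n \<odot> Swap C q d))"
    using assoc_inverse_natural[of "Ide C a" "Ide C n" "Swap C q d"] by simp
  show ?thesis
    by (simp add: move_def h1 rewrite_prefix[OF h2] rewrite_prefix[OF assoc_inverse_assoc])
qed

text \<open>The hexagon, in a form that replaces two successive symmetries by one.\<close>

lemma move_swap:
  assumes [simp]: "b \<in> Obj C" "d \<in> Obj C" "q \<in> Obj C"
  shows "move C b q d \<cdot> (Swap C q b \<odot> Ide C d) = Swap C q (b \<otimes> d) \<cdot> Assoc C q b d"
proof -
  have "move C b q d \<cdot> (Swap C q b \<odot> Ide C d)
    = inverse_arr C (Assoc C b d q) \<cdot> ((Ide C b \<odot> Swap C q d) \<cdot> Assoc C b q d \<cdot> (Swap C q b \<odot> Ide C d))"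
    by (simp add: move_def)
  also have "\<dots> = Swap C q (b \<otimes> d) \<cdot> Assoc C q b d"
    by (simp flip: hexagon)
  finally show ?thesis .
qed

text \<open>Both factors act from the right.  The inner \<open>move\<close> is unfolded, which reduces the claim to
  \<open>assoc_move_inverse\<close> and the hexagon.\<close>

lemma assoc_move_move:
  assumes [simp]: "m \<in> Obj C" "b \<in> Obj C" "d \<in> Obj C" "q \<in> Obj C"
  shows "(Assoc C m b d \<odot> Ide C q) \<cdot> move C (m \<otimes> b) q d \<cdot> (move C m q b \<odot> Ide C d)
    = move C m q (b \<otimes> d) \<cdot> Assoc C (m \<otimes> q) b d"
proof -
  have n: "Assoc C m (b \<otimes> q) d \<cdot> ((Ide C m \<odot> Swap C q b) \<odot> Ide C d)
    = (Ide C m \<odot> (Swap C q b \<odot> Ide C d)) \<cdot> Assoc C m (q \<otimes> b) d"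
    using assoc_natural[of "Ide C m" "Swap C q b" "Ide C d"] by simp
  have "(Assoc C m b d \<odot> Ide C q) \<cdot> move C (m \<otimes> b) q d \<cdot> (move C m q b \<odot> Ide C d)
    = ((Assoc C m b d \<odot> Ide C q) \<cdot> move C (m \<otimes> b) q d \<cdot> (inverse_arr C (Assoc C m b q) \<odot> Ide C d)) \<cdot>
      ((Ide C m \<odot> Swap C q b) \<odot> Ide C d) \<cdot> (Assoc C m q b \<odot> Ide C d)"
    by (simp add: move_def[of C m q b])
  also have "\<dots> = inverse_arr C (Assoc C m (b \<otimes> d) q) \<cdot> (Ide C m \<odot> (move C b q d \<cdot> (Swap C q b \<odot> Ide C d)))
      \<cdot> Assoc C m (q \<otimes> b) d \<cdot> (Assoc C m q b \<odot> Ide C d)"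
    unfolding assoc_move_inverse[OF assms(1,2,3,4)]
    by (simp add: rewrite_prefix[OF n] del: interchange)
  also have "\<dots> = inverse_arr C (Assoc C m (b \<otimes> d) q) \<cdot> (Ide C m \<odot> Swap C q (b \<otimes> d)) \<cdot>
      ((Ide C m \<odot> Assoc C q b d) \<cdot> Assoc C m (q \<otimes> b) d \<cdot> (Assoc C m q b \<odot> Ide C d))"
    by (simp add: move_swap)
  also have "\<dots> = inverse_arr C (Assoc C m (b \<otimes> d) q) \<cdot> (Ide C m \<odot> Swap C q (b \<otimes> d)) \<cdot>
      (Assoc C m q (b \<otimes> d) \<cdot> Assoc C (m \<otimes> q) b d)"
    by (simp only: pentagon assms)
  also have "\<dots> = move C m q (b \<otimes> d) \<cdot> Assoc C (m \<otimes> q) b d"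
    by (simp add: move_def)
  finally show ?thesis .
qed

lemma lun_assoc_inverse:
  assumes [simp]: "m \<in> Obj C" "q \<in> Obj C"
  shows "(Lun C m \<odot> Ide C q) \<cdot> inverse_arr C (Assoc C \<one> m q) = Lun C (m \<otimes> q)"
  by (simp flip: lun_tensor)

lemma run_move:
  assumes [simp]: "m \<in> Obj C" "q \<in> Obj C"
  shows "(Run C m \<odot> Ide C q) \<cdot> move C m q \<one> = Run C (m \<otimes> q)"
proof -
  have "(Run C m \<odot> Ide C q) \<cdot> move C m q \<one> = (Ide C m \<odot> Lun C q) \<cdot> (Ide C m \<odot> Swap C q \<one>) \<cdot> Assoc C m q \<one>"
    by (simp add: move_def flip: triangle)
  also have "\<dots> = (Ide C m \<odot> Run C q) \<cdot> Assoc C m q \<one>"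
    by (simp add: lun_swap)
  finally show ?thesis
    by (simp add: run_tensor)
qed

lemma swap_assoc_inverse:
  assumes [simp]: "a \<in> Obj C" "n \<in> Obj C" "q \<in> Obj C"
  shows "(Swap C a n \<odot> Ide C q) \<cdot> inverse_arr C (Assoc C a n q) = move C n q a \<cdot> Swap C a (n \<otimes> q)"
proof (rule epi_cancel[of "Assoc C a n q"])
  have "(move C n q a \<cdot> Swap C a (n \<otimes> q)) \<cdot> Assoc C a n q
    = inverse_arr C (Assoc C n a q) \<cdot> (Ide C n \<odot> Swap C q a) \<cdot> (Assoc C n q a \<cdot> Swap C a (n \<otimes> q) \<cdot> Assoc C a n q)"
    by (simp add: move_def)
  also have "\<dots> = inverse_arr C (Assoc C n a q) \<cdot> (Ide C n \<odot> Swap C q a) \<cdot>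
      ((Ide C n \<odot> Swap C a q) \<cdot> Assoc C n a q \<cdot> (Swap C a n \<odot> Ide C q))"
    by (simp only: hexagon assms)
  also have "\<dots> = Swap C a n \<odot> Ide C q"
    by simp
  finally show "((Swap C a n \<odot> Ide C q) \<cdot> inverse_arr C (Assoc C a n q)) \<cdot> Assoc C a n q
    = (move C n q a \<cdot> Swap C a (n \<otimes> q)) \<cdot> Assoc C a n q"
    by simp
qed simp_all

end

section \<open>Initial objects and coproducts in rigs\<close>

lemma colimit_empty_iff:
  assumes "finite_discrete 0 J"
  shows "is_colimit J C P c \<kappa> \<longleftrightarrow> is_initial C c"
proof -
  interpret J: category J
    using assms by (simp add: finite_discrete_def)
  have "Obj J = {}" "Arr J = {}"
    using assms by (auto simp: finite_discrete_def)
  then show ?thesis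
    by (auto simp: is_colimit_def is_cocone_def is_initial_def)
qed

lemma empty_functor:
  assumes "finite_discrete 0 J" "category C"
  shows "is_functor J C P"
proof -
  interpret J: category J
    using assms by (simp add: finite_discrete_def)
  interpret C: category C by fact
  have "Obj J = {}" "Arr J = {}"
    using assms by (auto simp: finite_discrete_def)
  then show ?thesis
    by unfold_locales (auto simp: hom_def)
qed

text \<open>Over a discrete shape the naturality condition on cocones concerns identities only, so a colimit of
  a diagram with two objects is a coproduct.\<close>

lemma colimit_pair_iff:
  assumes J: "finite_discrete 2 J" "Obj J = {x, y}" "x \<noteq> y" and P: "is_functor J C P"
  shows "is_colimit J C P c \<kappa> \<longleftrightarrow> is_coproduct C (fobj P x) (fobj P y) c (\<kappa> x) (\<kappa> y)"
proof -
  interpret P: is_functor J C P by fact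
  have Arr: "Arr J = {Ide J x, Ide J y}"
    using J by (auto simp: finite_discrete_def)
  have cocone: "is_cocone J C P c \<kappa> \<longleftrightarrow>
      c \<in> Obj C \<and> \<kappa> x \<in> hom C (fobj P x) c \<and> \<kappa> y \<in> hom C (fobj P y) c" for c \<kappa>
    using J by (auto simp: is_cocone_def Arr in_hom)
  show ?thesis
  proof
    assume col: "is_colimit J C P c \<kappa>"
    have "\<exists>!h. h \<in> hom C c d \<and> h \<cdot>\<^bsub>C\<^esub> \<kappa> x = f \<and> h \<cdot>\<^bsub>C\<^esub> \<kappa> y = g"
      if "d \<in> Obj C" "f \<in> hom C (fobj P x) d" "g \<in> hom C (fobj P y) d" for d f g
    proof -
      have "is_cocone J C P d (\<lambda>j. if j = x then f else g)"
        using that J by (simp add: cocone)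
      with col have "\<exists>!h. h \<in> hom C c d \<and> (\<forall>j\<in>Obj J. h \<cdot>\<^bsub>C\<^esub> \<kappa> j = (if j = x then f else g))"
        unfolding is_colimit_def by blast
      then show ?thesis
        using J by simp
    qed
    then show "is_coproduct C (fobj P x) (fobj P y) c (\<kappa> x) (\<kappa> y)"
      using col by (simp add: is_coproduct_def is_colimit_def cocone)
  next
    assume "is_coproduct C (fobj P x) (fobj P y) c (\<kappa> x) (\<kappa> y)"
    then show "is_colimit J C P c \<kappa>"
      by (simp add: is_coproduct_def is_colimit_def cocone J(2))
  qed
qed

definition pair_diagram :: "('j, 'k, 'm) cat_scheme \<Rightarrow> ('o, 'a, 'n) cat_scheme \<Rightarrow> 'j \<Rightarrow> 'o \<Rightarrow> 'o \<Rightarrow> ('j, 'k, 'o, 'a) fctr" where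
  "pair_diagram J C x a b =
     \<lparr>fobj = (\<lambda>j. if j = x then a else b), farr = (\<lambda>u. Ide C (if Dom J u = x then a else b))\<rparr>"

lemma pair_diagram_functor:
  assumes J: "finite_discrete n J" and C: "category C" and ab: "a \<in> Obj C" "b \<in> Obj C"
  shows "is_functor J C (pair_diagram J C x a b)"
proof -
  interpret J: category J
    using J by (simp add: finite_discrete_def)
  interpret C: category C by fact
  have ide: "\<exists>j\<in>Obj J. u = Ide J j" if "u \<in> Arr J" for u
    using J that by (auto simp: finite_discrete_def)
  show ?thesis
  proof
    fix u v i j k
    assume "u \<in> hom J i j" "v \<in> hom J j k"
    then have "i \<in> Obj J" "j = i" "k = i" "u = Ide J i" "v = Ide J i"
      using ide[of u] ide[of v] by (auto simp: in_hom)
    then show "farr (pair_diagram J C x a b) (v \<cdot>\<^bsub>J\<^esub> u)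
      = farr (pair_diagram J C x a b) v \<cdot>\<^bsub>C\<^esub> farr (pair_diagram J C x a b) u"
      using ab by (simp add: pair_diagram_def)
  next
    fix u i j
    assume "u \<in> hom J i j"
    then have "i \<in> Obj J" "j = i" "u = Ide J i"
      using ide[of u] by (auto simp: in_hom)
    then show "farr (pair_diagram J C x a b) u
      \<in> hom C (fobj (pair_diagram J C x a b) i) (fobj (pair_diagram J C x a b) j)"
      using ab by (simp add: pair_diagram_def in_hom)
  qed (use ab in \<open>simp_all add: pair_diagram_def\<close>)
qed

lemma comp_fctr_functor:
  assumes "is_functor C D F" "is_functor D E K"
  shows "is_functor C E (comp_fctr K F)"
proof -
  interpret F: is_functor C D F by fact
  interpret K: is_functor D E K by fact
  show ?thesis
  proof
    fix f g a b c
    assume "f \<in> hom C a b" "g \<in> hom C b c"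
    then show "farr (comp_fctr K F) (g \<cdot>\<^bsub>C\<^esub> f) = farr (comp_fctr K F) g \<cdot>\<^bsub>E\<^esub> farr (comp_fctr K F) f"
      by (simp add: comp_fctr_def in_hom)
  qed (auto simp: comp_fctr_def in_hom)
qed

lemma doctrine_pair:
  assumes "additive_doctrine \<A>"
  obtains J x y where "J \<in> \<A>" "finite_discrete 2 J" "Obj J = {x, y}" "x \<noteq> y"
proof -
  obtain J where J: "J \<in> \<A>" "finite_discrete 2 J"
    using assms by (auto simp: additive_doctrine_def)
  then obtain x y where "Obj J = {x, y}" "x \<noteq> y"
    by (auto simp: finite_discrete_def card_2_iff)
  with J that show thesis by blast
qed

lemma doctrine_empty:
  assumes "additive_doctrine \<A>"
  obtains J where "J \<in> \<A>" "finite_discrete 0 J"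
  using assms by (auto simp: additive_doctrine_def)

text \<open>Cocontinuity speaks only about colimits over the shapes of the doctrine; coproducts are reached
  through its discrete shape with two objects.\<close>

lemma cocontinuous_coproduct:
  assumes "additive_doctrine \<A>" "cocontinuous \<A> C D F" "is_coproduct C a b c i j"
    and "a \<in> Obj C" "b \<in> Obj C"
  shows "is_coproduct D (fobj F a) (fobj F b) (fobj F c) (farr F i) (farr F j)"
proof -
  obtain J x y where J: "J \<in> \<A>" "finite_discrete 2 J" "Obj J = {x, y}" "x \<noteq> y"
    using doctrine_pair[OF assms(1)] .
  have F: "is_functor C D F"
    using assms(2) by (simp add: cocontinuous_def)
  then interpret F: is_functor C D F .
  let ?P = "pair_diagram J C x a b" and ?\<kappa> = "\<lambda>z. if z = x then i else j"
  have P: "is_functor J C ?P"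
    using pair_diagram_functor[OF J(2) F.C.category_axioms assms(4,5)] .
  have *: "fobj ?P x = a" "fobj ?P y = b"
    using J by (simp_all add: pair_diagram_def)
  have "is_colimit J C ?P c ?\<kappa>"
    using assms(3) J(4) unfolding colimit_pair_iff[OF J(2-4) P] * by simp
  then have "is_colimit J D (comp_fctr F ?P) (fobj F c) (\<lambda>z. farr F (?\<kappa> z))"
    using assms(2) J(1) P unfolding cocontinuous_def by blast
  then show ?thesis
    using J(4) * unfolding colimit_pair_iff[OF J(2-4) comp_fctr_functor[OF P F]]
    by (simp add: comp_fctr_def)
qed

lemma cocontinuous_initial:
  assumes "additive_doctrine \<A>" "cocontinuous \<A> C D F" "is_initial C z"
  shows "is_initial D (fobj F z)"
proof -
  obtain J where J: "J \<in> \<A>" "finite_discrete 0 J"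
    using doctrine_empty[OF assms(1)] .
  have F: "is_functor C D F"
    using assms(2) by (simp add: cocontinuous_def)
  then interpret F: is_functor C D F .
  fix P :: "('a, 'b, 'c, 'd) fctr" and \<kappa>
  have "is_colimit J C P z \<kappa>" "is_functor J C P"
    using assms(3) empty_functor[OF J(2) F.C.category_axioms] by (simp_all add: colimit_empty_iff[OF J(2)])
  then have "is_colimit J D (comp_fctr F P) (fobj F z) (\<lambda>j. farr F (\<kappa> j))"
    using assms(2) J(1) unfolding cocontinuous_def by blast
  then show ?thesis
    by (simp add: colimit_empty_iff[OF J(2)])
qed

text \<open>The values of \<open>zero\<close>, \<open>plus\<close>, \<open>inl\<close> and \<open>inr\<close> are chosen by Hilbert's operator; the axioms say that
  there was something to choose.\<close>

locale coproduct_category = category C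
  for C :: "('o, 'a, 'm) cat_scheme" (structure) +
  assumes zero_initial: "is_initial C (zero C)"
    and plus_coproduct: "a \<in> Obj C \<Longrightarrow> b \<in> Obj C \<Longrightarrow> is_coproduct C a b (plus C a b) (inl C a b) (inr C a b)"
begin

lemma inj_simps [simp]:
  assumes "a \<in> Obj C" "b \<in> Obj C"
  shows "plus C a b \<in> Obj C"
    "inl C a b \<in> Arr C" "Dom C (inl C a b) = a" "Cod C (inl C a b) = plus C a b"
    "inr C a b \<in> Arr C" "Dom C (inr C a b) = b" "Cod C (inr C a b) = plus C a b"
  using plus_coproduct[OF assms] by (auto simp: is_coproduct_def in_hom)

lemma copair_simps [simp]:
  assumes "f \<in> Arr C" "g \<in> Arr C" "Cod C f = Cod C g"
  shows "copair C f g \<in> Arr C" "Dom C (copair C f g) = plus C (Dom C f) (Dom C g)"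
    "Cod C (copair C f g) = Cod C f"
    "copair C f g \<cdot> inl C (Dom C f) (Dom C g) = f" "copair C f g \<cdot> inr C (Dom C f) (Dom C g) = g"
proof -
  have "f \<in> hom C (Dom C f) (Cod C f)" "g \<in> hom C (Dom C g) (Cod C f)"
    using assms by (auto simp: in_hom)
  then have "\<exists>!h. h \<in> hom C (plus C (Dom C f) (Dom C g)) (Cod C f) \<and>
      h \<cdot> inl C (Dom C f) (Dom C g) = f \<and> h \<cdot> inr C (Dom C f) (Dom C g) = g"
    using plus_coproduct[of "Dom C f" "Dom C g"] assms unfolding is_coproduct_def by simp
  from theI'[OF this] show "copair C f g \<in> Arr C" "Dom C (copair C f g) = plus C (Dom C f) (Dom C g)"
    "Cod C (copair C f g) = Cod C f"
    "copair C f g \<cdot> inl C (Dom C f) (Dom C g) = f" "copair C f g \<cdot> inr C (Dom C f) (Dom C g) = g"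
    unfolding copair_def by (auto simp: in_hom)
qed

lemma copair_inj [simp]:
  assumes "f \<in> Arr C" "g \<in> Arr C" "Cod C f = Cod C g" "Dom C f = a" "Dom C g = b"
  shows "copair C f g \<cdot> inl C a b = f" "copair C f g \<cdot> inr C a b = g"
    and "x \<in> Arr C \<Longrightarrow> Cod C x = a \<Longrightarrow> copair C f g \<cdot> inl C a b \<cdot> x = f \<cdot> x"
    and "y \<in> Arr C \<Longrightarrow> Cod C y = b \<Longrightarrow> copair C f g \<cdot> inr C a b \<cdot> y = g \<cdot> y"
proof -
  have ab: "a \<in> Obj C" "b \<in> Obj C"
    using assms by auto
  show e: "copair C f g \<cdot> inl C a b = f" "copair C f g \<cdot> inr C a b = g"
    using copair_simps(4,5)[OF assms(1-3)] assms(4,5) by simp_all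
  show "copair C f g \<cdot> inl C a b \<cdot> x = f \<cdot> x" if "x \<in> Arr C" "Cod C x = a"
    by (rule rewrite_prefix[OF e(1)]) (simp_all add: that ab assms)
  show "copair C f g \<cdot> inr C a b \<cdot> y = g \<cdot> y" if "y \<in> Arr C" "Cod C y = b"
    by (rule rewrite_prefix[OF e(2)]) (simp_all add: that ab assms)
qed

text \<open>Equality of arrows out of a coproduct that need not be the chosen one; below it is applied to
  the images of chosen coproducts under cocontinuous functors.\<close>

lemma coproduct_eqI:
  assumes "is_coproduct C a b c i j" "a \<in> Obj C" "b \<in> Obj C" "h \<in> Arr C" "k \<in> Arr C"
    and "Dom C h = c" "Dom C k = c" "Cod C h = Cod C k" "h \<cdot> i = k \<cdot> i" "h \<cdot> j = k \<cdot> j"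
  shows "h = k"
proof -
  have ij: "i \<in> hom C a c" "j \<in> hom C b c"
    using assms by (auto simp: is_coproduct_def)
  have "k \<cdot> i \<in> hom C a (Cod C k)" "k \<cdot> j \<in> hom C b (Cod C k)"
    using ij assms(4-7) by (auto simp: in_hom)
  then have "\<exists>!h. h \<in> hom C c (Cod C k) \<and> h \<cdot> i = k \<cdot> i \<and> h \<cdot> j = k \<cdot> j"
    using assms(1,5) unfolding is_coproduct_def by simp
  moreover have "h \<in> hom C c (Cod C k)" "k \<in> hom C c (Cod C k)"
    using assms by (auto simp: in_hom)
  ultimately show ?thesis
    using assms(9,10) by blast
qed

lemma plus_eqI:
  assumes "h \<in> Arr C" "k \<in> Arr C" "Dom C h = plus C a b" "Dom C k = plus C a b" "Cod C h = Cod C k"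
    and "h \<cdot> inl C a b = k \<cdot> inl C a b" "h \<cdot> inr C a b = k \<cdot> inr C a b" "a \<in> Obj C" "b \<in> Obj C"
  shows "h = k"
  using coproduct_eqI[OF plus_coproduct] assms by blast

text \<open>The comparison from the chosen coproduct to any other coproduct of the same objects.\<close>

lemma copair_invertible:
  assumes "is_coproduct C a b c i j" "a \<in> Obj C" "b \<in> Obj C"
  shows "invertible C (copair C i j)"
proof -
  have ij [simp]: "i \<in> Arr C" "j \<in> Arr C" "Dom C i = a" "Dom C j = b" "Cod C i = c" "Cod C j = c" "c \<in> Obj C"
    using assms by (auto simp: is_coproduct_def in_hom)
  have "inl C a b \<in> hom C a (plus C a b)" "inr C a b \<in> hom C b (plus C a b)" "plus C a b \<in> Obj C"
    using assms(2,3) by (auto simp: in_hom)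
  then obtain k where k: "k \<in> hom C c (plus C a b)" "k \<cdot> i = inl C a b" "k \<cdot> j = inr C a b"
    using assms(1) unfolding is_coproduct_def by metis
  then have [simp]: "k \<in> Arr C" "Dom C k = c" "Cod C k = plus C a b"
    by (auto simp: in_hom)
  have "k \<cdot> copair C i j = Ide C (plus C a b)"
    by (rule plus_eqI[of _ _ a b]) (simp_all add: assms k)
  moreover have "copair C i j \<cdot> k = Ide C c"
    by (rule coproduct_eqI[OF assms]) (simp_all add: assms k)
  ultimately show ?thesis
    using k(1) assms by (intro invertibleI[of "copair C i j" "plus C a b" c k]) (simp_all add: in_hom)
qed

lemma plusA_simps [simp]:
  assumes "f \<in> Arr C" "g \<in> Arr C"
  shows "plusA C f g \<in> Arr C" "Dom C (plusA C f g) = plus C (Dom C f) (Dom C g)"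
    "Cod C (plusA C f g) = plus C (Cod C f) (Cod C g)"
  using assms by (simp_all add: plusA_def)

lemma plusA_inj [simp]:
  assumes "f \<in> Arr C" "g \<in> Arr C" "Dom C f = a" "Dom C g = b"
  shows "plusA C f g \<cdot> inl C a b = inl C (Cod C f) (Cod C g) \<cdot> f"
    and "plusA C f g \<cdot> inr C a b = inr C (Cod C f) (Cod C g) \<cdot> g"
    and "x \<in> Arr C \<Longrightarrow> Cod C x = a \<Longrightarrow> plusA C f g \<cdot> inl C a b \<cdot> x = inl C (Cod C f) (Cod C g) \<cdot> f \<cdot> x"
    and "y \<in> Arr C \<Longrightarrow> Cod C y = b \<Longrightarrow> plusA C f g \<cdot> inr C a b \<cdot> y = inr C (Cod C f) (Cod C g) \<cdot> g \<cdot> y"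
  using assms by (simp_all add: plusA_def)

lemma initial_eqI:
  assumes "is_initial C z" "f \<in> Arr C" "g \<in> Arr C" "Dom C f = z" "Dom C g = z" "Cod C f = Cod C g"
  shows "f = g"
proof -
  have "\<exists>!h. h \<in> hom C z (Cod C f)"
    using assms by (simp add: is_initial_def)
  moreover have "f \<in> hom C z (Cod C f)" "g \<in> hom C z (Cod C f)"
    using assms by (auto simp: in_hom)
  ultimately show ?thesis by blast
qed

lemma from_initial_simps:
  assumes "is_initial C z" "c \<in> Obj C"
  shows "from_initial C z c \<in> Arr C" "Dom C (from_initial C z c) = z" "Cod C (from_initial C z c) = c"
proof -
  have "\<exists>!h. h \<in> hom C z c"
    using assms by (simp add: is_initial_def)
  from theI'[OF this] show "from_initial C z c \<in> Arr C" "Dom C (from_initial C z c) = z" "Cod C (from_initial C z c) = c"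
    by (auto simp: from_initial_def in_hom)
qed

lemma from_initial_invertible:
  assumes "is_initial C z" "is_initial C c"
  shows "invertible C (from_initial C z c)"
proof -
  have [simp]: "z \<in> Obj C" "c \<in> Obj C"
    using assms by (auto simp: is_initial_def)
  note [simp] = from_initial_simps[OF assms(1)] from_initial_simps[OF assms(2)]
  show ?thesis
  proof (rule invertibleI[of _ z c "from_initial C c z"])
    show "from_initial C c z \<cdot> from_initial C z c = Ide C z"
      by (rule initial_eqI[OF assms(1)]) simp_all
    show "from_initial C z c \<cdot> from_initial C c z = Ide C c"
      by (rule initial_eqI[OF assms(2)]) simp_all
  qed (simp_all add: in_hom)
qed

end

locale doctrine_rig =
  fixes \<A> :: "('j, 'k) cat set" and R :: "('o, 'a) smcat" (structure)
  assumes doctrine: "additive_doctrine \<A>" and rig: "rig \<A> R"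
begin

sublocale symmetric_monoidal_category R
  using rig by (simp add: rig_def)

sublocale coproduct_category R
proof
  obtain J where J: "J \<in> \<A>" "finite_discrete 0 J"
    using doctrine_empty[OF doctrine] .
  fix P :: "('j, 'k, 'o, 'a) fctr"
  obtain c \<kappa> where "is_colimit J R P c \<kappa>"
    using rig J(1) empty_functor[OF J(2) category_axioms] unfolding rig_def has_colimits_def by blast
  then have "is_initial R c"
    by (simp add: colimit_empty_iff[OF J(2)])
  then show "is_initial R (zero R)"
    unfolding zero_def by (rule someI)
next
  fix a b assume ab: "a \<in> Obj R" "b \<in> Obj R"
  obtain J x y where J: "J \<in> \<A>" "finite_discrete 2 J" "Obj J = {x, y}" "x \<noteq> y"
    using doctrine_pair[OF doctrine] .
  let ?P = "pair_diagram J R x a b"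
  have P: "is_functor J R ?P"
    by (rule pair_diagram_functor[OF J(2) category_axioms ab])
  obtain c \<kappa> where "is_colimit J R ?P c \<kappa>"
    using rig J(1) P unfolding rig_def has_colimits_def by blast
  then have "is_coproduct R a b c (\<kappa> x) (\<kappa> y)"
    using J(4) unfolding colimit_pair_iff[OF J(2-4) P] by (simp add: pair_diagram_def)
  then have "\<exists>p. case p of (s, i, j) \<Rightarrow> is_coproduct R a b s i j"
    by blast
  then have "case coproduct R a b of (s, i, j) \<Rightarrow> is_coproduct R a b s i j"
    unfolding coproduct_def by (rule someI_ex)
  then show "is_coproduct R a b (plus R a b) (inl R a b) (inr R a b)"
    by (auto simp: plus_def inl_def inr_def split: prod.splits)
qed

lemma tensor_cocontinuous:
  assumes "a \<in> Obj R"
  shows "cocontinuous \<A> R R (tensor_left R a)" "cocontinuous \<A> R R (tensor_right R a)"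
  using rig assms by (auto simp: rig_def)

lemma tensor_coproduct:
  assumes "a \<in> Obj R" "b \<in> Obj R" "c \<in> Obj R"
  shows "is_coproduct R (c \<otimes> a) (c \<otimes> b) (c \<otimes> plus R a b) (Ide R c \<odot> inl R a b) (Ide R c \<odot> inr R a b)"
    and "is_coproduct R (a \<otimes> c) (b \<otimes> c) (plus R a b \<otimes> c) (inl R a b \<odot> Ide R c) (inr R a b \<odot> Ide R c)"
  using cocontinuous_coproduct[OF doctrine tensor_cocontinuous(1)[OF assms(3)] plus_coproduct[OF assms(1,2)] assms(1,2)]
    cocontinuous_coproduct[OF doctrine tensor_cocontinuous(2)[OF assms(3)] plus_coproduct[OF assms(1,2)] assms(1,2)]
  by (simp_all add: tensor_left_def tensor_right_def)

lemma tensor_initial: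
  assumes "a \<in> Obj R" "is_initial R z"
  shows "is_initial R (a \<otimes> z)" "is_initial R (z \<otimes> a)"
  using cocontinuous_initial[OF doctrine tensor_cocontinuous(1)[OF assms(1)] assms(2)]
    cocontinuous_initial[OF doctrine tensor_cocontinuous(2)[OF assms(1)] assms(2)]
  by (simp_all add: tensor_left_def tensor_right_def)

lemma zero_obj [simp]: "zero R \<in> Obj R"
  using zero_initial by (simp add: is_initial_def)

lemma distr_simps [simp]:
  assumes "a \<in> Obj R" "b \<in> Obj R" "c \<in> Obj R"
  shows "invertible R (distr R a b c)" "Dom R (distr R a b c) = plus R (a \<otimes> c) (b \<otimes> c)"
    "Cod R (distr R a b c) = plus R a b \<otimes> c"
  using copair_invertible[OF tensor_coproduct(2)] assms by (simp_all add: distr_def)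

text \<open>The associator of the dual numbers contains an inverse of \<open>distr\<close>, and these two equations give its
  values on the summands.\<close>

lemma distr_inverse [simp]:
  assumes "a \<in> Obj R" "b \<in> Obj R" "c \<in> Obj R"
  shows "inverse_arr R (distr R a b c) \<cdot> (inl R a b \<odot> Ide R c) = inl R (a \<otimes> c) (b \<otimes> c)"
    and "inverse_arr R (distr R a b c) \<cdot> (inr R a b \<odot> Ide R c) = inr R (a \<otimes> c) (b \<otimes> c)"
proof -
  have "distr R a b c \<cdot> inl R (a \<otimes> c) (b \<otimes> c) = inl R a b \<odot> Ide R c"
    "distr R a b c \<cdot> inr R (a \<otimes> c) (b \<otimes> c) = inr R a b \<odot> Ide R c"
    using assms by (simp_all add: distr_def)
  from this[symmetric] show "inverse_arr R (distr R a b c) \<cdot> (inl R a b \<odot> Ide R c) = inl R (a \<otimes> c) (b \<otimes> c)"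
    "inverse_arr R (distr R a b c) \<cdot> (inr R a b \<odot> Ide R c) = inr R (a \<otimes> c) (b \<otimes> c)"
    using assms by simp_all
qed

end

section \<open>Composition of monoidal functors and of rig maps\<close>

lemma (in is_functor) farr_rewrite:
  assumes "g \<cdot>\<^bsub>C\<^esub> f = k" "f \<in> Arr C" "g \<in> Arr C" "Cod C f = Dom C g"
  shows "farr F g \<cdot>\<^bsub>D\<^esub> farr F f = farr F k"
    and "x \<in> Arr D \<Longrightarrow> Cod D x = fobj F (Dom C f) \<Longrightarrow> farr F g \<cdot>\<^bsub>D\<^esub> farr F f \<cdot>\<^bsub>D\<^esub> x = farr F k \<cdot>\<^bsub>D\<^esub> x"
proof -
  show e: "farr F g \<cdot>\<^bsub>D\<^esub> farr F f = farr F k"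
    using assms(2-) by (simp flip: assms(1))
  show "farr F g \<cdot>\<^bsub>D\<^esub> farr F f \<cdot>\<^bsub>D\<^esub> x = farr F k \<cdot>\<^bsub>D\<^esub> x" if "x \<in> Arr D" "Cod D x = fobj F (Dom C f)"
    by (rule D.rewrite_prefix[OF e]) (use assms(2-) that in simp_all)
qed

context symmetric_monoidal_functor
begin

lemma munit_simps [simp]:
  "invertible D (munit H)" "Dom D (munit H) = \<one>\<^bsub>D\<^esub>" "Cod D (munit H) = fobj H \<one>\<^bsub>C\<^esub>"
  using munit_iso by (auto simp: iso_between_iff in_hom)

lemma mmult_simps [simp]:
  assumes "a \<in> Obj C" "b \<in> Obj C"
  shows "invertible D (mmult H a b)" "Dom D (mmult H a b) = fobj H a \<otimes>\<^bsub>D\<^esub> fobj H b"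
    "Cod D (mmult H a b) = fobj H (a \<otimes>\<^bsub>C\<^esub> b)"
  using mmult_iso[OF assms] by (auto simp: iso_between_iff in_hom)

lemma mmult_natural:
  "f \<in> Arr C \<Longrightarrow> g \<in> Arr C \<Longrightarrow>
   mmult H (Cod C f) (Cod C g) \<cdot>\<^bsub>D\<^esub> (farr H f \<odot>\<^bsub>D\<^esub> farr H g)
     = farr H (f \<odot>\<^bsub>C\<^esub> g) \<cdot>\<^bsub>D\<^esub> mmult H (Dom C f) (Dom C g)"
  by (rule mmult_nat) (auto simp: in_hom)

end

lemma comp_mfctr_monoidal:
  assumes "symmetric_monoidal_functor C D H" "symmetric_monoidal_functor D E K"
  shows "symmetric_monoidal_functor C E (comp_mfctr E K H)"
proof -
  interpret H: symmetric_monoidal_functor C D H by fact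
  interpret K: symmetric_monoidal_functor D E K by fact
  let ?KH = "comp_mfctr E K H"
  have nat: "mmult K (fobj H a') (fobj H b') \<cdot>\<^bsub>E\<^esub> (farr K f \<odot>\<^bsub>E\<^esub> farr K g)
      = farr K (f \<odot>\<^bsub>D\<^esub> g) \<cdot>\<^bsub>E\<^esub> mmult K (Dom D f) (Dom D g)"
    if "f \<in> Arr D" "g \<in> Arr D" "Cod D f = fobj H a'" "Cod D g = fobj H b'" for f g a' b'
    using K.mmult_natural[of f g] that by simp
  show ?thesis
  proof
    fix f g a b c
    assume "f \<in> hom C a b" "g \<in> hom C b c"
    then show "farr ?KH (g \<cdot>\<^bsub>C\<^esub> f) = farr ?KH g \<cdot>\<^bsub>E\<^esub> farr ?KH f"
      by (simp add: comp_mfctr_def in_hom)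
  next
    show "iso_between E (munit ?KH) \<one>\<^bsub>E\<^esub> (fobj ?KH \<one>\<^bsub>C\<^esub>)"
      by (simp add: comp_mfctr_def iso_between_iff in_hom)
  next
    fix a b assume [simp]: "a \<in> Obj C" "b \<in> Obj C"
    show "iso_between E (mmult ?KH a b)
      (fobj ?KH a \<otimes>\<^bsub>E\<^esub> fobj ?KH b) (fobj ?KH (a \<otimes>\<^bsub>C\<^esub> b))"
      by (simp add: comp_mfctr_def iso_between_iff in_hom)
    show "farr ?KH (Swap C a b) \<cdot>\<^bsub>E\<^esub> mmult ?KH a b =
      mmult ?KH b a \<cdot>\<^bsub>E\<^esub> Swap E (fobj ?KH a) (fobj ?KH b)"
      by (simp add: comp_mfctr_def K.farr_rewrite(2)[OF H.mmult_swap] K.mmult_swap[symmetric])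
  next
    fix a a' b b' f g assume *: "f \<in> hom C a a'" "g \<in> hom C b b'"
    then have [simp]: "f \<in> Arr C" "g \<in> Arr C" "Dom C f = a" "Dom C g = b" "Cod C f = a'" "Cod C g = b'"
      and [simp]: "a \<in> Obj C" "a' \<in> Obj C" "b \<in> Obj C" "b' \<in> Obj C"
      by (auto simp: in_hom)
    have "mmult H a' b' \<cdot>\<^bsub>D\<^esub> (farr H f \<odot>\<^bsub>D\<^esub> farr H g) = farr H (f \<odot>\<^bsub>C\<^esub> g) \<cdot>\<^bsub>D\<^esub> mmult H a b"
      using H.mmult_natural[of f g] by simp
    note e = K.farr_rewrite(2)[OF this]
    show "mmult ?KH a' b' \<cdot>\<^bsub>E\<^esub> (farr ?KH f \<odot>\<^bsub>E\<^esub> farr ?KH g) =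
      farr ?KH (f \<odot>\<^bsub>C\<^esub> g) \<cdot>\<^bsub>E\<^esub> mmult ?KH a b"
      by (simp add: comp_mfctr_def nat e)
  next
    fix a b c assume [simp]: "a \<in> Obj C" "b \<in> Obj C" "c \<in> Obj C"
    let ?h = "mmult H" and ?k = "\<lambda>a b. mmult K (fobj H a) (fobj H b)"
    have n1: "?k (a \<otimes>\<^bsub>C\<^esub> b) c \<cdot>\<^bsub>E\<^esub> (farr K (?h a b) \<odot>\<^bsub>E\<^esub> Ide E (fobj K (fobj H c)))
      = farr K (?h a b \<odot>\<^bsub>D\<^esub> Ide D (fobj H c)) \<cdot>\<^bsub>E\<^esub> mmult K (fobj H a \<otimes>\<^bsub>D\<^esub> fobj H b) (fobj H c)"
      using nat[of "?h a b" "Ide D (fobj H c)" "a \<otimes>\<^bsub>C\<^esub> b" c] by simp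
    have n2: "farr K (Ide D (fobj H a) \<odot>\<^bsub>D\<^esub> ?h b c) \<cdot>\<^bsub>E\<^esub> mmult K (fobj H a) (fobj H b \<otimes>\<^bsub>D\<^esub> fobj H c)
      = ?k a (b \<otimes>\<^bsub>C\<^esub> c) \<cdot>\<^bsub>E\<^esub> (Ide E (fobj K (fobj H a)) \<odot>\<^bsub>E\<^esub> farr K (?h b c))"
      using nat[of "Ide D (fobj H a)" "?h b c" a "b \<otimes>\<^bsub>C\<^esub> c"] by simp
    have "farr K (farr H (Assoc C a b c)) \<cdot>\<^bsub>E\<^esub> (farr K (?h (a \<otimes>\<^bsub>C\<^esub> b) c) \<cdot>\<^bsub>E\<^esub> ?k (a \<otimes>\<^bsub>C\<^esub> b) c)
        \<cdot>\<^bsub>E\<^esub> ((farr K (?h a b) \<cdot>\<^bsub>E\<^esub> ?k a b) \<odot>\<^bsub>E\<^esub> Ide E (fobj K (fobj H c)))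
      = farr K (farr H (Assoc C a b c)) \<cdot>\<^bsub>E\<^esub> farr K (?h (a \<otimes>\<^bsub>C\<^esub> b) c) \<cdot>\<^bsub>E\<^esub>
        (?k (a \<otimes>\<^bsub>C\<^esub> b) c \<cdot>\<^bsub>E\<^esub> (farr K (?h a b) \<odot>\<^bsub>E\<^esub> Ide E (fobj K (fobj H c)))) \<cdot>\<^bsub>E\<^esub> (?k a b \<odot>\<^bsub>E\<^esub> Ide E (fobj K (fobj H c)))"
      by simp
    also have "\<dots> = farr K (farr H (Assoc C a b c) \<cdot>\<^bsub>D\<^esub> ?h (a \<otimes>\<^bsub>C\<^esub> b) c \<cdot>\<^bsub>D\<^esub> (?h a b \<odot>\<^bsub>D\<^esub> Ide D (fobj H c))) \<cdot>\<^bsub>E\<^esub>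
        mmult K (fobj H a \<otimes>\<^bsub>D\<^esub> fobj H b) (fobj H c) \<cdot>\<^bsub>E\<^esub> (?k a b \<odot>\<^bsub>E\<^esub> Ide E (fobj K (fobj H c)))"
      unfolding n1 by simp
    also have "\<dots> = farr K (?h a (b \<otimes>\<^bsub>C\<^esub> c)) \<cdot>\<^bsub>E\<^esub> farr K (Ide D (fobj H a) \<odot>\<^bsub>D\<^esub> ?h b c) \<cdot>\<^bsub>E\<^esub>
        (farr K (Assoc D (fobj H a) (fobj H b) (fobj H c)) \<cdot>\<^bsub>E\<^esub>
        mmult K (fobj H a \<otimes>\<^bsub>D\<^esub> fobj H b) (fobj H c) \<cdot>\<^bsub>E\<^esub> (?k a b \<odot>\<^bsub>E\<^esub> Ide E (fobj K (fobj H c))))"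
      by (simp add: H.mmult_assoc)
    also have "\<dots> = farr K (?h a (b \<otimes>\<^bsub>C\<^esub> c)) \<cdot>\<^bsub>E\<^esub> (farr K (Ide D (fobj H a) \<odot>\<^bsub>D\<^esub> ?h b c) \<cdot>\<^bsub>E\<^esub>
        mmult K (fobj H a) (fobj H b \<otimes>\<^bsub>D\<^esub> fobj H c)) \<cdot>\<^bsub>E\<^esub> (Ide E (fobj K (fobj H a)) \<odot>\<^bsub>E\<^esub> ?k b c) \<cdot>\<^bsub>E\<^esub>
        Assoc E (fobj K (fobj H a)) (fobj K (fobj H b)) (fobj K (fobj H c))"
      by (simp add: K.mmult_assoc)
    also have "\<dots> = (farr K (?h a (b \<otimes>\<^bsub>C\<^esub> c)) \<cdot>\<^bsub>E\<^esub> ?k a (b \<otimes>\<^bsub>C\<^esub> c)) \<cdot>\<^bsub>E\<^esub>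
        (Ide E (fobj K (fobj H a)) \<odot>\<^bsub>E\<^esub> (farr K (?h b c) \<cdot>\<^bsub>E\<^esub> ?k b c)) \<cdot>\<^bsub>E\<^esub>
        Assoc E (fobj K (fobj H a)) (fobj K (fobj H b)) (fobj K (fobj H c))"
      unfolding n2 by simp
    finally show "farr ?KH (Assoc C a b c) \<cdot>\<^bsub>E\<^esub> mmult ?KH (a \<otimes>\<^bsub>C\<^esub> b) c \<cdot>\<^bsub>E\<^esub>
        (mmult ?KH a b \<odot>\<^bsub>E\<^esub> Ide E (fobj ?KH c))
      = mmult ?KH a (b \<otimes>\<^bsub>C\<^esub> c) \<cdot>\<^bsub>E\<^esub>
        (Ide E (fobj ?KH a) \<odot>\<^bsub>E\<^esub> mmult ?KH b c) \<cdot>\<^bsub>E\<^esub>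
        Assoc E (fobj ?KH a) (fobj ?KH b) (fobj ?KH c)"
      by (simp add: comp_mfctr_def)
  next
    fix a assume [simp]: "a \<in> Obj C"
    have n1: "mmult K (fobj H \<one>\<^bsub>C\<^esub>) (fobj H a) \<cdot>\<^bsub>E\<^esub> (farr K (munit H) \<odot>\<^bsub>E\<^esub> Ide E (fobj K (fobj H a)))
      = farr K (munit H \<odot>\<^bsub>D\<^esub> Ide D (fobj H a)) \<cdot>\<^bsub>E\<^esub> mmult K \<one>\<^bsub>D\<^esub> (fobj H a)"
      using nat[of "munit H" "Ide D (fobj H a)" "\<one>\<^bsub>C\<^esub>" a] by simp
    have "farr K (farr H (Lun C a)) \<cdot>\<^bsub>E\<^esub> (farr K (mmult H \<one>\<^bsub>C\<^esub> a) \<cdot>\<^bsub>E\<^esub> mmult K (fobj H \<one>\<^bsub>C\<^esub>) (fobj H a)) \<cdot>\<^bsub>E\<^esub>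
        ((farr K (munit H) \<cdot>\<^bsub>E\<^esub> munit K) \<odot>\<^bsub>E\<^esub> Ide E (fobj K (fobj H a)))
      = farr K (farr H (Lun C a)) \<cdot>\<^bsub>E\<^esub> farr K (mmult H \<one>\<^bsub>C\<^esub> a) \<cdot>\<^bsub>E\<^esub> (mmult K (fobj H \<one>\<^bsub>C\<^esub>) (fobj H a) \<cdot>\<^bsub>E\<^esub>
        (farr K (munit H) \<odot>\<^bsub>E\<^esub> Ide E (fobj K (fobj H a)))) \<cdot>\<^bsub>E\<^esub> (munit K \<odot>\<^bsub>E\<^esub> Ide E (fobj K (fobj H a)))"
      by simp
    also have "\<dots> = farr K (farr H (Lun C a) \<cdot>\<^bsub>D\<^esub> mmult H \<one>\<^bsub>C\<^esub> a \<cdot>\<^bsub>D\<^esub> (munit H \<odot>\<^bsub>D\<^esub> Ide D (fobj H a))) \<cdot>\<^bsub>E\<^esub>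
        mmult K \<one>\<^bsub>D\<^esub> (fobj H a) \<cdot>\<^bsub>E\<^esub> (munit K \<odot>\<^bsub>E\<^esub> Ide E (fobj K (fobj H a)))"
      unfolding n1 by simp
    finally show "farr ?KH (Lun C a) \<cdot>\<^bsub>E\<^esub> mmult ?KH \<one>\<^bsub>C\<^esub> a \<cdot>\<^bsub>E\<^esub>
        (munit ?KH \<odot>\<^bsub>E\<^esub> Ide E (fobj ?KH a)) = Lun E (fobj ?KH a)"
      by (simp add: comp_mfctr_def H.mmult_lun K.mmult_lun)
    have n2: "mmult K (fobj H a) (fobj H \<one>\<^bsub>C\<^esub>) \<cdot>\<^bsub>E\<^esub> (Ide E (fobj K (fobj H a)) \<odot>\<^bsub>E\<^esub> farr K (munit H))
      = farr K (Ide D (fobj H a) \<odot>\<^bsub>D\<^esub> munit H) \<cdot>\<^bsub>E\<^esub> mmult K (fobj H a) \<one>\<^bsub>D\<^esub>"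
      using nat[of "Ide D (fobj H a)" "munit H" a "\<one>\<^bsub>C\<^esub>"] by simp
    have "farr K (farr H (Run C a)) \<cdot>\<^bsub>E\<^esub> (farr K (mmult H a \<one>\<^bsub>C\<^esub>) \<cdot>\<^bsub>E\<^esub> mmult K (fobj H a) (fobj H \<one>\<^bsub>C\<^esub>)) \<cdot>\<^bsub>E\<^esub>
        (Ide E (fobj K (fobj H a)) \<odot>\<^bsub>E\<^esub> (farr K (munit H) \<cdot>\<^bsub>E\<^esub> munit K))
      = farr K (farr H (Run C a)) \<cdot>\<^bsub>E\<^esub> farr K (mmult H a \<one>\<^bsub>C\<^esub>) \<cdot>\<^bsub>E\<^esub> (mmult K (fobj H a) (fobj H \<one>\<^bsub>C\<^esub>) \<cdot>\<^bsub>E\<^esub>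
        (Ide E (fobj K (fobj H a)) \<odot>\<^bsub>E\<^esub> farr K (munit H))) \<cdot>\<^bsub>E\<^esub> (Ide E (fobj K (fobj H a)) \<odot>\<^bsub>E\<^esub> munit K)"
      by simp
    also have "\<dots> = farr K (farr H (Run C a) \<cdot>\<^bsub>D\<^esub> mmult H a \<one>\<^bsub>C\<^esub> \<cdot>\<^bsub>D\<^esub> (Ide D (fobj H a) \<odot>\<^bsub>D\<^esub> munit H)) \<cdot>\<^bsub>E\<^esub>
        mmult K (fobj H a) \<one>\<^bsub>D\<^esub> \<cdot>\<^bsub>E\<^esub> (Ide E (fobj K (fobj H a)) \<odot>\<^bsub>E\<^esub> munit K)"
      unfolding n2 by simp
    finally show "farr ?KH (Run C a) \<cdot>\<^bsub>E\<^esub> mmult ?KH a \<one>\<^bsub>C\<^esub> \<cdot>\<^bsub>E\<^esub>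
        (Ide E (fobj ?KH a) \<odot>\<^bsub>E\<^esub> munit ?KH) = Run E (fobj ?KH a)"
      by (simp add: comp_mfctr_def H.mmult_run K.mmult_run)
  qed (auto simp: comp_mfctr_def in_hom)
qed

lemma comp_cocontinuous:
  assumes "cocontinuous \<A> C D F" "cocontinuous \<A> D E K"
  shows "cocontinuous \<A> C E (comp_fctr K F)"
proof -
  have F: "is_functor C D F" and K: "is_functor D E K"
    using assms by (auto simp: cocontinuous_def)
  have "is_colimit J E (comp_fctr (comp_fctr K F) P) (fobj (comp_fctr K F) c) (\<lambda>j. farr (comp_fctr K F) (\<kappa> j))"
    if "J \<in> \<A>" "is_functor J C P" "is_colimit J C P c \<kappa>" for J and P :: "('a, 'b, 'c, 'd) fctr" and c \<kappa>
  proof -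
    have "is_colimit J D (comp_fctr F P) (fobj F c) (\<lambda>j. farr F (\<kappa> j))"
      using assms(1) that unfolding cocontinuous_def by blast
    then have "is_colimit J E (comp_fctr K (comp_fctr F P)) (fobj K (fobj F c)) (\<lambda>j. farr K (farr F (\<kappa> j)))"
      using assms(2) that(1) comp_fctr_functor[OF that(2) F] unfolding cocontinuous_def by blast
    then show ?thesis
      by (simp add: comp_fctr_def)
  qed
  then show ?thesis
    using comp_fctr_functor[OF F K] by (simp add: cocontinuous_def)
qed

lemma is_functor_cong:
  assumes "is_functor C D F" "fobj F' = fobj F" "farr F' = farr F"
  shows "is_functor C D F'"
  using assms unfolding is_functor_def is_functor_axioms_def by simp

lemma cocontinuous_cong:
  assumes "cocontinuous \<A> C D F" "fobj F' = fobj F" "farr F' = farr F"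
  shows "cocontinuous \<A> C D F'"
  using assms is_functor_cong[of C D F F'] by (simp add: cocontinuous_def comp_fctr_def)

lemma comp_rig_map:
  assumes "rig_map \<A> R S H" "rig_map \<A> S U K"
  shows "rig_map \<A> R U (comp_mfctr U K H)"
proof -
  have "cocontinuous \<A> R U (comp_fctr K H)"
    using assms comp_cocontinuous unfolding rig_map_def by blast
  then have "cocontinuous \<A> R U (comp_mfctr U K H)"
    by (rule cocontinuous_cong) (simp_all add: comp_fctr_def comp_mfctr_def)
  then show ?thesis
    using assms comp_mfctr_monoidal[of R S H U K] by (simp add: rig_map_def)
qed

lemma id_rig_map:
  assumes "rig \<A> R"
  shows "rig_map \<A> R R (id_mfctr R)"
proof -
  interpret symmetric_monoidal_category R
    using assms by (simp add: rig_def)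
  have "symmetric_monoidal_functor R R (id_mfctr R)"
    by unfold_locales (auto simp: id_mfctr_def in_hom iso_between_iff)
  moreover from this interpret I: symmetric_monoidal_functor R R "id_mfctr R" .
  have "cocontinuous \<A> R R (id_mfctr R)"
    unfolding cocontinuous_def using I.is_functor_axioms by (simp add: comp_fctr_def id_mfctr_def is_colimit_def is_cocone_def)
  ultimately show ?thesis
    using assms by (simp add: rig_map_def)
qed

section \<open>Bimodule functors induce functors between dual numbers\<close>

text \<open>A functor \<open>K\<close> on which the monoidal functor \<open>H\<close> acts from both sides, compatibly with the symmetries.
  The axioms are those of a monoidal functor with one of the factors marked: \<open>H\<close> is applied to the
  unmarked factors and \<open>K\<close> to the marked one, and there is one associativity law for each position of
  the mark.\<close>

locale bimodule_functor =
  H: symmetric_monoidal_functor R S H + K: is_functor R S K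
  for R :: "('o, 'a, 'm) smcat_scheme" and S :: "('p, 'q, 'n) smcat_scheme"
    and H :: "('o, 'a, 'p, 'q, 'k) mfctr_scheme" and K :: "('o, 'a, 'p, 'q, 'l) fctr_scheme" +
  fixes lact ract :: "'o \<Rightarrow> 'o \<Rightarrow> 'q"
  assumes lact_iso: "a \<in> Obj R \<Longrightarrow> n \<in> Obj R \<Longrightarrow>
          iso_between S (lact a n) (fobj H a \<otimes>\<^bsub>S\<^esub> fobj K n) (fobj K (a \<otimes>\<^bsub>R\<^esub> n))"
    and ract_iso: "m \<in> Obj R \<Longrightarrow> b \<in> Obj R \<Longrightarrow>
          iso_between S (ract m b) (fobj K m \<otimes>\<^bsub>S\<^esub> fobj H b) (fobj K (m \<otimes>\<^bsub>R\<^esub> b))"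
    and lact_natural: "f \<in> Arr R \<Longrightarrow> g \<in> Arr R \<Longrightarrow>
          lact (Cod R f) (Cod R g) \<cdot>\<^bsub>S\<^esub> (farr H f \<odot>\<^bsub>S\<^esub> farr K g)
            = farr K (f \<odot>\<^bsub>R\<^esub> g) \<cdot>\<^bsub>S\<^esub> lact (Dom R f) (Dom R g)"
    and ract_natural: "f \<in> Arr R \<Longrightarrow> g \<in> Arr R \<Longrightarrow>
          ract (Cod R f) (Cod R g) \<cdot>\<^bsub>S\<^esub> (farr K f \<odot>\<^bsub>S\<^esub> farr H g)
            = farr K (f \<odot>\<^bsub>R\<^esub> g) \<cdot>\<^bsub>S\<^esub> ract (Dom R f) (Dom R g)"
    and lact_assoc: "a \<in> Obj R \<Longrightarrow> b \<in> Obj R \<Longrightarrow> p \<in> Obj R \<Longrightarrow>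
          farr K (Assoc R a b p) \<cdot>\<^bsub>S\<^esub> lact (a \<otimes>\<^bsub>R\<^esub> b) p \<cdot>\<^bsub>S\<^esub> (mmult H a b \<odot>\<^bsub>S\<^esub> Ide S (fobj K p))
            = lact a (b \<otimes>\<^bsub>R\<^esub> p) \<cdot>\<^bsub>S\<^esub> (Ide S (fobj H a) \<odot>\<^bsub>S\<^esub> lact b p)
                \<cdot>\<^bsub>S\<^esub> Assoc S (fobj H a) (fobj H b) (fobj K p)"
    and lact_ract_assoc: "a \<in> Obj R \<Longrightarrow> n \<in> Obj R \<Longrightarrow> c \<in> Obj R \<Longrightarrow>
          farr K (Assoc R a n c) \<cdot>\<^bsub>S\<^esub> ract (a \<otimes>\<^bsub>R\<^esub> n) c \<cdot>\<^bsub>S\<^esub> (lact a n \<odot>\<^bsub>S\<^esub> Ide S (fobj H c))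
            = lact a (n \<otimes>\<^bsub>R\<^esub> c) \<cdot>\<^bsub>S\<^esub> (Ide S (fobj H a) \<odot>\<^bsub>S\<^esub> ract n c)
                \<cdot>\<^bsub>S\<^esub> Assoc S (fobj H a) (fobj K n) (fobj H c)"
    and ract_assoc: "m \<in> Obj R \<Longrightarrow> b \<in> Obj R \<Longrightarrow> c \<in> Obj R \<Longrightarrow>
          farr K (Assoc R m b c) \<cdot>\<^bsub>S\<^esub> ract (m \<otimes>\<^bsub>R\<^esub> b) c \<cdot>\<^bsub>S\<^esub> (ract m b \<odot>\<^bsub>S\<^esub> Ide S (fobj H c))
            = ract m (b \<otimes>\<^bsub>R\<^esub> c) \<cdot>\<^bsub>S\<^esub> (Ide S (fobj K m) \<odot>\<^bsub>S\<^esub> mmult H b c)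
                \<cdot>\<^bsub>S\<^esub> Assoc S (fobj K m) (fobj H b) (fobj H c)"
    and lact_unit: "m \<in> Obj R \<Longrightarrow>
          farr K (Lun R m) \<cdot>\<^bsub>S\<^esub> lact \<one>\<^bsub>R\<^esub> m \<cdot>\<^bsub>S\<^esub> (munit H \<odot>\<^bsub>S\<^esub> Ide S (fobj K m)) = Lun S (fobj K m)"
    and ract_unit: "m \<in> Obj R \<Longrightarrow>
          farr K (Run R m) \<cdot>\<^bsub>S\<^esub> ract m \<one>\<^bsub>R\<^esub> \<cdot>\<^bsub>S\<^esub> (Ide S (fobj K m) \<odot>\<^bsub>S\<^esub> munit H) = Run S (fobj K m)"
    and lact_swap: "a \<in> Obj R \<Longrightarrow> n \<in> Obj R \<Longrightarrow>
          farr K (Swap R a n) \<cdot>\<^bsub>S\<^esub> lact a n = ract n a \<cdot>\<^bsub>S\<^esub> Swap S (fobj H a) (fobj K n)"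
begin

lemma act_simps [simp]:
  assumes "a \<in> Obj R" "b \<in> Obj R"
  shows "invertible S (lact a b)" "Dom S (lact a b) = fobj H a \<otimes>\<^bsub>S\<^esub> fobj K b"
    "Cod S (lact a b) = fobj K (a \<otimes>\<^bsub>R\<^esub> b)"
    "invertible S (ract a b)" "Dom S (ract a b) = fobj K a \<otimes>\<^bsub>S\<^esub> fobj H b"
    "Cod S (ract a b) = fobj K (a \<otimes>\<^bsub>R\<^esub> b)"
  using lact_iso[OF assms] ract_iso[OF assms] by (auto simp: iso_between_iff in_hom)

text \<open>Axiom \<open>lact_swap\<close> with the symmetries moved to the other sides, as swapping twice is the identity.\<close>

lemma ract_swap:
  assumes [simp]: "m \<in> Obj R" "b \<in> Obj R"
  shows "farr K (Swap R m b) \<cdot>\<^bsub>S\<^esub> ract m b = lact b m \<cdot>\<^bsub>S\<^esub> Swap S (fobj K m) (fobj H b)"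
proof (rule H.D.mono_cancel[of "farr K (Swap R b m)"])
  have e: "farr K (Swap R b m) \<cdot>\<^bsub>S\<^esub> farr K (Swap R m b) \<cdot>\<^bsub>S\<^esub> ract m b = ract m b"
    using K.farr_rewrite(2)[OF H.C.swap_swap_simps(1), of m b "ract m b"] by simp
  show "farr K (Swap R b m) \<cdot>\<^bsub>S\<^esub> farr K (Swap R m b) \<cdot>\<^bsub>S\<^esub> ract m b =
    farr K (Swap R b m) \<cdot>\<^bsub>S\<^esub> lact b m \<cdot>\<^bsub>S\<^esub> Swap S (fobj K m) (fobj H b)"
    unfolding e by (simp add: H.D.rewrite_prefix[OF lact_swap])
qed simp_all

end

lemma dual_simps [simp]:
  "Obj (dual_numbers R) = Obj R \<times> Obj R"
  "Arr (dual_numbers R) = Arr R \<times> Arr R"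
  "Dom (dual_numbers R) (f, m) = (Dom R f, Dom R m)"
  "Cod (dual_numbers R) (f, m) = (Cod R f, Cod R m)"
  "Ide (dual_numbers R) (A, M) = (Ide R A, Ide R M)"
  "(g, n) \<cdot>\<^bsub>dual_numbers R\<^esub> (f, m) = (g \<cdot>\<^bsub>R\<^esub> f, n \<cdot>\<^bsub>R\<^esub> m)"
  "(A, M) \<otimes>\<^bsub>dual_numbers R\<^esub> (B, N) = (A \<otimes>\<^bsub>R\<^esub> B, plus R (A \<otimes>\<^bsub>R\<^esub> N) (M \<otimes>\<^bsub>R\<^esub> B))"
  "(f, m) \<odot>\<^bsub>dual_numbers R\<^esub> (g, n) = (f \<odot>\<^bsub>R\<^esub> g, plusA R (f \<odot>\<^bsub>R\<^esub> n) (m \<odot>\<^bsub>R\<^esub> g))"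
  "\<one>\<^bsub>dual_numbers R\<^esub> = (\<one>\<^bsub>R\<^esub>, zero R)"
  "Lun (dual_numbers R) (A, M) = (Lun R A, copair R (Lun R M) (from_initial R (zero R \<otimes>\<^bsub>R\<^esub> A) M))"
  "Run (dual_numbers R) (A, M) = (Run R A, copair R (from_initial R (A \<otimes>\<^bsub>R\<^esub> zero R) M) (Run R M))"
  "Swap (dual_numbers R) (A, M) (B, N) =
    (Swap R A B, copair R (inr R (B \<otimes>\<^bsub>R\<^esub> M) (N \<otimes>\<^bsub>R\<^esub> A) \<cdot>\<^bsub>R\<^esub> Swap R A N) (inl R (B \<otimes>\<^bsub>R\<^esub> M) (N \<otimes>\<^bsub>R\<^esub> A) \<cdot>\<^bsub>R\<^esub> Swap R M B))"
  by (simp_all add: dual_numbers_def)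

lemma dual_hom [simp]: "hom (dual_numbers R) (A, M) (B, N) = hom R A B \<times> hom R M N"
  by (auto simp: hom_def)

lemma dual_iso_between [simp]:
  "iso_between (dual_numbers R) (f, m) (A, M) (B, N) \<longleftrightarrow> iso_between R f A B \<and> iso_between R m M N"
  by (auto simp: iso_between_def)

text \<open>The long second component of the associator of the dual numbers gets a name, so that rewriting
  with the definition of \<open>dual_numbers\<close> does not expose it.\<close>

definition dual_assoc where
  "dual_assoc R A M B N D P = snd (Assoc (dual_numbers R) (A, M) (B, N) (D, P))"

lemma dual_assoc_simp [simp]:
  "Assoc (dual_numbers R) (A, M) (B, N) (D, P) = (Assoc R A B D, dual_assoc R A M B N D P)"
  by (simp add: dual_assoc_def dual_numbers_def Let_def)

context doctrine_rig
begin

lemma dual_assoc_simps [simp]: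
  assumes "A \<in> Obj R" "M \<in> Obj R" "B \<in> Obj R" "N \<in> Obj R" "D \<in> Obj R" "P \<in> Obj R"
  shows "dual_assoc R A M B N D P \<in> Arr R"
    "Dom R (dual_assoc R A M B N D P) = plus R ((A \<otimes> B) \<otimes> P) (plus R (A \<otimes> N) (M \<otimes> B) \<otimes> D)"
    "Cod R (dual_assoc R A M B N D P) = plus R (A \<otimes> plus R (B \<otimes> P) (N \<otimes> D)) (M \<otimes> (B \<otimes> D))"
  using assms by (simp_all add: dual_assoc_def dual_numbers_def Let_def)

text \<open>The values of the associator on the three summands \<open>(A \<otimes> B) \<otimes> P\<close>, \<open>(A \<otimes> N) \<otimes> D\<close> and \<open>(M \<otimes> B) \<otimes> D\<close> of its
  source; by \<open>plus_tensor_eqI\<close> they determine it.\<close>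

lemma dual_assoc_inj:
  assumes "A \<in> Obj R" "M \<in> Obj R" "B \<in> Obj R" "N \<in> Obj R" "D \<in> Obj R" "P \<in> Obj R"
  defines "U \<equiv> plus R (B \<otimes> P) (N \<otimes> D)" and "V \<equiv> plus R (A \<otimes> N) (M \<otimes> B)"
  shows "dual_assoc R A M B N D P \<cdot> inl R ((A \<otimes> B) \<otimes> P) (V \<otimes> D)
      = inl R (A \<otimes> U) (M \<otimes> B \<otimes> D) \<cdot> (Ide R A \<odot> inl R (B \<otimes> P) (N \<otimes> D)) \<cdot> Assoc R A B P"
    and "dual_assoc R A M B N D P \<cdot> inr R ((A \<otimes> B) \<otimes> P) (V \<otimes> D) \<cdot> (inl R (A \<otimes> N) (M \<otimes> B) \<odot> Ide R D)
      = inl R (A \<otimes> U) (M \<otimes> B \<otimes> D) \<cdot> (Ide R A \<odot> inr R (B \<otimes> P) (N \<otimes> D)) \<cdot> Assoc R A N D"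
    and "dual_assoc R A M B N D P \<cdot> inr R ((A \<otimes> B) \<otimes> P) (V \<otimes> D) \<cdot> (inr R (A \<otimes> N) (M \<otimes> B) \<odot> Ide R D)
      = inr R (A \<otimes> U) (M \<otimes> B \<otimes> D) \<cdot> Assoc R M B D"
  using assms(1-6) by (simp_all add: U_def V_def dual_assoc_def dual_numbers_def Let_def)

lemma plus_tensor_eqI:
  assumes "h \<in> Arr R" "k \<in> Arr R" "Dom R h = plus R x (plus R a b \<otimes> c)" "Dom R k = plus R x (plus R a b \<otimes> c)"
    and "Cod R h = Cod R k" "x \<in> Obj R" "a \<in> Obj R" "b \<in> Obj R" "c \<in> Obj R"
    and "h \<cdot> inl R x (plus R a b \<otimes> c) = k \<cdot> inl R x (plus R a b \<otimes> c)"
    and "h \<cdot> inr R x (plus R a b \<otimes> c) \<cdot> (inl R a b \<odot> Ide R c) = k \<cdot> inr R x (plus R a b \<otimes> c) \<cdot> (inl R a b \<odot> Ide R c)"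
    and "h \<cdot> inr R x (plus R a b \<otimes> c) \<cdot> (inr R a b \<odot> Ide R c) = k \<cdot> inr R x (plus R a b \<otimes> c) \<cdot> (inr R a b \<odot> Ide R c)"
  shows "h = k"
proof (rule plus_eqI[of h k x "plus R a b \<otimes> c"])
  show "h \<cdot> inr R x (plus R a b \<otimes> c) = k \<cdot> inr R x (plus R a b \<otimes> c)"
    by (rule coproduct_eqI[OF tensor_coproduct(2)[of a b c]]) (use assms(1-9,11,12) in simp_all)
qed (use assms(1-10) in simp_all)

lemma plusA_invertible:
  assumes [simp]: "invertible R f" "invertible R g"
  shows "invertible R (plusA R f g)"
proof (rule invertibleI[of _ "plus R (Dom R f) (Dom R g)" "plus R (Cod R f) (Cod R g)"
      "plusA R (inverse_arr R f) (inverse_arr R g)"])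
  show "plusA R (inverse_arr R f) (inverse_arr R g) \<cdot> plusA R f g = Ide R (plus R (Dom R f) (Dom R g))"
    by (rule plus_eqI[of _ _ "Dom R f" "Dom R g"]) simp_all
  show "plusA R f g \<cdot> plusA R (inverse_arr R f) (inverse_arr R g) = Ide R (plus R (Cod R f) (Cod R g))"
    by (rule plus_eqI[of _ _ "Cod R f" "Cod R g"]) simp_all
qed (simp_all add: in_hom)

end

text \<open>The functor \<open>E (A, M) = (H A, K M)\<close> between dual numbers.  It is described by its values rather than
  defined as a record: the multiplicativity constraint is prescribed on objects of \<open>R\<close> only, where
  different formulas for it can be compared.\<close>

locale dual_functor =
  R: doctrine_rig \<A> R + S: doctrine_rig \<A> S + bimodule_functor R S H K lact ract
  for \<A> :: "('j, 'k) cat set" and R :: "('o, 'a) smcat" and S :: "('p, 'q) smcat"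
    and H :: "('o, 'a, 'p, 'q) mfctr" and K :: "('o, 'a, 'p, 'q) fctr" and lact ract +
  fixes E :: "('o \<times> 'o, 'a \<times> 'a, 'p \<times> 'p, 'q \<times> 'q) mfctr"
  assumes dual_R: "rig \<A> (dual_numbers R)" and dual_S: "rig \<A> (dual_numbers S)"
    and H_cocontinuous: "cocontinuous \<A> R S H" and K_cocontinuous: "cocontinuous \<A> R S K"
    and E_obj: "fobj E (A, M) = (fobj H A, fobj K M)"
    and E_arr: "farr E (f, m) = (farr H f, farr K m)"
    and E_unit: "munit E = (munit H, from_initial S (zero S) (fobj K (zero R)))"
    and E_mult: "A \<in> Obj R \<Longrightarrow> M \<in> Obj R \<Longrightarrow> B \<in> Obj R \<Longrightarrow> N \<in> Obj R \<Longrightarrow>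
      mmult E (A, M) (B, N) = (mmult H A B,
        copair S (farr K (inl R (A \<otimes>\<^bsub>R\<^esub> N) (M \<otimes>\<^bsub>R\<^esub> B)) \<cdot>\<^bsub>S\<^esub> lact A N)
                 (farr K (inr R (A \<otimes>\<^bsub>R\<^esub> N) (M \<otimes>\<^bsub>R\<^esub> B)) \<cdot>\<^bsub>S\<^esub> ract M B))"
begin

abbreviation mult where
  "mult A M B N \<equiv> copair S (farr K (inl R (A \<otimes>\<^bsub>R\<^esub> N) (M \<otimes>\<^bsub>R\<^esub> B)) \<cdot>\<^bsub>S\<^esub> lact A N)
                 (farr K (inr R (A \<otimes>\<^bsub>R\<^esub> N) (M \<otimes>\<^bsub>R\<^esub> B)) \<cdot>\<^bsub>S\<^esub> ract M B)"

lemma K_zero: "is_initial S (fobj K (zero R))"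
  by (rule cocontinuous_initial[OF R.doctrine K_cocontinuous R.zero_initial])

lemma K_plus:
  "a \<in> Obj R \<Longrightarrow> b \<in> Obj R \<Longrightarrow>
   is_coproduct S (fobj K a) (fobj K b) (fobj K (plus R a b)) (farr K (inl R a b)) (farr K (inr R a b))"
  by (rule cocontinuous_coproduct[OF R.doctrine K_cocontinuous R.plus_coproduct])

lemma mult_invertible:
  assumes [simp]: "A \<in> Obj R" "M \<in> Obj R" "B \<in> Obj R" "N \<in> Obj R"
  shows "invertible S (mult A M B N)"
proof -
  let ?i = "farr K (inl R (A \<otimes>\<^bsub>R\<^esub> N) (M \<otimes>\<^bsub>R\<^esub> B))" and ?j = "farr K (inr R (A \<otimes>\<^bsub>R\<^esub> N) (M \<otimes>\<^bsub>R\<^esub> B))"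
  have "mult A M B N = copair S ?i ?j \<cdot>\<^bsub>S\<^esub> plusA S (lact A N) (ract M B)"
    by (rule S.plus_eqI[of _ _ "fobj H A \<otimes>\<^bsub>S\<^esub> fobj K N" "fobj K M \<otimes>\<^bsub>S\<^esub> fobj H B"]) simp_all
  moreover have "invertible S (copair S ?i ?j)"
    by (rule S.copair_invertible[OF K_plus]) simp_all
  ultimately show ?thesis
    using S.plusA_invertible[of "lact A N" "ract M B"] by simp
qed

lemma mult_natural:
  assumes [simp]: "f \<in> Arr R" "m \<in> Arr R" "g \<in> Arr R" "n \<in> Arr R"
  shows "mult (Cod R f) (Cod R m) (Cod R g) (Cod R n) \<cdot>\<^bsub>S\<^esub> plusA S (farr H f \<odot>\<^bsub>S\<^esub> farr K n) (farr K m \<odot>\<^bsub>S\<^esub> farr H g)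
    = farr K (plusA R (f \<odot>\<^bsub>R\<^esub> n) (m \<odot>\<^bsub>R\<^esub> g)) \<cdot>\<^bsub>S\<^esub> mult (Dom R f) (Dom R m) (Dom R g) (Dom R n)"
proof -
  note l = K.farr_rewrite(2)[OF R.plusA_inj(1)] K.farr_rewrite(2)[OF R.plusA_inj(2)]
  show ?thesis
    by (rule S.plus_eqI[of _ _ "fobj H (Dom R f) \<otimes>\<^bsub>S\<^esub> fobj K (Dom R n)" "fobj K (Dom R m) \<otimes>\<^bsub>S\<^esub> fobj H (Dom R g)"])
       (simp_all add: lact_natural ract_natural l)
qed

lemma mult_lun:
  assumes [simp]: "A \<in> Obj R" "M \<in> Obj R"
  shows "farr K (copair R (Lun R M) (from_initial R (zero R \<otimes>\<^bsub>R\<^esub> A) M)) \<cdot>\<^bsub>S\<^esub> mult \<one>\<^bsub>R\<^esub> (zero R) A M \<cdot>\<^bsub>S\<^esub>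
      plusA S (munit H \<odot>\<^bsub>S\<^esub> Ide S (fobj K M)) (from_initial S (zero S) (fobj K (zero R)) \<odot>\<^bsub>S\<^esub> Ide S (fobj H A))
    = copair S (Lun S (fobj K M)) (from_initial S (zero S \<otimes>\<^bsub>S\<^esub> fobj H A) (fobj K M))"
proof -
  have z: "is_initial R (zero R \<otimes>\<^bsub>R\<^esub> A)" "is_initial S (zero S \<otimes>\<^bsub>S\<^esub> fobj H A)"
    using R.tensor_initial(2)[OF _ R.zero_initial] S.tensor_initial(2)[OF _ S.zero_initial] by simp_all
  note [simp] = R.from_initial_simps[OF z(1)] S.from_initial_simps[OF z(2)] S.from_initial_simps[OF S.zero_initial]
  have l: "copair R (Lun R M) (from_initial R (zero R \<otimes>\<^bsub>R\<^esub> A) M) \<cdot>\<^bsub>R\<^esub> inl R (\<one>\<^bsub>R\<^esub> \<otimes>\<^bsub>R\<^esub> M) (zero R \<otimes>\<^bsub>R\<^esub> A) = Lun R M"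
    by simp
  show ?thesis
  proof (rule S.plus_eqI[of _ _ "\<one>\<^bsub>S\<^esub> \<otimes>\<^bsub>S\<^esub> fobj K M" "zero S \<otimes>\<^bsub>S\<^esub> fobj H A"], goal_cases)
    \<comment> \<open>On the second summand, which is initial, there is nothing to compare.\<close>
    case 7
    show ?case
      by (rule S.initial_eqI[OF z(2)]) simp_all
  qed (simp_all add: K.farr_rewrite(2)[OF l] lact_unit)
qed

lemma mult_run:
  assumes [simp]: "A \<in> Obj R" "M \<in> Obj R"
  shows "farr K (copair R (from_initial R (A \<otimes>\<^bsub>R\<^esub> zero R) M) (Run R M)) \<cdot>\<^bsub>S\<^esub> mult A M \<one>\<^bsub>R\<^esub> (zero R) \<cdot>\<^bsub>S\<^esub>
      plusA S (Ide S (fobj H A) \<odot>\<^bsub>S\<^esub> from_initial S (zero S) (fobj K (zero R))) (Ide S (fobj K M) \<odot>\<^bsub>S\<^esub> munit H)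
    = copair S (from_initial S (fobj H A \<otimes>\<^bsub>S\<^esub> zero S) (fobj K M)) (Run S (fobj K M))"
proof -
  have z: "is_initial R (A \<otimes>\<^bsub>R\<^esub> zero R)" "is_initial S (fobj H A \<otimes>\<^bsub>S\<^esub> zero S)"
    using R.tensor_initial(1)[OF _ R.zero_initial] S.tensor_initial(1)[OF _ S.zero_initial] by simp_all
  note [simp] = R.from_initial_simps[OF z(1)] S.from_initial_simps[OF z(2)] S.from_initial_simps[OF S.zero_initial]
  have l: "copair R (from_initial R (A \<otimes>\<^bsub>R\<^esub> zero R) M) (Run R M) \<cdot>\<^bsub>R\<^esub> inr R (A \<otimes>\<^bsub>R\<^esub> zero R) (M \<otimes>\<^bsub>R\<^esub> \<one>\<^bsub>R\<^esub>) = Run R M"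
    by simp
  show ?thesis
  proof (rule S.plus_eqI[of _ _ "fobj H A \<otimes>\<^bsub>S\<^esub> zero S" "fobj K M \<otimes>\<^bsub>S\<^esub> \<one>\<^bsub>S\<^esub>"], goal_cases)
    \<comment> \<open>The first summand is initial.\<close>
    case 6
    show ?case
      by (rule S.initial_eqI[OF z(2)]) simp_all
  qed (simp_all add: K.farr_rewrite(2)[OF l] ract_unit)
qed

lemma mult_swap:
  assumes [simp]: "A \<in> Obj R" "M \<in> Obj R" "B \<in> Obj R" "N \<in> Obj R"
  shows "farr K (copair R (inr R (B \<otimes>\<^bsub>R\<^esub> M) (N \<otimes>\<^bsub>R\<^esub> A) \<cdot>\<^bsub>R\<^esub> Swap R A N) (inl R (B \<otimes>\<^bsub>R\<^esub> M) (N \<otimes>\<^bsub>R\<^esub> A) \<cdot>\<^bsub>R\<^esub> Swap R M B)) \<cdot>\<^bsub>S\<^esub> mult A M B N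
    = mult B N A M \<cdot>\<^bsub>S\<^esub> copair S
       (inr S (fobj H B \<otimes>\<^bsub>S\<^esub> fobj K M) (fobj K N \<otimes>\<^bsub>S\<^esub> fobj H A) \<cdot>\<^bsub>S\<^esub> Swap S (fobj H A) (fobj K N))
       (inl S (fobj H B \<otimes>\<^bsub>S\<^esub> fobj K M) (fobj K N \<otimes>\<^bsub>S\<^esub> fobj H A) \<cdot>\<^bsub>S\<^esub> Swap S (fobj K M) (fobj H B))"
proof -
  note l = K.farr_rewrite(2)[OF R.copair_inj(1)] K.farr_rewrite(2)[OF R.copair_inj(2)]
  show ?thesis
    by (rule S.plus_eqI[of _ _ "fobj H A \<otimes>\<^bsub>S\<^esub> fobj K N" "fobj K M \<otimes>\<^bsub>S\<^esub> fobj H B"])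
       (simp_all add: l lact_swap ract_swap)
qed

text \<open>The three summands of the source are the three positions of the mark, so they lead to the three
  associativity laws of the actions.\<close>

lemma mult_assoc:
  assumes [simp]: "A \<in> Obj R" "M \<in> Obj R" "B \<in> Obj R" "N \<in> Obj R" "D \<in> Obj R" "P \<in> Obj R"
  shows "farr K (dual_assoc R A M B N D P) \<cdot>\<^bsub>S\<^esub> mult (A \<otimes>\<^bsub>R\<^esub> B) (plus R (A \<otimes>\<^bsub>R\<^esub> N) (M \<otimes>\<^bsub>R\<^esub> B)) D P \<cdot>\<^bsub>S\<^esub>
      plusA S (mmult H A B \<odot>\<^bsub>S\<^esub> Ide S (fobj K P)) (mult A M B N \<odot>\<^bsub>S\<^esub> Ide S (fobj H D))
    = mult A M (B \<otimes>\<^bsub>R\<^esub> D) (plus R (B \<otimes>\<^bsub>R\<^esub> P) (N \<otimes>\<^bsub>R\<^esub> D)) \<cdot>\<^bsub>S\<^esub>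
      plusA S (Ide S (fobj H A) \<odot>\<^bsub>S\<^esub> mult B N D P) (Ide S (fobj K M) \<odot>\<^bsub>S\<^esub> mmult H B D) \<cdot>\<^bsub>S\<^esub>
      dual_assoc S (fobj H A) (fobj K M) (fobj H B) (fobj K N) (fobj H D) (fobj K P)"
    (is "?L = ?R")
proof -
  let ?U = "plus R (B \<otimes>\<^bsub>R\<^esub> P) (N \<otimes>\<^bsub>R\<^esub> D)" and ?V = "plus R (A \<otimes>\<^bsub>R\<^esub> N) (M \<otimes>\<^bsub>R\<^esub> B)"
  let ?i = "inl R (A \<otimes>\<^bsub>R\<^esub> ?U) (M \<otimes>\<^bsub>R\<^esub> B \<otimes>\<^bsub>R\<^esub> D)" and ?j = "inr R (A \<otimes>\<^bsub>R\<^esub> ?U) (M \<otimes>\<^bsub>R\<^esub> B \<otimes>\<^bsub>R\<^esub> D)"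
  let ?y = "inr R ((A \<otimes>\<^bsub>R\<^esub> B) \<otimes>\<^bsub>R\<^esub> P) (?V \<otimes>\<^bsub>R\<^esub> D)"
  let ?hA = "fobj H A" and ?kM = "fobj K M" and ?hB = "fobj H B" and ?kN = "fobj K N"
    and ?hD = "fobj H D" and ?kP = "fobj K P"
  let ?V' = "plus S (?hA \<otimes>\<^bsub>S\<^esub> ?kN) (?kM \<otimes>\<^bsub>S\<^esub> ?hB)"
  let ?x' = "inl S ((?hA \<otimes>\<^bsub>S\<^esub> ?hB) \<otimes>\<^bsub>S\<^esub> ?kP) (?V' \<otimes>\<^bsub>S\<^esub> ?hD)"
    and ?y' = "inr S ((?hA \<otimes>\<^bsub>S\<^esub> ?hB) \<otimes>\<^bsub>S\<^esub> ?kP) (?V' \<otimes>\<^bsub>S\<^esub> ?hD)"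
    and ?u' = "inl S (?hA \<otimes>\<^bsub>S\<^esub> ?kN) (?kM \<otimes>\<^bsub>S\<^esub> ?hB)"
    and ?v' = "inr S (?hA \<otimes>\<^bsub>S\<^esub> ?kN) (?kM \<otimes>\<^bsub>S\<^esub> ?hB)"
    and ?u = "inl R (A \<otimes>\<^bsub>R\<^esub> N) (M \<otimes>\<^bsub>R\<^esub> B)"
    and ?v = "inr R (A \<otimes>\<^bsub>R\<^esub> N) (M \<otimes>\<^bsub>R\<^esub> B)"
    and ?w = "inl R (B \<otimes>\<^bsub>R\<^esub> P) (N \<otimes>\<^bsub>R\<^esub> D)"
    and ?z = "inr R (B \<otimes>\<^bsub>R\<^esub> P) (N \<otimes>\<^bsub>R\<^esub> D)"
  note dR = R.dual_assoc_inj[of A M B N D P]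
  note dS = S.dual_assoc_inj[of ?hA ?kM ?hB ?kN ?hD ?kP]
  show ?thesis
  proof (rule S.plus_tensor_eqI[of _ _ "(?hA \<otimes>\<^bsub>S\<^esub> ?hB) \<otimes>\<^bsub>S\<^esub> ?kP" "?hA \<otimes>\<^bsub>S\<^esub> ?kN" "?kM \<otimes>\<^bsub>S\<^esub> ?hB" ?hD])
    have n: "lact A ?U \<cdot>\<^bsub>S\<^esub> (Ide S ?hA \<odot>\<^bsub>S\<^esub> farr K ?w)
      = farr K (Ide R A \<odot>\<^bsub>R\<^esub> ?w) \<cdot>\<^bsub>S\<^esub> lact A (B \<otimes>\<^bsub>R\<^esub> P)"
      using lact_natural[of "Ide R A" "?w"] by simp
    have "?L \<cdot>\<^bsub>S\<^esub> ?x'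
      = farr K ?i \<cdot>\<^bsub>S\<^esub> farr K (Ide R A \<odot>\<^bsub>R\<^esub> ?w) \<cdot>\<^bsub>S\<^esub>
        (farr K (Assoc R A B P) \<cdot>\<^bsub>S\<^esub> lact (A \<otimes>\<^bsub>R\<^esub> B) P \<cdot>\<^bsub>S\<^esub> (mmult H A B \<odot>\<^bsub>S\<^esub> Ide S ?kP))"
      by (simp add: K.farr_rewrite(2)[OF dR(1)])
    also have "\<dots> = farr K ?i \<cdot>\<^bsub>S\<^esub> (farr K (Ide R A \<odot>\<^bsub>R\<^esub> ?w) \<cdot>\<^bsub>S\<^esub> lact A (B \<otimes>\<^bsub>R\<^esub> P)) \<cdot>\<^bsub>S\<^esub>
        (Ide S ?hA \<odot>\<^bsub>S\<^esub> lact B P) \<cdot>\<^bsub>S\<^esub> Assoc S ?hA ?hB ?kP"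
      by (simp add: lact_assoc)
    also have "\<dots> = ?R \<cdot>\<^bsub>S\<^esub> ?x'"
      unfolding n[symmetric] by (simp add: dS(1))
    finally show "?L \<cdot>\<^bsub>S\<^esub> ?x' = ?R \<cdot>\<^bsub>S\<^esub> ?x'" .
  next
    have n1: "ract ?V D \<cdot>\<^bsub>S\<^esub> (farr K ?u \<odot>\<^bsub>S\<^esub> Ide S ?hD)
      = farr K (?u \<odot>\<^bsub>R\<^esub> Ide R D) \<cdot>\<^bsub>S\<^esub> ract (A \<otimes>\<^bsub>R\<^esub> N) D"
      using ract_natural[of "?u" "Ide R D"] by simp
    have n2: "lact A ?U \<cdot>\<^bsub>S\<^esub> (Ide S ?hA \<odot>\<^bsub>S\<^esub> farr K ?z)
      = farr K (Ide R A \<odot>\<^bsub>R\<^esub> ?z) \<cdot>\<^bsub>S\<^esub> lact A (N \<otimes>\<^bsub>R\<^esub> D)"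
      using lact_natural[of "Ide R A" "?z"] by simp
    have "?L \<cdot>\<^bsub>S\<^esub> ?y' \<cdot>\<^bsub>S\<^esub> (?u' \<odot>\<^bsub>S\<^esub> Ide S ?hD)
      = farr K (dual_assoc R A M B N D P) \<cdot>\<^bsub>S\<^esub> farr K ?y \<cdot>\<^bsub>S\<^esub>
        (ract ?V D \<cdot>\<^bsub>S\<^esub> (farr K ?u \<odot>\<^bsub>S\<^esub> Ide S ?hD)) \<cdot>\<^bsub>S\<^esub> (lact A N \<odot>\<^bsub>S\<^esub> Ide S ?hD)"
      by simp
    also have "\<dots> = farr K (dual_assoc R A M B N D P \<cdot>\<^bsub>R\<^esub> ?y \<cdot>\<^bsub>R\<^esub> (?u \<odot>\<^bsub>R\<^esub> Ide R D)) \<cdot>\<^bsub>S\<^esub>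
        ract (A \<otimes>\<^bsub>R\<^esub> N) D \<cdot>\<^bsub>S\<^esub> (lact A N \<odot>\<^bsub>S\<^esub> Ide S ?hD)"
      unfolding n1 by simp
    also have "\<dots> = farr K ?i \<cdot>\<^bsub>S\<^esub> farr K (Ide R A \<odot>\<^bsub>R\<^esub> ?z) \<cdot>\<^bsub>S\<^esub>
        (farr K (Assoc R A N D) \<cdot>\<^bsub>S\<^esub> ract (A \<otimes>\<^bsub>R\<^esub> N) D \<cdot>\<^bsub>S\<^esub> (lact A N \<odot>\<^bsub>S\<^esub> Ide S ?hD))"
      by (simp add: dR(2))
    also have "\<dots> = farr K ?i \<cdot>\<^bsub>S\<^esub> (farr K (Ide R A \<odot>\<^bsub>R\<^esub> ?z) \<cdot>\<^bsub>S\<^esub> lact A (N \<otimes>\<^bsub>R\<^esub> D)) \<cdot>\<^bsub>S\<^esub>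
        (Ide S ?hA \<odot>\<^bsub>S\<^esub> ract N D) \<cdot>\<^bsub>S\<^esub> Assoc S ?hA ?kN ?hD"
      by (simp add: lact_ract_assoc)
    also have "\<dots> = ?R \<cdot>\<^bsub>S\<^esub> ?y' \<cdot>\<^bsub>S\<^esub> (?u' \<odot>\<^bsub>S\<^esub> Ide S ?hD)"
      unfolding n2[symmetric] by (simp add: dS(2))
    finally show "?L \<cdot>\<^bsub>S\<^esub> ?y' \<cdot>\<^bsub>S\<^esub> (?u' \<odot>\<^bsub>S\<^esub> Ide S ?hD)
      = ?R \<cdot>\<^bsub>S\<^esub> ?y' \<cdot>\<^bsub>S\<^esub> (?u' \<odot>\<^bsub>S\<^esub> Ide S ?hD)" .
  next
    have n1: "ract ?V D \<cdot>\<^bsub>S\<^esub> (farr K ?v \<odot>\<^bsub>S\<^esub> Ide S ?hD)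
      = farr K (?v \<odot>\<^bsub>R\<^esub> Ide R D) \<cdot>\<^bsub>S\<^esub> ract (M \<otimes>\<^bsub>R\<^esub> B) D"
      using ract_natural[of "?v" "Ide R D"] by simp
    have "?L \<cdot>\<^bsub>S\<^esub> ?y' \<cdot>\<^bsub>S\<^esub> (?v' \<odot>\<^bsub>S\<^esub> Ide S ?hD)
      = farr K (dual_assoc R A M B N D P) \<cdot>\<^bsub>S\<^esub> farr K ?y \<cdot>\<^bsub>S\<^esub>
        (ract ?V D \<cdot>\<^bsub>S\<^esub> (farr K ?v \<odot>\<^bsub>S\<^esub> Ide S ?hD)) \<cdot>\<^bsub>S\<^esub> (ract M B \<odot>\<^bsub>S\<^esub> Ide S ?hD)"
      by simp
    also have "\<dots> = farr K (dual_assoc R A M B N D P \<cdot>\<^bsub>R\<^esub> ?y \<cdot>\<^bsub>R\<^esub> (?v \<odot>\<^bsub>R\<^esub> Ide R D)) \<cdot>\<^bsub>S\<^esub>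
        ract (M \<otimes>\<^bsub>R\<^esub> B) D \<cdot>\<^bsub>S\<^esub> (ract M B \<odot>\<^bsub>S\<^esub> Ide S ?hD)"
      unfolding n1 by simp
    also have "\<dots> = farr K ?j \<cdot>\<^bsub>S\<^esub>
        (farr K (Assoc R M B D) \<cdot>\<^bsub>S\<^esub> ract (M \<otimes>\<^bsub>R\<^esub> B) D \<cdot>\<^bsub>S\<^esub> (ract M B \<odot>\<^bsub>S\<^esub> Ide S ?hD))"
      by (simp add: dR(3))
    also have "\<dots> = ?R \<cdot>\<^bsub>S\<^esub> ?y' \<cdot>\<^bsub>S\<^esub> (?v' \<odot>\<^bsub>S\<^esub> Ide S ?hD)"
      by (simp add: ract_assoc dS(3))
    finally show "?L \<cdot>\<^bsub>S\<^esub> ?y' \<cdot>\<^bsub>S\<^esub> (?v' \<odot>\<^bsub>S\<^esub> Ide S ?hD)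
      = ?R \<cdot>\<^bsub>S\<^esub> ?y' \<cdot>\<^bsub>S\<^esub> (?v' \<odot>\<^bsub>S\<^esub> Ide S ?hD)" .
  qed simp_all
qed

end

section \<open>Colimits of dual numbers\<close>

lemma dual_comp: "x \<cdot>\<^bsub>dual_numbers R\<^esub> y = (fst x \<cdot>\<^bsub>R\<^esub> fst y, snd x \<cdot>\<^bsub>R\<^esub> snd y)"
  by (cases x; cases y) simp

lemma dual_invertible [simp]: "invertible (dual_numbers R) (f, m) \<longleftrightarrow> invertible R f \<and> invertible R m"
  by (simp add: invertible_def)

lemma in_dual_hom:
  "x \<in> hom (dual_numbers R) a b \<longleftrightarrow> fst x \<in> hom R (fst a) (fst b) \<and> snd x \<in> hom R (snd a) (snd b)"
  by (cases x; cases a; cases b) simp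

definition first_part :: "('j, 'k, 'o \<times> 'o, 'a \<times> 'a, 'l) fctr_scheme \<Rightarrow> ('j, 'k, 'o, 'a) fctr" where
  "first_part P = \<lparr>fobj = (\<lambda>j. fst (fobj P j)), farr = (\<lambda>u. fst (farr P u))\<rparr>"

definition second_part :: "('j, 'k, 'o \<times> 'o, 'a \<times> 'a, 'l) fctr_scheme \<Rightarrow> ('j, 'k, 'o, 'a) fctr" where
  "second_part P = \<lparr>fobj = (\<lambda>j. snd (fobj P j)), farr = (\<lambda>u. snd (farr P u))\<rparr>"

lemma dual_cocone_iff:
  "is_cocone J (dual_numbers R) P c \<kappa> \<longleftrightarrow>
   is_cocone J R (first_part P) (fst c) (\<lambda>j. fst (\<kappa> j)) \<and> is_cocone J R (second_part P) (snd c) (\<lambda>j. snd (\<kappa> j))"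
  by (auto simp: is_cocone_def first_part_def second_part_def in_dual_hom dual_comp prod_eq_iff mem_Times_iff)

text \<open>Colimits of dual numbers are computed componentwise.  From left to right, a cocone under one
  component is completed by the given cocone under the other component, whose factorisation through
  itself is the identity.\<close>

lemma dual_colimit_iff:
  assumes "category R"
  shows "is_colimit J (dual_numbers R) P c \<kappa> \<longleftrightarrow>
   is_colimit J R (first_part P) (fst c) (\<lambda>j. fst (\<kappa> j)) \<and> is_colimit J R (second_part P) (snd c) (\<lambda>j. snd (\<kappa> j))"
    (is "?L \<longleftrightarrow> ?R")
proof
  assume L: ?L
  then have cc: "is_cocone J R (first_part P) (fst c) (\<lambda>j. fst (\<kappa> j))" "is_cocone J R (second_part P) (snd c) (\<lambda>j. snd (\<kappa> j))"
    by (simp_all add: is_colimit_def dual_cocone_iff)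
  have univ: "\<exists>!h. h \<in> hom (dual_numbers R) c (a, b) \<and> (\<forall>j\<in>Obj J. h \<cdot>\<^bsub>dual_numbers R\<^esub> \<kappa> j = (\<kappa>1 j, \<kappa>2 j))"
    if "is_cocone J R (first_part P) a \<kappa>1" "is_cocone J R (second_part P) b \<kappa>2" for a b \<kappa>1 \<kappa>2
  proof -
    have "is_cocone J (dual_numbers R) P (a, b) (\<lambda>j. (\<kappa>1 j, \<kappa>2 j))"
      using that by (simp add: dual_cocone_iff)
    then show ?thesis
      using L unfolding is_colimit_def by blast
  qed
  have "\<exists>!h. h \<in> hom R (fst c) a \<and> (\<forall>j\<in>Obj J. h \<cdot>\<^bsub>R\<^esub> fst (\<kappa> j) = \<kappa>1 j)"
    if "is_cocone J R (first_part P) a \<kappa>1" for a \<kappa>1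
  proof (rule ex_ex1I)
    show "\<exists>h. h \<in> hom R (fst c) a \<and> (\<forall>j\<in>Obj J. h \<cdot>\<^bsub>R\<^esub> fst (\<kappa> j) = \<kappa>1 j)"
      using univ[OF that cc(2)] by (auto simp: in_dual_hom dual_comp)
  next
    fix h k
    assume hk: "h \<in> hom R (fst c) a \<and> (\<forall>j\<in>Obj J. h \<cdot>\<^bsub>R\<^esub> fst (\<kappa> j) = \<kappa>1 j)"
      "k \<in> hom R (fst c) a \<and> (\<forall>j\<in>Obj J. k \<cdot>\<^bsub>R\<^esub> fst (\<kappa> j) = \<kappa>1 j)"
    let ?i = "Ide R (snd c)"
    have i: "?i \<in> hom R (snd c) (snd c)" "\<forall>j\<in>Obj J. ?i \<cdot>\<^bsub>R\<^esub> snd (\<kappa> j) = snd (\<kappa> j)"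
      using cc(2) category.ide_hom[OF assms] category.comp_ide_left[OF assms]
      unfolding is_cocone_def by blast+
    have "(h, ?i) = (k, ?i)"
      by (rule ex1E[OF univ[OF that cc(2)]]) (use hk i in \<open>auto simp: in_dual_hom dual_comp\<close>)
    then show "h = k" by simp
  qed
  moreover have "\<exists>!h. h \<in> hom R (snd c) b \<and> (\<forall>j\<in>Obj J. h \<cdot>\<^bsub>R\<^esub> snd (\<kappa> j) = \<kappa>2 j)"
    if "is_cocone J R (second_part P) b \<kappa>2" for b \<kappa>2
  proof (rule ex_ex1I)
    show "\<exists>h. h \<in> hom R (snd c) b \<and> (\<forall>j\<in>Obj J. h \<cdot>\<^bsub>R\<^esub> snd (\<kappa> j) = \<kappa>2 j)"
      using univ[OF cc(1) that] by (auto simp: in_dual_hom dual_comp)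
  next
    fix h k
    assume hk: "h \<in> hom R (snd c) b \<and> (\<forall>j\<in>Obj J. h \<cdot>\<^bsub>R\<^esub> snd (\<kappa> j) = \<kappa>2 j)"
      "k \<in> hom R (snd c) b \<and> (\<forall>j\<in>Obj J. k \<cdot>\<^bsub>R\<^esub> snd (\<kappa> j) = \<kappa>2 j)"
    let ?i = "Ide R (fst c)"
    have i: "?i \<in> hom R (fst c) (fst c)" "\<forall>j\<in>Obj J. ?i \<cdot>\<^bsub>R\<^esub> fst (\<kappa> j) = fst (\<kappa> j)"
      using cc(1) category.ide_hom[OF assms] category.comp_ide_left[OF assms]
      unfolding is_cocone_def by blast+
    have "(?i, h) = (?i, k)"
      by (rule ex1E[OF univ[OF cc(1) that]]) (use hk i in \<open>auto simp: in_dual_hom dual_comp\<close>)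
    then show "h = k" by simp
  qed
  ultimately show ?R
    using cc by (simp add: is_colimit_def)
next
  assume R: ?R
  have "\<exists>!h. h \<in> hom (dual_numbers R) c c' \<and> (\<forall>j\<in>Obj J. h \<cdot>\<^bsub>dual_numbers R\<^esub> \<kappa> j = \<kappa>' j)"
    if "is_cocone J (dual_numbers R) P c' \<kappa>'" for c' \<kappa>'
  proof -
    define P1 where "P1 h \<longleftrightarrow> h \<in> hom R (fst c) (fst c') \<and> (\<forall>j\<in>Obj J. h \<cdot>\<^bsub>R\<^esub> fst (\<kappa> j) = fst (\<kappa>' j))" for h
    define P2 where "P2 h \<longleftrightarrow> h \<in> hom R (snd c) (snd c') \<and> (\<forall>j\<in>Obj J. h \<cdot>\<^bsub>R\<^esub> snd (\<kappa> j) = snd (\<kappa>' j))" for h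
    have "\<exists>!h. P1 h" "\<exists>!h. P2 h"
      using R that unfolding is_colimit_def dual_cocone_iff P1_def P2_def by blast+
    then obtain h1 h2 where h: "P1 h1" "\<forall>h. P1 h \<longrightarrow> h = h1" "P2 h2" "\<forall>h. P2 h \<longrightarrow> h = h2"
      by (elim ex1E)
    have "(h \<in> hom (dual_numbers R) c c' \<and> (\<forall>j\<in>Obj J. h \<cdot>\<^bsub>dual_numbers R\<^esub> \<kappa> j = \<kappa>' j)) \<longleftrightarrow> P1 (fst h) \<and> P2 (snd h)" for h
      by (auto simp: in_dual_hom dual_comp prod_eq_iff P1_def P2_def)
    moreover have "\<exists>!h. P1 (fst h) \<and> P2 (snd h)"
    proof (rule ex1I[of _ "(h1, h2)"])
      show "k = (h1, h2)" if "P1 (fst k) \<and> P2 (snd k)" for k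
        unfolding prod_eq_iff fst_conv snd_conv using h(2,4) that by blast
    qed (use h(1,3) in simp)
    ultimately show ?thesis
      by (simp only:)
  qed
  then show ?L
    using R by (simp add: is_colimit_def dual_cocone_iff)
qed

lemma dual_parts_functor:
  assumes "is_functor J (dual_numbers R) P" "category R"
  shows "is_functor J R (first_part P)" "is_functor J R (second_part P)"
proof -
  interpret P: is_functor J "dual_numbers R" P by fact
  interpret R: category R by fact
  have o: "fst (fobj P a) \<in> Obj R \<and> snd (fobj P a) \<in> Obj R" if "a \<in> Obj J" for a
    using P.fobj_obj[OF that] by (cases "fobj P a") simp
  have h: "fst (farr P f) \<in> hom R (fst (fobj P a)) (fst (fobj P b)) \<and>
      snd (farr P f) \<in> hom R (snd (fobj P a)) (snd (fobj P b))" if "f \<in> hom J a b" for f a b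
    using P.farr_hom[OF that] by (simp add: in_dual_hom)
  have i: "fst (farr P (Ide J a)) = Ide R (fst (fobj P a)) \<and> snd (farr P (Ide J a)) = Ide R (snd (fobj P a))"
    if "a \<in> Obj J" for a
    using P.farr_ide[OF that] by (cases "fobj P a") simp
  have c: "fst (farr P (g \<cdot>\<^bsub>J\<^esub> f)) = fst (farr P g) \<cdot>\<^bsub>R\<^esub> fst (farr P f) \<and>
      snd (farr P (g \<cdot>\<^bsub>J\<^esub> f)) = snd (farr P g) \<cdot>\<^bsub>R\<^esub> snd (farr P f)" if "f \<in> hom J a b" "g \<in> hom J b c" for f g a b c
    using P.farr_comp[OF that] by (simp add: dual_comp)
  show "is_functor J R (first_part P)" "is_functor J R (second_part P)"
    by (unfold_locales; use o h i c in \<open>auto simp: first_part_def second_part_def\<close>)+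
qed

lemma dual_proj_rig_map:
  assumes "additive_doctrine \<A>" "rig \<A> R" "rig \<A> (dual_numbers R)"
  shows "rig_map \<A> (dual_numbers R) R (dual_proj R)"
proof -
  interpret R: doctrine_rig \<A> R
    using assms by (simp add: doctrine_rig_def)
  interpret D: symmetric_monoidal_category "dual_numbers R"
    using assms by (simp add: rig_def)
  have "symmetric_monoidal_functor (dual_numbers R) R (dual_proj R)"
    by unfold_locales (auto simp: dual_proj_def in_hom iso_between_iff)
  then interpret P: symmetric_monoidal_functor "dual_numbers R" R "dual_proj R" .
  have "cocontinuous \<A> (dual_numbers R) R (dual_proj R)"
    unfolding cocontinuous_def
  proof (intro conjI ballI allI impI; (elim conjE)?)
    show "is_functor (dual_numbers R) R (dual_proj R)" ..
    fix J and P :: "('a, 'b, 'c \<times> 'c, 'd \<times> 'd) fctr" and c \<kappa>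
    assume "is_colimit J (dual_numbers R) P c \<kappa>"
    then have "is_colimit J R (first_part P) (fst c) (\<lambda>j. fst (\<kappa> j))"
      by (simp add: dual_colimit_iff[OF R.category_axioms])
    then show "is_colimit J R (comp_fctr (dual_proj R) P) (fobj (dual_proj R) c) (\<lambda>j. farr (dual_proj R) (\<kappa> j))"
      by (simp add: dual_proj_def comp_fctr_def first_part_def)
  qed
  then show ?thesis
    using assms P.symmetric_monoidal_functor_axioms by (simp add: rig_map_def)
qed

section \<open>The functor of dual numbers is a rig map\<close>

context dual_functor
begin

lemma E_monoidal: "symmetric_monoidal_functor (dual_numbers R) (dual_numbers S) E"
proof -
  interpret DR: symmetric_monoidal_category "dual_numbers R"
    using dual_R by (simp add: rig_def)
  interpret DS: symmetric_monoidal_category "dual_numbers S"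
    using dual_S by (simp add: rig_def)
  note E [simp] = E_obj E_arr E_unit E_mult
  show ?thesis
  proof (unfold_locales, goal_cases)
    case (1 a)
    then show ?case by (cases a) simp
  next
    case (2 f a b)
    then show ?case by (cases f; cases a; cases b) (simp add: in_hom)
  next
    case (3 a)
    then show ?case by (cases a) simp
  next
    case (4 f a b g c)
    then show ?case by (cases f; cases g; cases a; cases b; cases c) (simp add: in_hom)
  next
    case 5
    show ?case
      using S.from_initial_simps[OF S.zero_initial] S.from_initial_invertible[OF S.zero_initial K_zero]
      by (simp add: iso_between_iff in_hom)
  next
    case (6 a b)
    then show ?case
      using mult_invertible by (cases a; cases b) (auto simp: iso_between_iff in_hom)
  next
    case (7 f a a' g b b')
    obtain f1 f2 g1 g2 where [simp]: "f = (f1, f2)" "g = (g1, g2)"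
      by (metis surj_pair)
    from 7 have [simp]: "f1 \<in> Arr R" "f2 \<in> Arr R" "g1 \<in> Arr R" "g2 \<in> Arr R"
        "a = (Dom R f1, Dom R f2)" "a' = (Cod R f1, Cod R f2)" "b = (Dom R g1, Dom R g2)" "b' = (Cod R g1, Cod R g2)"
      by (auto simp: in_hom)
    show ?case
      using H.mmult_natural[of f1 g1] mult_natural[of f1 f2 g1 g2] by simp
  next
    case (8 a b c)
    obtain A M B N D P where [simp]: "a = (A, M)" "b = (B, N)" "c = (D, P)"
      by (metis surj_pair)
    from 8 have "A \<in> Obj R" "M \<in> Obj R" "B \<in> Obj R" "N \<in> Obj R" "D \<in> Obj R" "P \<in> Obj R"
      by auto
    then show ?case
      using mult_assoc[of A M B N D P] H.mmult_assoc[of A B D] by simp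
  next
    case (9 a)
    obtain A M where [simp]: "a = (A, M)"
      by (metis surj_pair)
    from 9 show ?case
      using mult_lun[of A M] H.mmult_lun[of A] by simp
  next
    case (10 a)
    obtain A M where [simp]: "a = (A, M)"
      by (metis surj_pair)
    from 10 show ?case
      using mult_run[of A M] H.mmult_run[of A] by simp
  next
    case (11 a b)
    obtain A M B N where [simp]: "a = (A, M)" "b = (B, N)"
      by (metis surj_pair)
    from 11 show ?case
      using mult_swap[of A M B N] H.mmult_swap[of A B] by simp
  qed
qed

lemma E_cocontinuous: "cocontinuous \<A> (dual_numbers R) (dual_numbers S) E"
  unfolding cocontinuous_def
proof (intro conjI ballI allI impI; (elim conjE)?)
  interpret E: symmetric_monoidal_functor "dual_numbers R" "dual_numbers S" E
    by (rule E_monoidal)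
  show "is_functor (dual_numbers R) (dual_numbers S) E" ..
  fix J and P :: "('j, 'k, 'o \<times> 'o, 'a \<times> 'a) fctr" and c \<kappa>
  assume J: "J \<in> \<A>" and P: "is_functor J (dual_numbers R) P" and c: "is_colimit J (dual_numbers R) P c \<kappa>"
  have *: "fst (fobj E p) = fobj H (fst p)" "snd (fobj E p) = fobj K (snd p)" for p
    using E_obj[of "fst p" "snd p"] by simp_all
  have **: "fst (farr E p) = farr H (fst p)" "snd (farr E p) = farr K (snd p)" for p
    using E_arr[of "fst p" "snd p"] by simp_all
  note col = c[unfolded dual_colimit_iff[OF R.category_axioms]]
  note parts = dual_parts_functor[OF P R.category_axioms]
  have "is_colimit J S (comp_fctr H (first_part P)) (fobj H (fst c)) (\<lambda>j. farr H (fst (\<kappa> j)))"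
    using H_cocontinuous J parts(1) col unfolding cocontinuous_def by blast
  moreover have "is_colimit J S (comp_fctr K (second_part P)) (fobj K (snd c)) (\<lambda>j. farr K (snd (\<kappa> j)))"
    using K_cocontinuous J parts(2) col unfolding cocontinuous_def by blast
  ultimately show "is_colimit J (dual_numbers S) (comp_fctr E P) (fobj E c) (\<lambda>j. farr E (\<kappa> j))"
    unfolding dual_colimit_iff[OF S.category_axioms]
    by (simp add: first_part_def second_part_def comp_fctr_def * **)
qed

lemma E_rig_map: "rig_map \<A> (dual_numbers R) (dual_numbers S) E"
  using E_monoidal E_cocontinuous dual_R dual_S by (simp add: rig_map_def)

end

text \<open>A monoidal transformation of the \<open>H\<close> and a transformation of the \<open>K\<close> that respects the actions
  combine to a monoidal transformation between functors of dual numbers.\<close>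

lemma dual_functor_trans:
  assumes "dual_functor \<A> R S H K l r E" "dual_functor \<A> R S H' K' l' r' E'"
    and \<sigma>: "monoidal_trans R S H H' \<sigma>" and \<kappa>: "nat_trans R S K K' \<kappa>"
    and l: "\<And>a n. a \<in> Obj R \<Longrightarrow> n \<in> Obj R \<Longrightarrow> \<kappa> (a \<otimes>\<^bsub>R\<^esub> n) \<cdot>\<^bsub>S\<^esub> l a n = l' a n \<cdot>\<^bsub>S\<^esub> (\<sigma> a \<odot>\<^bsub>S\<^esub> \<kappa> n)"
    and r: "\<And>m b. m \<in> Obj R \<Longrightarrow> b \<in> Obj R \<Longrightarrow> \<kappa> (m \<otimes>\<^bsub>R\<^esub> b) \<cdot>\<^bsub>S\<^esub> r m b = r' m b \<cdot>\<^bsub>S\<^esub> (\<kappa> m \<odot>\<^bsub>S\<^esub> \<sigma> b)"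
  shows "monoidal_trans (dual_numbers R) (dual_numbers S) E E'
    (\<lambda>(A, M) \<in> Obj (dual_numbers R). (\<sigma> A, \<kappa> M))"
proof -
  interpret E: dual_functor \<A> R S H K l r E by fact
  interpret E': dual_functor \<A> R S H' K' l' r' E' by fact
  note [simp] = E.E_obj E.E_arr E.E_unit E.E_mult E'.E_obj E'.E_arr E'.E_unit E'.E_mult
  have [simp]: "\<sigma> a \<in> Arr S" "Dom S (\<sigma> a) = fobj H a" "Cod S (\<sigma> a) = fobj H' a"
    "\<kappa> a \<in> Arr S" "Dom S (\<kappa> a) = fobj K a" "Cod S (\<kappa> a) = fobj K' a" if "a \<in> Obj R" for a
    using \<sigma> \<kappa> that by (auto simp: monoidal_trans_def nat_trans_def in_hom)
  have \<sigma>u: "\<sigma> \<one>\<^bsub>R\<^esub> \<cdot>\<^bsub>S\<^esub> munit H = munit H'"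
    using \<sigma> by (simp add: monoidal_trans_def)
  have \<sigma>m: "\<sigma> (a \<otimes>\<^bsub>R\<^esub> b) \<cdot>\<^bsub>S\<^esub> mmult H a b = mmult H' a b \<cdot>\<^bsub>S\<^esub> (\<sigma> a \<odot>\<^bsub>S\<^esub> \<sigma> b)" if "a \<in> Obj R" "b \<in> Obj R" for a b
    using \<sigma> that by (simp_all add: monoidal_trans_def)
  have \<sigma>n: "\<sigma> (Cod R f) \<cdot>\<^bsub>S\<^esub> farr H f = farr H' f \<cdot>\<^bsub>S\<^esub> \<sigma> (Dom R f)" if "f \<in> Arr R" for f
    using \<sigma> unfolding monoidal_trans_def by (intro nat_trans_natural[OF _ E.R.category_axioms that]) blast
  have \<kappa>n: "\<kappa> (Cod R f) \<cdot>\<^bsub>S\<^esub> farr K f = farr K' f \<cdot>\<^bsub>S\<^esub> \<kappa> (Dom R f)" if "f \<in> Arr R" for f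
    using nat_trans_natural[OF \<kappa> E.R.category_axioms that] .
  have "\<kappa> (zero R) \<cdot>\<^bsub>S\<^esub> from_initial S (zero S) (fobj K (zero R)) = from_initial S (zero S) (fobj K' (zero R))"
    using E.S.from_initial_simps[OF E.S.zero_initial]
    by (intro E.S.initial_eqI[OF E.S.zero_initial]) simp_all
  moreover have "\<kappa> (plus R (A \<otimes>\<^bsub>R\<^esub> N) (M \<otimes>\<^bsub>R\<^esub> B)) \<cdot>\<^bsub>S\<^esub> E.mult A M B N
      = E'.mult A M B N \<cdot>\<^bsub>S\<^esub> plusA S (\<sigma> A \<odot>\<^bsub>S\<^esub> \<kappa> N) (\<kappa> M \<odot>\<^bsub>S\<^esub> \<sigma> B)"
    if [simp]: "A \<in> Obj R" "M \<in> Obj R" "B \<in> Obj R" "N \<in> Obj R" for A M B N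
  proof -
    let ?i = "inl R (A \<otimes>\<^bsub>R\<^esub> N) (M \<otimes>\<^bsub>R\<^esub> B)" and ?j = "inr R (A \<otimes>\<^bsub>R\<^esub> N) (M \<otimes>\<^bsub>R\<^esub> B)"
    have i: "\<kappa> (plus R (A \<otimes>\<^bsub>R\<^esub> N) (M \<otimes>\<^bsub>R\<^esub> B)) \<cdot>\<^bsub>S\<^esub> farr K ?i = farr K' ?i \<cdot>\<^bsub>S\<^esub> \<kappa> (A \<otimes>\<^bsub>R\<^esub> N)"
      and j: "\<kappa> (plus R (A \<otimes>\<^bsub>R\<^esub> N) (M \<otimes>\<^bsub>R\<^esub> B)) \<cdot>\<^bsub>S\<^esub> farr K ?j = farr K' ?j \<cdot>\<^bsub>S\<^esub> \<kappa> (M \<otimes>\<^bsub>R\<^esub> B)"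
      using \<kappa>n[of ?i] \<kappa>n[of ?j] by simp_all
    show ?thesis
      by (rule E.S.plus_eqI[of _ _ "fobj H A \<otimes>\<^bsub>S\<^esub> fobj K N" "fobj K M \<otimes>\<^bsub>S\<^esub> fobj H B"])
         (simp_all add: E.S.rewrite_prefix[OF i] E.S.rewrite_prefix[OF j] l r)
  qed
  ultimately show ?thesis
    unfolding monoidal_trans_def nat_trans_def
    by (auto simp: \<sigma>u \<sigma>m in_hom \<sigma>n \<kappa>n)
qed

section \<open>The extension of a rig map to dual numbers\<close>

text \<open>The actions of \<open>H\<close> on \<open>K = H - \<otimes> Q\<close> are the multiplication of \<open>H\<close> after the coherence arrow
  that brings \<open>Q\<close> to the right end.  Each law is proved by moving all multiplications of \<open>H\<close> to the left
  of the coherence arrows; what remains is the corresponding axiom of \<open>H\<close>, tensored with \<open>Q\<close>, and one of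
  the coherence laws for \<open>Q\<close>.\<close>

lemma dual_extension_dual_functor:
  assumes "additive_doctrine \<A>" "rig_map \<A> R S H" "rig \<A> (dual_numbers R)" "rig \<A> (dual_numbers S)"
    and Q [simp]: "Q \<in> Obj S"
  shows "dual_functor \<A> R S H (comp_fctr (tensor_right S Q) H)
    (\<lambda>a n. (mmult H a n \<odot>\<^bsub>S\<^esub> Ide S Q) \<cdot>\<^bsub>S\<^esub> inverse_arr S (Assoc S (fobj H a) (fobj H n) Q))
    (\<lambda>m b. (mmult H m b \<odot>\<^bsub>S\<^esub> Ide S Q) \<cdot>\<^bsub>S\<^esub> move S (fobj H m) Q (fobj H b))
    (dual_extension R S H Q)"
proof -
  interpret R: doctrine_rig \<A> R
    using assms by (simp add: doctrine_rig_def rig_map_def)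
  interpret S: doctrine_rig \<A> S
    using assms by (simp add: doctrine_rig_def rig_map_def)
  interpret H: symmetric_monoidal_functor R S H
    using assms by (simp add: rig_map_def)
  let ?K = "comp_fctr (tensor_right S Q) H"
  have H: "cocontinuous \<A> R S H"
    using assms by (simp add: rig_map_def)
  have K: "cocontinuous \<A> R S ?K"
    by (rule comp_cocontinuous[OF H S.tensor_cocontinuous(2)[OF Q]])
  then interpret K: is_functor R S ?K
    by (simp add: cocontinuous_def)
  have [simp]: "fobj ?K a = fobj H a \<otimes>\<^bsub>S\<^esub> Q" "farr ?K f = farr H f \<odot>\<^bsub>S\<^esub> Ide S Q" for a f
    by (simp_all add: comp_fctr_def tensor_right_def)
  have left: "inverse_arr S (Assoc S (Cod S f) (Cod S g) Q) \<cdot>\<^bsub>S\<^esub> (f \<odot>\<^bsub>S\<^esub> (g \<odot>\<^bsub>S\<^esub> Ide S Q))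
      = ((f \<odot>\<^bsub>S\<^esub> g) \<odot>\<^bsub>S\<^esub> Ide S Q) \<cdot>\<^bsub>S\<^esub> inverse_arr S (Assoc S (Dom S f) (Dom S g) Q)"
    if "f \<in> Arr S" "g \<in> Arr S" for f g
    using S.assoc_inverse_natural[of f g "Ide S Q"] that by simp
  have right: "move S (Cod S f) Q (Cod S g) \<cdot>\<^bsub>S\<^esub> ((f \<odot>\<^bsub>S\<^esub> Ide S Q) \<odot>\<^bsub>S\<^esub> g)
      = ((f \<odot>\<^bsub>S\<^esub> g) \<odot>\<^bsub>S\<^esub> Ide S Q) \<cdot>\<^bsub>S\<^esub> move S (Dom S f) Q (Dom S g)"
    if "f \<in> Arr S" "g \<in> Arr S" for f g
    using S.move_natural[of f "Ide S Q" g] that by simp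
  show ?thesis
  proof (unfold_locales, goal_cases)
    case (1 a n)
    then show ?case by (simp add: iso_between_iff in_hom)
  next
    case (2 m b)
    then show ?case by (simp add: iso_between_iff in_hom)
  next
    case (3 f g)
    then show ?case
      using left[of "farr H f" "farr H g"] H.mmult_natural[of f g] by simp
  next
    case (4 f g)
    then show ?case
      using right[of "farr H f" "farr H g"] H.mmult_natural[of f g] by simp
  next
    case (5 a b p)
    note [simp] = 5
    let ?a = "fobj H a" and ?b = "fobj H b" and ?p = "fobj H p" and ?I = "Ide S Q"
    have e1: "inverse_arr S (Assoc S (fobj H (a \<otimes>\<^bsub>R\<^esub> b)) ?p Q) \<cdot>\<^bsub>S\<^esub> (mmult H a b \<odot>\<^bsub>S\<^esub> Ide S (?p \<otimes>\<^bsub>S\<^esub> Q))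
      = ((mmult H a b \<odot>\<^bsub>S\<^esub> Ide S ?p) \<odot>\<^bsub>S\<^esub> ?I) \<cdot>\<^bsub>S\<^esub> inverse_arr S (Assoc S (?a \<otimes>\<^bsub>S\<^esub> ?b) ?p Q)"
      using left[of "mmult H a b" "Ide S ?p"] by simp
    have e2: "((Ide S ?a \<odot>\<^bsub>S\<^esub> mmult H b p) \<odot>\<^bsub>S\<^esub> ?I) \<cdot>\<^bsub>S\<^esub> inverse_arr S (Assoc S ?a (?b \<otimes>\<^bsub>S\<^esub> ?p) Q)
      = inverse_arr S (Assoc S ?a (fobj H (b \<otimes>\<^bsub>R\<^esub> p)) Q) \<cdot>\<^bsub>S\<^esub> (Ide S ?a \<odot>\<^bsub>S\<^esub> (mmult H b p \<odot>\<^bsub>S\<^esub> ?I))"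
      using left[of "Ide S ?a" "mmult H b p"] by simp
    have "(farr H (Assoc R a b p) \<odot>\<^bsub>S\<^esub> ?I) \<cdot>\<^bsub>S\<^esub> ((mmult H (a \<otimes>\<^bsub>R\<^esub> b) p \<odot>\<^bsub>S\<^esub> ?I) \<cdot>\<^bsub>S\<^esub>
        inverse_arr S (Assoc S (fobj H (a \<otimes>\<^bsub>R\<^esub> b)) ?p Q)) \<cdot>\<^bsub>S\<^esub> (mmult H a b \<odot>\<^bsub>S\<^esub> Ide S (?p \<otimes>\<^bsub>S\<^esub> Q))
      = ((farr H (Assoc R a b p) \<cdot>\<^bsub>S\<^esub> mmult H (a \<otimes>\<^bsub>R\<^esub> b) p \<cdot>\<^bsub>S\<^esub> (mmult H a b \<odot>\<^bsub>S\<^esub> Ide S ?p)) \<odot>\<^bsub>S\<^esub> ?I) \<cdot>\<^bsub>S\<^esub>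
        inverse_arr S (Assoc S (?a \<otimes>\<^bsub>S\<^esub> ?b) ?p Q)"
      by (simp add: e1)
    also have "\<dots> = (mmult H a (b \<otimes>\<^bsub>R\<^esub> p) \<odot>\<^bsub>S\<^esub> ?I) \<cdot>\<^bsub>S\<^esub> ((Ide S ?a \<odot>\<^bsub>S\<^esub> mmult H b p) \<odot>\<^bsub>S\<^esub> ?I) \<cdot>\<^bsub>S\<^esub>
        ((Assoc S ?a ?b ?p \<odot>\<^bsub>S\<^esub> ?I) \<cdot>\<^bsub>S\<^esub> inverse_arr S (Assoc S (?a \<otimes>\<^bsub>S\<^esub> ?b) ?p Q))"
      unfolding H.mmult_assoc[OF 5] by simp
    also have "\<dots> = (mmult H a (b \<otimes>\<^bsub>R\<^esub> p) \<odot>\<^bsub>S\<^esub> ?I) \<cdot>\<^bsub>S\<^esub> (((Ide S ?a \<odot>\<^bsub>S\<^esub> mmult H b p) \<odot>\<^bsub>S\<^esub> ?I) \<cdot>\<^bsub>S\<^esub>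
        inverse_arr S (Assoc S ?a (?b \<otimes>\<^bsub>S\<^esub> ?p) Q)) \<cdot>\<^bsub>S\<^esub> (Ide S ?a \<odot>\<^bsub>S\<^esub> inverse_arr S (Assoc S ?b ?p Q)) \<cdot>\<^bsub>S\<^esub>
        Assoc S ?a ?b (?p \<otimes>\<^bsub>S\<^esub> Q)"
      unfolding S.assoc_inverse_assoc[OF H.fobj_obj[OF 5(1)] H.fobj_obj[OF 5(2)] H.fobj_obj[OF 5(3)] Q]
      by (simp del: S.interchange S.interchange_prefix)
    finally show ?case
      unfolding e2 by simp
  next
    case (6 a n c)
    note [simp] = 6
    let ?a = "fobj H a" and ?n = "fobj H n" and ?c = "fobj H c" and ?I = "Ide S Q"
    have e1: "move S (fobj H (a \<otimes>\<^bsub>R\<^esub> n)) Q ?c \<cdot>\<^bsub>S\<^esub> ((mmult H a n \<odot>\<^bsub>S\<^esub> ?I) \<odot>\<^bsub>S\<^esub> Ide S ?c)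
      = ((mmult H a n \<odot>\<^bsub>S\<^esub> Ide S ?c) \<odot>\<^bsub>S\<^esub> ?I) \<cdot>\<^bsub>S\<^esub> move S (?a \<otimes>\<^bsub>S\<^esub> ?n) Q ?c"
      using right[of "mmult H a n" "Ide S ?c"] by simp
    have e2: "((Ide S ?a \<odot>\<^bsub>S\<^esub> mmult H n c) \<odot>\<^bsub>S\<^esub> ?I) \<cdot>\<^bsub>S\<^esub> inverse_arr S (Assoc S ?a (?n \<otimes>\<^bsub>S\<^esub> ?c) Q)
      = inverse_arr S (Assoc S ?a (fobj H (n \<otimes>\<^bsub>R\<^esub> c)) Q) \<cdot>\<^bsub>S\<^esub> (Ide S ?a \<odot>\<^bsub>S\<^esub> (mmult H n c \<odot>\<^bsub>S\<^esub> ?I))"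
      using left[of "Ide S ?a" "mmult H n c"] by simp
    let ?A = "inverse_arr S (Assoc S ?a ?n Q)"
    have "(farr H (Assoc R a n c) \<odot>\<^bsub>S\<^esub> ?I) \<cdot>\<^bsub>S\<^esub> ((mmult H (a \<otimes>\<^bsub>R\<^esub> n) c \<odot>\<^bsub>S\<^esub> ?I) \<cdot>\<^bsub>S\<^esub>
        move S (fobj H (a \<otimes>\<^bsub>R\<^esub> n)) Q ?c) \<cdot>\<^bsub>S\<^esub> (((mmult H a n \<odot>\<^bsub>S\<^esub> ?I) \<cdot>\<^bsub>S\<^esub> ?A) \<odot>\<^bsub>S\<^esub> Ide S ?c)
      = (farr H (Assoc R a n c) \<odot>\<^bsub>S\<^esub> ?I) \<cdot>\<^bsub>S\<^esub> (mmult H (a \<otimes>\<^bsub>R\<^esub> n) c \<odot>\<^bsub>S\<^esub> ?I) \<cdot>\<^bsub>S\<^esub>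
        (move S (fobj H (a \<otimes>\<^bsub>R\<^esub> n)) Q ?c \<cdot>\<^bsub>S\<^esub> ((mmult H a n \<odot>\<^bsub>S\<^esub> ?I) \<odot>\<^bsub>S\<^esub> Ide S ?c)) \<cdot>\<^bsub>S\<^esub> (?A \<odot>\<^bsub>S\<^esub> Ide S ?c)"
      by simp
    also have "\<dots> = ((farr H (Assoc R a n c) \<cdot>\<^bsub>S\<^esub> mmult H (a \<otimes>\<^bsub>R\<^esub> n) c \<cdot>\<^bsub>S\<^esub> (mmult H a n \<odot>\<^bsub>S\<^esub> Ide S ?c)) \<odot>\<^bsub>S\<^esub> ?I) \<cdot>\<^bsub>S\<^esub>
        move S (?a \<otimes>\<^bsub>S\<^esub> ?n) Q ?c \<cdot>\<^bsub>S\<^esub> (?A \<odot>\<^bsub>S\<^esub> Ide S ?c)"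
      unfolding e1 by simp
    also have "\<dots> = (mmult H a (n \<otimes>\<^bsub>R\<^esub> c) \<odot>\<^bsub>S\<^esub> ?I) \<cdot>\<^bsub>S\<^esub> ((Ide S ?a \<odot>\<^bsub>S\<^esub> mmult H n c) \<odot>\<^bsub>S\<^esub> ?I) \<cdot>\<^bsub>S\<^esub>
        ((Assoc S ?a ?n ?c \<odot>\<^bsub>S\<^esub> ?I) \<cdot>\<^bsub>S\<^esub> move S (?a \<otimes>\<^bsub>S\<^esub> ?n) Q ?c \<cdot>\<^bsub>S\<^esub> (?A \<odot>\<^bsub>S\<^esub> Ide S ?c))"
      unfolding H.mmult_assoc[OF 6] by simp
    also have "\<dots> = (mmult H a (n \<otimes>\<^bsub>R\<^esub> c) \<odot>\<^bsub>S\<^esub> ?I) \<cdot>\<^bsub>S\<^esub> (((Ide S ?a \<odot>\<^bsub>S\<^esub> mmult H n c) \<odot>\<^bsub>S\<^esub> ?I) \<cdot>\<^bsub>S\<^esub>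
        inverse_arr S (Assoc S ?a (?n \<otimes>\<^bsub>S\<^esub> ?c) Q)) \<cdot>\<^bsub>S\<^esub> (Ide S ?a \<odot>\<^bsub>S\<^esub> move S ?n Q ?c) \<cdot>\<^bsub>S\<^esub>
        Assoc S ?a (?n \<otimes>\<^bsub>S\<^esub> Q) ?c"
      unfolding S.assoc_move_inverse[OF H.fobj_obj[OF 6(1)] H.fobj_obj[OF 6(2)] H.fobj_obj[OF 6(3)] Q]
      by (simp del: S.interchange S.interchange_prefix)
    finally show ?case
      unfolding e2 by simp
  next
    case (7 m b c)
    note [simp] = 7
    let ?m = "fobj H m" and ?b = "fobj H b" and ?c = "fobj H c" and ?I = "Ide S Q"
    have e1: "move S (fobj H (m \<otimes>\<^bsub>R\<^esub> b)) Q ?c \<cdot>\<^bsub>S\<^esub> ((mmult H m b \<odot>\<^bsub>S\<^esub> ?I) \<odot>\<^bsub>S\<^esub> Ide S ?c)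
      = ((mmult H m b \<odot>\<^bsub>S\<^esub> Ide S ?c) \<odot>\<^bsub>S\<^esub> ?I) \<cdot>\<^bsub>S\<^esub> move S (?m \<otimes>\<^bsub>S\<^esub> ?b) Q ?c"
      using right[of "mmult H m b" "Ide S ?c"] by simp
    have e2: "((Ide S ?m \<odot>\<^bsub>S\<^esub> mmult H b c) \<odot>\<^bsub>S\<^esub> ?I) \<cdot>\<^bsub>S\<^esub> move S ?m Q (?b \<otimes>\<^bsub>S\<^esub> ?c)
      = move S ?m Q (fobj H (b \<otimes>\<^bsub>R\<^esub> c)) \<cdot>\<^bsub>S\<^esub> (Ide S (?m \<otimes>\<^bsub>S\<^esub> Q) \<odot>\<^bsub>S\<^esub> mmult H b c)"
      using right[of "Ide S ?m" "mmult H b c"] by simp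
    let ?A = "move S ?m Q ?b"
    have "(farr H (Assoc R m b c) \<odot>\<^bsub>S\<^esub> ?I) \<cdot>\<^bsub>S\<^esub> ((mmult H (m \<otimes>\<^bsub>R\<^esub> b) c \<odot>\<^bsub>S\<^esub> ?I) \<cdot>\<^bsub>S\<^esub>
        move S (fobj H (m \<otimes>\<^bsub>R\<^esub> b)) Q ?c) \<cdot>\<^bsub>S\<^esub> (((mmult H m b \<odot>\<^bsub>S\<^esub> ?I) \<cdot>\<^bsub>S\<^esub> ?A) \<odot>\<^bsub>S\<^esub> Ide S ?c)
      = (farr H (Assoc R m b c) \<odot>\<^bsub>S\<^esub> ?I) \<cdot>\<^bsub>S\<^esub> (mmult H (m \<otimes>\<^bsub>R\<^esub> b) c \<odot>\<^bsub>S\<^esub> ?I) \<cdot>\<^bsub>S\<^esub>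
        (move S (fobj H (m \<otimes>\<^bsub>R\<^esub> b)) Q ?c \<cdot>\<^bsub>S\<^esub> ((mmult H m b \<odot>\<^bsub>S\<^esub> ?I) \<odot>\<^bsub>S\<^esub> Ide S ?c)) \<cdot>\<^bsub>S\<^esub> (?A \<odot>\<^bsub>S\<^esub> Ide S ?c)"
      by simp
    also have "\<dots> = ((farr H (Assoc R m b c) \<cdot>\<^bsub>S\<^esub> mmult H (m \<otimes>\<^bsub>R\<^esub> b) c \<cdot>\<^bsub>S\<^esub> (mmult H m b \<odot>\<^bsub>S\<^esub> Ide S ?c)) \<odot>\<^bsub>S\<^esub> ?I) \<cdot>\<^bsub>S\<^esub>
        move S (?m \<otimes>\<^bsub>S\<^esub> ?b) Q ?c \<cdot>\<^bsub>S\<^esub> (?A \<odot>\<^bsub>S\<^esub> Ide S ?c)"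
      unfolding e1 by simp
    also have "\<dots> = (mmult H m (b \<otimes>\<^bsub>R\<^esub> c) \<odot>\<^bsub>S\<^esub> ?I) \<cdot>\<^bsub>S\<^esub> ((Ide S ?m \<odot>\<^bsub>S\<^esub> mmult H b c) \<odot>\<^bsub>S\<^esub> ?I) \<cdot>\<^bsub>S\<^esub>
        ((Assoc S ?m ?b ?c \<odot>\<^bsub>S\<^esub> ?I) \<cdot>\<^bsub>S\<^esub> move S (?m \<otimes>\<^bsub>S\<^esub> ?b) Q ?c \<cdot>\<^bsub>S\<^esub> (?A \<odot>\<^bsub>S\<^esub> Ide S ?c))"
      unfolding H.mmult_assoc[OF 7] by simp
    also have "\<dots> = (mmult H m (b \<otimes>\<^bsub>R\<^esub> c) \<odot>\<^bsub>S\<^esub> ?I) \<cdot>\<^bsub>S\<^esub> (((Ide S ?m \<odot>\<^bsub>S\<^esub> mmult H b c) \<odot>\<^bsub>S\<^esub> ?I) \<cdot>\<^bsub>S\<^esub>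
        move S ?m Q (?b \<otimes>\<^bsub>S\<^esub> ?c)) \<cdot>\<^bsub>S\<^esub> Assoc S (?m \<otimes>\<^bsub>S\<^esub> Q) ?b ?c"
      unfolding S.assoc_move_move[OF H.fobj_obj[OF 7(1)] H.fobj_obj[OF 7(2)] H.fobj_obj[OF 7(3)] Q]
      by (simp del: S.interchange S.interchange_prefix)
    finally show ?case
      unfolding e2 by simp
  next
    case (8 m)
    note [simp] = 8
    have e: "inverse_arr S (Assoc S (fobj H \<one>\<^bsub>R\<^esub>) (fobj H m) Q) \<cdot>\<^bsub>S\<^esub> (munit H \<odot>\<^bsub>S\<^esub> Ide S (fobj H m \<otimes>\<^bsub>S\<^esub> Q))
      = ((munit H \<odot>\<^bsub>S\<^esub> Ide S (fobj H m)) \<odot>\<^bsub>S\<^esub> Ide S Q) \<cdot>\<^bsub>S\<^esub> inverse_arr S (Assoc S \<one>\<^bsub>S\<^esub> (fobj H m) Q)"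
      using left[of "munit H" "Ide S (fobj H m)"] by simp
    show ?case
      by (simp add: e H.mmult_lun S.lun_assoc_inverse)
  next
    case (9 m)
    note [simp] = 9
    have e: "move S (fobj H m) Q (fobj H \<one>\<^bsub>R\<^esub>) \<cdot>\<^bsub>S\<^esub> (Ide S (fobj H m \<otimes>\<^bsub>S\<^esub> Q) \<odot>\<^bsub>S\<^esub> munit H)
      = ((Ide S (fobj H m) \<odot>\<^bsub>S\<^esub> munit H) \<odot>\<^bsub>S\<^esub> Ide S Q) \<cdot>\<^bsub>S\<^esub> move S (fobj H m) Q \<one>\<^bsub>S\<^esub>"
      using right[of "Ide S (fobj H m)" "munit H"] by simp
    show ?case
      by (simp add: e H.mmult_run S.run_move)
  next
    case (10 a n)
    note [simp] = 10
    have "((mmult H n a \<cdot>\<^bsub>S\<^esub> Swap S (fobj H a) (fobj H n)) \<odot>\<^bsub>S\<^esub> Ide S Q) \<cdot>\<^bsub>S\<^esub> inverse_arr S (Assoc S (fobj H a) (fobj H n) Q)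
      = (mmult H n a \<odot>\<^bsub>S\<^esub> Ide S Q) \<cdot>\<^bsub>S\<^esub> ((Swap S (fobj H a) (fobj H n) \<odot>\<^bsub>S\<^esub> Ide S Q) \<cdot>\<^bsub>S\<^esub> inverse_arr S (Assoc S (fobj H a) (fobj H n) Q))"
      by simp
    then show ?case
      by (simp add: H.mmult_swap S.swap_assoc_inverse)
  next
    case (18 A M B N)
    then show ?case
      by (simp add: dual_extension_def move_def)
  qed (use assms H K in \<open>simp_all add: dual_extension_def\<close>)
qed

text \<open>Functoriality of \<open>dual_extension\<close> in both \<open>H\<close> and \<open>Q\<close>; it is the source of the naturality of the
  chain rule in the inner argument.\<close>

lemma dual_extension_trans:
  assumes "additive_doctrine \<A>" "rig_map \<A> R S H" "rig_map \<A> R S H'"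
    and "rig \<A> (dual_numbers R)" "rig \<A> (dual_numbers S)"
    and \<sigma>: "monoidal_trans R S H H' \<sigma>" and q: "q \<in> hom S Q Q'"
  shows "monoidal_trans (dual_numbers R) (dual_numbers S) (dual_extension R S H Q) (dual_extension R S H' Q')
    (\<lambda>(A, M) \<in> Obj (dual_numbers R). (\<sigma> A, \<sigma> M \<odot>\<^bsub>S\<^esub> q))"
proof -
  interpret H: symmetric_monoidal_functor R S H
    using assms by (simp add: rig_map_def)
  interpret H': symmetric_monoidal_functor R S H'
    using assms by (simp add: rig_map_def)
  have q' [simp]: "q \<in> Arr S" "Dom S q = Q" "Cod S q = Q'" "Q \<in> Obj S" "Q' \<in> Obj S"
    using q by (auto simp: in_hom)
  have \<sigma>' [simp]: "\<sigma> a \<in> Arr S" "Dom S (\<sigma> a) = fobj H a" "Cod S (\<sigma> a) = fobj H' a" if "a \<in> Obj R" for a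
    using \<sigma> that by (auto simp: monoidal_trans_def nat_trans_def in_hom)
  have \<sigma>m: "\<sigma> (a \<otimes>\<^bsub>R\<^esub> b) \<cdot>\<^bsub>S\<^esub> mmult H a b = mmult H' a b \<cdot>\<^bsub>S\<^esub> (\<sigma> a \<odot>\<^bsub>S\<^esub> \<sigma> b)" if "a \<in> Obj R" "b \<in> Obj R" for a b
    using \<sigma> that by (simp add: monoidal_trans_def)
  have \<sigma>n: "\<sigma> b \<cdot>\<^bsub>S\<^esub> farr H f = farr H' f \<cdot>\<^bsub>S\<^esub> \<sigma> a" if "f \<in> hom R a b" for a b f
    using nat_trans_natural[of R S H H' \<sigma> f] \<sigma> that H.C.category_axioms by (simp add: monoidal_trans_def in_hom)
  have "monoidal_trans (dual_numbers R) (dual_numbers S) (dual_extension R S H Q) (dual_extension R S H' Q')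
    (\<lambda>(A, M) \<in> Obj (dual_numbers R). (\<sigma> A, restrict (\<lambda>M. \<sigma> M \<odot>\<^bsub>S\<^esub> q) (Obj R) M))"
  proof (rule dual_functor_trans[OF dual_extension_dual_functor[OF assms(1,2,4,5)]
        dual_extension_dual_functor[OF assms(1,3,4,5)] \<sigma>])
    show "nat_trans R S (comp_fctr (tensor_right S Q) H) (comp_fctr (tensor_right S Q') H')
        (restrict (\<lambda>M. \<sigma> M \<odot>\<^bsub>S\<^esub> q) (Obj R))"
      unfolding nat_trans_def by (auto simp: comp_fctr_def tensor_right_def in_hom \<sigma>n)
  next
    fix a n assume [simp]: "a \<in> Obj R" "n \<in> Obj R"
    have e: "inverse_arr S (Assoc S (fobj H' a) (fobj H' n) Q') \<cdot>\<^bsub>S\<^esub> (\<sigma> a \<odot>\<^bsub>S\<^esub> (\<sigma> n \<odot>\<^bsub>S\<^esub> q))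
      = ((\<sigma> a \<odot>\<^bsub>S\<^esub> \<sigma> n) \<odot>\<^bsub>S\<^esub> q) \<cdot>\<^bsub>S\<^esub> inverse_arr S (Assoc S (fobj H a) (fobj H n) Q)"
      using H.D.assoc_inverse_natural[of "\<sigma> a" "\<sigma> n" q] by simp
    show "restrict (\<lambda>M. \<sigma> M \<odot>\<^bsub>S\<^esub> q) (Obj R) (a \<otimes>\<^bsub>R\<^esub> n) \<cdot>\<^bsub>S\<^esub> (mmult H a n \<odot>\<^bsub>S\<^esub> Ide S Q) \<cdot>\<^bsub>S\<^esub>
        inverse_arr S (Assoc S (fobj H a) (fobj H n) Q)
      = ((mmult H' a n \<odot>\<^bsub>S\<^esub> Ide S Q') \<cdot>\<^bsub>S\<^esub> inverse_arr S (Assoc S (fobj H' a) (fobj H' n) Q')) \<cdot>\<^bsub>S\<^esub>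
        (\<sigma> a \<odot>\<^bsub>S\<^esub> restrict (\<lambda>M. \<sigma> M \<odot>\<^bsub>S\<^esub> q) (Obj R) n)"
      by (simp add: e \<sigma>m)
  next
    fix m b assume [simp]: "m \<in> Obj R" "b \<in> Obj R"
    have e: "move S (fobj H' m) Q' (fobj H' b) \<cdot>\<^bsub>S\<^esub> ((\<sigma> m \<odot>\<^bsub>S\<^esub> q) \<odot>\<^bsub>S\<^esub> \<sigma> b)
      = ((\<sigma> m \<odot>\<^bsub>S\<^esub> \<sigma> b) \<odot>\<^bsub>S\<^esub> q) \<cdot>\<^bsub>S\<^esub> move S (fobj H m) Q (fobj H b)"
      using H.D.move_natural[of "\<sigma> m" q "\<sigma> b"] by simp
    show "restrict (\<lambda>M. \<sigma> M \<odot>\<^bsub>S\<^esub> q) (Obj R) (m \<otimes>\<^bsub>R\<^esub> b) \<cdot>\<^bsub>S\<^esub> (mmult H m b \<odot>\<^bsub>S\<^esub> Ide S Q) \<cdot>\<^bsub>S\<^esub>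
        move S (fobj H m) Q (fobj H b)
      = ((mmult H' m b \<odot>\<^bsub>S\<^esub> Ide S Q') \<cdot>\<^bsub>S\<^esub> move S (fobj H' m) Q' (fobj H' b)) \<cdot>\<^bsub>S\<^esub>
        (restrict (\<lambda>M. \<sigma> M \<odot>\<^bsub>S\<^esub> q) (Obj R) m \<odot>\<^bsub>S\<^esub> \<sigma> b)"
      by (simp add: e \<sigma>m)
  qed simp_all
  moreover have "(\<lambda>(A, M) \<in> Obj (dual_numbers R). (\<sigma> A, restrict (\<lambda>M. \<sigma> M \<odot>\<^bsub>S\<^esub> q) (Obj R) M))
    = (\<lambda>(A, M) \<in> Obj (dual_numbers R). (\<sigma> A, \<sigma> M \<odot>\<^bsub>S\<^esub> q))"
    by (rule restrict_ext) auto
  ultimately show ?thesis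
    by (simp only:)
qed

section \<open>The calculus of monoidal transformations\<close>

lemma monoidal_trans_component:
  assumes "monoidal_trans R S H K \<alpha>" "a \<in> Obj R"
  shows "\<alpha> a \<in> Arr S" "Dom S (\<alpha> a) = fobj H a" "Cod S (\<alpha> a) = fobj K a"
  using assms by (auto simp: monoidal_trans_def nat_trans_def in_hom)

lemma monoidal_trans_natural:
  assumes "monoidal_trans R S H K \<alpha>" "category R" "f \<in> Arr R"
  shows "\<alpha> (Cod R f) \<cdot>\<^bsub>S\<^esub> farr H f = farr K f \<cdot>\<^bsub>S\<^esub> \<alpha> (Dom R f)"
  using assms(1) unfolding monoidal_trans_def by (intro nat_trans_natural[OF _ assms(2,3)]) blast

lemma monoidal_trans_coherent:
  assumes "monoidal_trans R S H K \<alpha>"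
  shows "\<alpha> \<one>\<^bsub>R\<^esub> \<cdot>\<^bsub>S\<^esub> munit H = munit K"
    and "a \<in> Obj R \<Longrightarrow> b \<in> Obj R \<Longrightarrow> \<alpha> (a \<otimes>\<^bsub>R\<^esub> b) \<cdot>\<^bsub>S\<^esub> mmult H a b = mmult K a b \<cdot>\<^bsub>S\<^esub> (\<alpha> a \<odot>\<^bsub>S\<^esub> \<alpha> b)"
  using assms by (auto simp: monoidal_trans_def)

lemma monoidal_transI:
  assumes "\<alpha> \<in> extensional (Obj R)"
    and "\<And>a. a \<in> Obj R \<Longrightarrow> \<alpha> a \<in> hom S (fobj H a) (fobj K a)"
    and "\<And>a b f. a \<in> Obj R \<Longrightarrow> b \<in> Obj R \<Longrightarrow> f \<in> hom R a b \<Longrightarrow> \<alpha> b \<cdot>\<^bsub>S\<^esub> farr H f = farr K f \<cdot>\<^bsub>S\<^esub> \<alpha> a"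
    and "\<alpha> \<one>\<^bsub>R\<^esub> \<cdot>\<^bsub>S\<^esub> munit H = munit K"
    and "\<And>a b. a \<in> Obj R \<Longrightarrow> b \<in> Obj R \<Longrightarrow> \<alpha> (a \<otimes>\<^bsub>R\<^esub> b) \<cdot>\<^bsub>S\<^esub> mmult H a b = mmult K a b \<cdot>\<^bsub>S\<^esub> (\<alpha> a \<odot>\<^bsub>S\<^esub> \<alpha> b)"
  shows "monoidal_trans R S H K \<alpha>"
  using assms by (simp add: monoidal_trans_def nat_trans_def)

lemma vertical_comp:
  assumes H: "symmetric_monoidal_functor R S H" and K: "symmetric_monoidal_functor R S K"
    and L: "symmetric_monoidal_functor R S L"
    and \<alpha>: "monoidal_trans R S H K \<alpha>" and \<beta>: "monoidal_trans R S K L \<beta>"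
  shows "monoidal_trans R S H L (\<lambda>a\<in>Obj R. \<beta> a \<cdot>\<^bsub>S\<^esub> \<alpha> a)"
proof -
  interpret H: symmetric_monoidal_functor R S H by fact
  interpret K: symmetric_monoidal_functor R S K by fact
  interpret L: symmetric_monoidal_functor R S L by fact
  note [simp] = monoidal_trans_component[OF \<alpha>] monoidal_trans_component[OF \<beta>]
  note \<alpha>' = monoidal_trans_coherent[OF \<alpha>] and \<beta>' = monoidal_trans_coherent[OF \<beta>]
  show ?thesis
  proof (rule monoidal_transI)
    fix a b f assume "a \<in> Obj R" "b \<in> Obj R" "f \<in> hom R a b"
    then have f [simp]: "a \<in> Obj R" "b \<in> Obj R" "f \<in> Arr R" "Dom R f = a" "Cod R f = b"
      by (simp_all add: in_hom)
    have n1: "\<alpha> b \<cdot>\<^bsub>S\<^esub> farr H f = farr K f \<cdot>\<^bsub>S\<^esub> \<alpha> a" and n2: "\<beta> b \<cdot>\<^bsub>S\<^esub> farr K f = farr L f \<cdot>\<^bsub>S\<^esub> \<beta> a"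
      using monoidal_trans_natural[OF \<alpha>, of f] monoidal_trans_natural[OF \<beta>, of f] H.C.category_axioms by simp_all
    show "(\<lambda>a\<in>Obj R. \<beta> a \<cdot>\<^bsub>S\<^esub> \<alpha> a) b \<cdot>\<^bsub>S\<^esub> farr H f = farr L f \<cdot>\<^bsub>S\<^esub> (\<lambda>a\<in>Obj R. \<beta> a \<cdot>\<^bsub>S\<^esub> \<alpha> a) a"
      by (simp add: n1 H.D.rewrite_prefix[OF n2])
  next
    fix a b assume [simp]: "a \<in> Obj R" "b \<in> Obj R"
    show "(\<lambda>a\<in>Obj R. \<beta> a \<cdot>\<^bsub>S\<^esub> \<alpha> a) (a \<otimes>\<^bsub>R\<^esub> b) \<cdot>\<^bsub>S\<^esub> mmult H a b =
      mmult L a b \<cdot>\<^bsub>S\<^esub> ((\<lambda>a\<in>Obj R. \<beta> a \<cdot>\<^bsub>S\<^esub> \<alpha> a) a \<odot>\<^bsub>S\<^esub> (\<lambda>a\<in>Obj R. \<beta> a \<cdot>\<^bsub>S\<^esub> \<alpha> a) b)"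
      by (simp add: \<alpha>' H.D.rewrite_prefix[OF \<beta>'(2)])
  qed (simp_all add: in_hom \<alpha>' \<beta>')
qed

lemma whisker_left:
  assumes H: "symmetric_monoidal_functor R S H" and H': "symmetric_monoidal_functor R S H'"
    and K: "symmetric_monoidal_functor S U K" and \<alpha>: "monoidal_trans R S H H' \<alpha>"
  shows "monoidal_trans R U (comp_mfctr U K H) (comp_mfctr U K H') (\<lambda>a\<in>Obj R. farr K (\<alpha> a))"
proof -
  interpret H: symmetric_monoidal_functor R S H by fact
  interpret H': symmetric_monoidal_functor R S H' by fact
  interpret K: symmetric_monoidal_functor S U K by fact
  note [simp] = monoidal_trans_component[OF \<alpha>]
  note \<alpha>' = monoidal_trans_coherent[OF \<alpha>]
  show ?thesis
  proof (rule monoidal_transI)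
    fix a b f assume "a \<in> Obj R" "b \<in> Obj R" "f \<in> hom R a b"
    then have f [simp]: "a \<in> Obj R" "b \<in> Obj R" "f \<in> Arr R" "Dom R f = a" "Cod R f = b"
      by (simp_all add: in_hom)
    have n: "\<alpha> b \<cdot>\<^bsub>S\<^esub> farr H f = farr H' f \<cdot>\<^bsub>S\<^esub> \<alpha> a"
      using monoidal_trans_natural[OF \<alpha>, of f] H.C.category_axioms by simp
    show "(\<lambda>a\<in>Obj R. farr K (\<alpha> a)) b \<cdot>\<^bsub>U\<^esub> farr (comp_mfctr U K H) f = farr (comp_mfctr U K H') f \<cdot>\<^bsub>U\<^esub> (\<lambda>a\<in>Obj R. farr K (\<alpha> a)) a"
      by (simp add: comp_mfctr_def K.farr_rewrite(1)[OF n])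
  next
    show "(\<lambda>a\<in>Obj R. farr K (\<alpha> a)) \<one>\<^bsub>R\<^esub> \<cdot>\<^bsub>U\<^esub> munit (comp_mfctr U K H) = munit (comp_mfctr U K H')"
      by (simp add: comp_mfctr_def K.farr_rewrite(2)[OF \<alpha>'(1)])
  next
    fix a b assume [simp]: "a \<in> Obj R" "b \<in> Obj R"
    have n: "mmult K (fobj H' a) (fobj H' b) \<cdot>\<^bsub>U\<^esub> (farr K (\<alpha> a) \<odot>\<^bsub>U\<^esub> farr K (\<alpha> b)) =
      farr K (\<alpha> a \<odot>\<^bsub>S\<^esub> \<alpha> b) \<cdot>\<^bsub>U\<^esub> mmult K (fobj H a) (fobj H b)"
      using K.mmult_natural[of "\<alpha> a" "\<alpha> b"] by simp
    show "(\<lambda>a\<in>Obj R. farr K (\<alpha> a)) (a \<otimes>\<^bsub>R\<^esub> b) \<cdot>\<^bsub>U\<^esub> mmult (comp_mfctr U K H) a b =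
      mmult (comp_mfctr U K H') a b \<cdot>\<^bsub>U\<^esub> ((\<lambda>a\<in>Obj R. farr K (\<alpha> a)) a \<odot>\<^bsub>U\<^esub> (\<lambda>a\<in>Obj R. farr K (\<alpha> a)) b)"
      by (simp add: comp_mfctr_def n K.farr_rewrite(2)[OF \<alpha>'(2)])
  qed (simp_all add: comp_mfctr_def in_hom)
qed

lemma whisker_right:
  assumes H: "symmetric_monoidal_functor R S H" and K: "symmetric_monoidal_functor S U K"
    and K': "symmetric_monoidal_functor S U K'" and \<beta>: "monoidal_trans S U K K' \<beta>"
  shows "monoidal_trans R U (comp_mfctr U K H) (comp_mfctr U K' H) (\<lambda>a\<in>Obj R. \<beta> (fobj H a))"
proof -
  interpret H: symmetric_monoidal_functor R S H by fact
  interpret K: symmetric_monoidal_functor S U K by fact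
  interpret K': symmetric_monoidal_functor S U K' by fact
  note [simp] = monoidal_trans_component[OF \<beta>]
  note \<beta>' = monoidal_trans_coherent[OF \<beta>]
  have n: "\<beta> (Cod S f) \<cdot>\<^bsub>U\<^esub> farr K f = farr K' f \<cdot>\<^bsub>U\<^esub> \<beta> (Dom S f)" if "f \<in> Arr S" for f
    using monoidal_trans_natural[OF \<beta> H.D.category_axioms that] .
  show ?thesis
  proof (rule monoidal_transI)
    fix a b f assume "a \<in> Obj R" "b \<in> Obj R" "f \<in> hom R a b"
    then have f [simp]: "a \<in> Obj R" "b \<in> Obj R" "f \<in> Arr R" "Dom R f = a" "Cod R f = b"
      by (simp_all add: in_hom)
    show "(\<lambda>a\<in>Obj R. \<beta> (fobj H a)) b \<cdot>\<^bsub>U\<^esub> farr (comp_mfctr U K H) f = farr (comp_mfctr U K' H) f \<cdot>\<^bsub>U\<^esub> (\<lambda>a\<in>Obj R. \<beta> (fobj H a)) a"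
      using n[of "farr H f"] by (simp add: comp_mfctr_def)
  next
    have e: "\<beta> (fobj H \<one>\<^bsub>R\<^esub>) \<cdot>\<^bsub>U\<^esub> farr K (munit H) = farr K' (munit H) \<cdot>\<^bsub>U\<^esub> \<beta> \<one>\<^bsub>S\<^esub>"
      using n[of "munit H"] by simp
    show "(\<lambda>a\<in>Obj R. \<beta> (fobj H a)) \<one>\<^bsub>R\<^esub> \<cdot>\<^bsub>U\<^esub> munit (comp_mfctr U K H) = munit (comp_mfctr U K' H)"
      by (simp add: comp_mfctr_def K.D.rewrite_prefix[OF e] \<beta>')
  next
    fix a b assume [simp]: "a \<in> Obj R" "b \<in> Obj R"
    have e: "\<beta> (fobj H (a \<otimes>\<^bsub>R\<^esub> b)) \<cdot>\<^bsub>U\<^esub> farr K (mmult H a b) = farr K' (mmult H a b) \<cdot>\<^bsub>U\<^esub> \<beta> (fobj H a \<otimes>\<^bsub>S\<^esub> fobj H b)"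
      using n[of "mmult H a b"] by simp
    show "(\<lambda>a\<in>Obj R. \<beta> (fobj H a)) (a \<otimes>\<^bsub>R\<^esub> b) \<cdot>\<^bsub>U\<^esub> mmult (comp_mfctr U K H) a b =
      mmult (comp_mfctr U K' H) a b \<cdot>\<^bsub>U\<^esub> ((\<lambda>a\<in>Obj R. \<beta> (fobj H a)) a \<odot>\<^bsub>U\<^esub> (\<lambda>a\<in>Obj R. \<beta> (fobj H a)) b)"
      by (simp add: comp_mfctr_def K.D.rewrite_prefix[OF e] \<beta>')
  qed (simp_all add: comp_mfctr_def in_hom)
qed

lemma ide_trans:
  assumes "symmetric_monoidal_functor R S H"
  shows "monoidal_trans R S H H (\<lambda>a\<in>Obj R. Ide S (fobj H a))"
proof -
  interpret H: symmetric_monoidal_functor R S H by fact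
  show ?thesis
    by (rule monoidal_transI) (auto simp: in_hom)
qed

text \<open>Two monoidal functors with the same values on the objects and arrows of \<open>R\<close> may differ as records
  elsewhere, since the operations are unconstrained there.  Composites of monoidal functors are
  associative and unital only up to this relation.\<close>

definition mfctr_agree :: "('o, 'a, 'm) smcat_scheme \<Rightarrow> ('o, 'a, 'p, 'q) mfctr \<Rightarrow> ('o, 'a, 'p, 'q) mfctr \<Rightarrow> bool" where
  "mfctr_agree R H K \<longleftrightarrow>
     (\<forall>a\<in>Obj R. fobj H a = fobj K a) \<and> (\<forall>f\<in>Arr R. farr H f = farr K f) \<and> munit H = munit K \<and>
     (\<forall>a\<in>Obj R. \<forall>b\<in>Obj R. mmult H a b = mmult K a b)"

lemma monoidal_trans_agree:
  assumes "monoidal_trans R S H K \<alpha>" "mfctr_agree R H H'" "mfctr_agree R K K'"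
  shows "monoidal_trans R S H' K' \<alpha>"
proof -
  have "f \<in> hom R a b \<Longrightarrow> f \<in> Arr R" for f a b
    by (simp add: in_hom)
  then show ?thesis
    using assms by (simp add: monoidal_trans_def nat_trans_def mfctr_agree_def)
qed

section \<open>Transformations out of a free rig\<close>

text \<open>The full faithfulness of evaluation at \<open>X\<close>, without the packaging of transformations as arrows of
  a category.\<close>

lemma free_rig_lift:
  fixes S :: "('p, 'q) smcat"
  assumes "free_rig_on \<A> R X TYPE('p \<times> 'q)" "rig_map \<A> R S H" "rig_map \<A> R S K"
    and "f \<in> hom S (fobj H X) (fobj K X)"
  shows "\<exists>!\<alpha>. monoidal_trans R S H K \<alpha> \<and> \<alpha> X = f"
proof -
  have "equivalence_of_categories (rig_hom \<A> R S) S (evaluation X)"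
    using assms by (simp add: free_rig_on_def rig_map_def)
  from equivalence_fully_faithful[OF this, of H K f]
  have "\<exists>!h. h \<in> hom (rig_hom \<A> R S) H K \<and> farr (evaluation X) h = f"
    using assms by (simp add: rig_hom_def evaluation_def)
  then obtain h where h: "h \<in> hom (rig_hom \<A> R S) H K \<and> farr (evaluation X) h = f"
    and u: "\<forall>k. k \<in> hom (rig_hom \<A> R S) H K \<and> farr (evaluation X) k = f \<longrightarrow> k = h"
    by (rule ex1E)
  have *: "(H, K, \<alpha>) \<in> hom (rig_hom \<A> R S) H K \<and> farr (evaluation X) (H, K, \<alpha>) = f \<longleftrightarrow>
      monoidal_trans R S H K \<alpha> \<and> \<alpha> X = f" for \<alpha>
    using assms by (auto simp: in_hom rig_hom_def evaluation_def)
  obtain \<alpha> where "h = (H, K, \<alpha>)"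
    using h by (auto simp: in_hom rig_hom_def)
  then show ?thesis
    using h u * by (intro ex1I[of _ \<alpha>]) blast+
qed

lemma free_rig_eq:
  fixes S :: "('p, 'q) smcat"
  assumes "free_rig_on \<A> R X TYPE('p \<times> 'q)" "rig_map \<A> R S H" "rig_map \<A> R S K"
    and "monoidal_trans R S H K \<alpha>" "monoidal_trans R S H K \<beta>" "\<alpha> X = \<beta> X"
  shows "\<alpha> = \<beta>"
proof -
  have "X \<in> Obj R"
    using assms(1) by (simp add: free_rig_on_def)
  then have "\<beta> X \<in> hom S (fobj H X) (fobj K X)"
    using monoidal_trans_component[OF assms(5)] by (simp add: in_hom)
  then show ?thesis
    using free_rig_lift[OF assms(1-3)] assms(4-6) by blast
qed

text \<open>The inverse at \<open>X\<close> also extends, and the two composites of the extensions are identities because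
  they are so at \<open>X\<close>.\<close>

lemma free_rig_invertible:
  fixes S :: "('p, 'q) smcat"
  assumes free: "free_rig_on \<A> R X TYPE('p \<times> 'q)" and H: "rig_map \<A> R S H" and K: "rig_map \<A> R S K"
    and \<alpha>: "monoidal_trans R S H K \<alpha>" "invertible S (\<alpha> X)" and a: "a \<in> Obj R"
  shows "invertible S (\<alpha> a)"
proof -
  have Hm: "symmetric_monoidal_functor R S H" and Km: "symmetric_monoidal_functor R S K"
    using H K by (auto simp: rig_map_def)
  interpret H: symmetric_monoidal_functor R S H by fact
  interpret K: symmetric_monoidal_functor R S K by fact
  have X: "X \<in> Obj R"
    using free by (simp add: free_rig_on_def)
  note [simp] = monoidal_trans_component[OF \<alpha>(1)]
  have "inverse_arr S (\<alpha> X) \<in> hom S (fobj K X) (fobj H X)"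
    using \<alpha>(2) X by (simp add: in_hom)
  then obtain \<beta> where \<beta>: "monoidal_trans R S K H \<beta>" "\<beta> X = inverse_arr S (\<alpha> X)"
    using free_rig_lift[OF free K H] by blast
  note [simp] = monoidal_trans_component[OF \<beta>(1)]
  have "(\<lambda>a\<in>Obj R. \<beta> a \<cdot>\<^bsub>S\<^esub> \<alpha> a) = (\<lambda>a\<in>Obj R. Ide S (fobj H a))"
    using X \<alpha>(2) by (intro free_rig_eq[OF free H H vertical_comp[OF Hm Km Hm \<alpha>(1) \<beta>(1)] ide_trans[OF Hm]])
      (simp add: \<beta>(2))
  from fun_cong[OF this, of a] have "\<beta> a \<cdot>\<^bsub>S\<^esub> \<alpha> a = Ide S (fobj H a)"
    using a by simp
  moreover have "(\<lambda>a\<in>Obj R. \<alpha> a \<cdot>\<^bsub>S\<^esub> \<beta> a) = (\<lambda>a\<in>Obj R. Ide S (fobj K a))"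
    using X \<alpha>(2) by (intro free_rig_eq[OF free K K vertical_comp[OF Km Hm Km \<beta>(1) \<alpha>(1)] ide_trans[OF Km]])
      (simp add: \<beta>(2))
  from fun_cong[OF this, of a] have "\<alpha> a \<cdot>\<^bsub>S\<^esub> \<beta> a = Ide S (fobj K a)"
    using a by simp
  ultimately show ?thesis
    using a by (intro H.D.invertibleI[of "\<alpha> a" "fobj H a" "fobj K a" "\<beta> a"]) (simp_all add: in_hom)
qed

section \<open>The chain rule\<close>

lemma dual_Dom: "Dom (dual_numbers R) x = (Dom R (fst x), Dom R (snd x))"
  by (cases x) simp

lemma dual_Cod: "Cod (dual_numbers R) x = (Cod R (fst x), Cod R (snd x))"
  by (cases x) simp

locale chain_rule =
  fixes \<A> :: "('j, 'k) cat set"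
    and R :: "('o, 'a) smcat" (structure) and X :: 'o
    and S :: "'o \<Rightarrow> ('o, 'a, 'o, 'a) mfctr" and s :: "'o \<Rightarrow> 'a"
    and T :: "('o, 'a, 'o \<times> 'o, 'a \<times> 'a) mfctr" and t :: "'a \<times> 'a"
  assumes add_doctrine: "additive_doctrine \<A>"
    and free: "free_rig_on \<A> R X TYPE('o \<times> 'a)"
    and free_dual: "free_rig_on \<A> R X TYPE(('o \<times> 'o) \<times> ('a \<times> 'a))"
    and subst_prod: "substitution_product \<A> R X S s"
    and derivation: "standard_derivation \<A> R X T t"
begin

abbreviation D where "D \<equiv> dual_numbers R"

sublocale doctrine_rig \<A> R
  using add_doctrine free by (simp add: doctrine_rig_def free_rig_on_def)

lemma X_obj [simp]: "X \<in> Obj R"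
  using free by (simp add: free_rig_on_def)

lemma S_rig_map: "G \<in> Obj R \<Longrightarrow> rig_map \<A> R R (S G)"
  using subst_prod by (simp add: substitution_product_def)

lemma S_monoidal: "G \<in> Obj R \<Longrightarrow> symmetric_monoidal_functor R R (S G)"
  using S_rig_map by (simp add: rig_map_def)

lemma s_simps [simp]:
  assumes "G \<in> Obj R"
  shows "invertible R (s G)" "Dom R (s G) = fobj (S G) X" "Cod R (s G) = G"
  using assms subst_prod by (auto simp: substitution_product_def iso_between_iff in_hom)

lemma T_rig_map: "rig_map \<A> R D T"
  using derivation by (simp add: standard_derivation_def)

lemma D_rig: "rig \<A> D"
  using T_rig_map by (simp add: rig_map_def)

lemma T_monoidal: "symmetric_monoidal_functor R D T"
  using T_rig_map by (simp add: rig_map_def)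

sublocale T: symmetric_monoidal_functor R D T
  by (rule T_monoidal)

lemma t_simps [simp]:
  "invertible R (fst t)" "Dom R (fst t) = fst (fobj T X)" "Cod R (fst t) = X"
  "invertible R (snd t)" "Dom R (snd t) = deriv T X" "Cod R (snd t) = \<one>"
proof -
  obtain t1 t2 x1 x2 where [simp]: "t = (t1, t2)" "fobj T X = (x1, x2)"
    by (metis surj_pair)
  have "iso_between D t (fobj T X) (X, \<one>)"
    using derivation by (simp add: standard_derivation_def)
  then show "invertible R (fst t)" "Dom R (fst t) = fst (fobj T X)" "Cod R (fst t) = X"
    "invertible R (snd t)" "Dom R (snd t) = deriv T X" "Cod R (snd t) = \<one>"
    by (simp_all add: iso_between_iff in_hom deriv_def)
qed

lemma T_obj [simp]:
  assumes "a \<in> Obj R"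
  shows "fst (fobj T a) \<in> Obj R" "deriv T a \<in> Obj R"
  using T.fobj_obj[OF assms] by (simp_all add: mem_Times_iff deriv_def)

lemma T_arr [simp]:
  assumes "f \<in> Arr R"
  shows "fst (farr T f) \<in> Arr R" "Dom R (fst (farr T f)) = fst (fobj T (Dom R f))"
    "Cod R (fst (farr T f)) = fst (fobj T (Cod R f))"
    "derivA T f \<in> Arr R" "Dom R (derivA T f) = deriv T (Dom R f)" "Cod R (derivA T f) = deriv T (Cod R f)"
  using T.farr_simps[OF assms] by (simp_all add: mem_Times_iff deriv_def derivA_def dual_Dom dual_Cod prod_eq_iff)

lemma derivA_comp:
  "f \<in> Arr R \<Longrightarrow> g \<in> Arr R \<Longrightarrow> Cod R f = Dom R g \<Longrightarrow> derivA T (g \<cdot> f) = derivA T g \<cdot> derivA T f"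
  by (simp add: derivA_def dual_comp)

lemma derivA_invertible [simp]: "invertible R f \<Longrightarrow> invertible R (derivA T f)"
  using T.farr_invertible[of f] by (cases "farr T f") (simp add: derivA_def)

subsection \<open>The first component of the derivation\<close>

abbreviation "T1 \<equiv> comp_mfctr R (dual_proj R) T"

abbreviation "\<tau> \<equiv> first_component_trans R X T t"

lemma proj_rig_map: "rig_map \<A> D R (dual_proj R)"
  by (rule dual_proj_rig_map[OF doctrine rig D_rig])

lemma proj_monoidal: "symmetric_monoidal_functor D R (dual_proj R)"
  using proj_rig_map by (simp add: rig_map_def)

lemma T1_rig_map: "rig_map \<A> R R T1"
  by (rule comp_rig_map[OF T_rig_map proj_rig_map])

lemma T1_monoidal: "symmetric_monoidal_functor R R T1"
  using T1_rig_map by (simp add: rig_map_def)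

lemma id_monoidal: "symmetric_monoidal_functor R R (id_mfctr R)"
  using id_rig_map[OF rig] by (simp add: rig_map_def)

lemma T1_simps [simp]: "fobj T1 a = fst (fobj T a)" "farr T1 f = fst (farr T f)"
  by (simp_all add: comp_mfctr_def dual_proj_def)

lemma id_simps [simp]: "fobj (id_mfctr R) a = a" "farr (id_mfctr R) f = f"
  by (simp_all add: id_mfctr_def)

lemma \<tau>: "monoidal_trans R R T1 (id_mfctr R) \<tau>" "\<tau> X = fst t"
proof -
  have "fst t \<in> hom R (fobj T1 X) (fobj (id_mfctr R) X)"
    by (simp add: in_hom)
  from theI'[OF free_rig_lift[OF free T1_rig_map id_rig_map[OF rig] this]]
  show "monoidal_trans R R T1 (id_mfctr R) \<tau>" "\<tau> X = fst t"
    by (simp_all add: first_component_trans_def)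
qed

lemma \<tau>_simps [simp]:
  assumes "a \<in> Obj R"
  shows "invertible R (\<tau> a)" "Dom R (\<tau> a) = fst (fobj T a)" "Cod R (\<tau> a) = a"
  using monoidal_trans_component[OF \<tau>(1) assms]
    free_rig_invertible[OF free T1_rig_map id_rig_map[OF rig] \<tau>(1) _ assms] \<tau>(2)
  by simp_all

subsection \<open>The two rig maps\<close>

text \<open>Its second component is the left side \<open>(F \<circ> G)'\<close> of the chain rule.\<close>

definition V where "V G = comp_mfctr D T (S G)"

text \<open>Its second component is the right side \<open>(F' \<circ> G) \<otimes> G'\<close> of the chain rule.\<close>

definition W where "W G = comp_mfctr D (dual_extension R R (S G) (deriv T G)) T"

lemma V_rig_map: "G \<in> Obj R \<Longrightarrow> rig_map \<A> R D (V G)"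
  unfolding V_def by (rule comp_rig_map[OF S_rig_map T_rig_map])

lemma extension_rig_map:
  "G \<in> Obj R \<Longrightarrow> rig_map \<A> D D (dual_extension R R (S G) (deriv T G))"
  by (rule dual_functor.E_rig_map[OF dual_extension_dual_functor[OF doctrine S_rig_map D_rig D_rig]]) simp_all

lemma W_rig_map: "G \<in> Obj R \<Longrightarrow> rig_map \<A> R D (W G)"
  unfolding W_def by (rule comp_rig_map[OF T_rig_map extension_rig_map])

lemma V_monoidal: "G \<in> Obj R \<Longrightarrow> symmetric_monoidal_functor R D (V G)"
  and W_monoidal: "G \<in> Obj R \<Longrightarrow> symmetric_monoidal_functor R D (W G)"
  and extension_monoidal: "G \<in> Obj R \<Longrightarrow> symmetric_monoidal_functor D D (dual_extension R R (S G) (deriv T G))"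
  using V_rig_map W_rig_map extension_rig_map by (simp_all add: rig_map_def)

lemma extension_simps [simp]:
  "fst (fobj (dual_extension R R H Q) p) = fobj H (fst p)"
  "snd (fobj (dual_extension R R H Q) p) = fobj H (snd p) \<otimes> Q"
  "fst (farr (dual_extension R R H Q) x) = farr H (fst x)"
  "snd (farr (dual_extension R R H Q) x) = farr H (snd x) \<odot> Ide R Q"
  "fst (munit (dual_extension R R H Q)) = munit H"
  "fst (mmult (dual_extension R R H Q) p q) = mmult H (fst p) (fst q)"
  by (simp_all add: dual_extension_def case_prod_beta)

lemma V_simps [simp]:
  "fobj (V G) F = fobj T (subst S F G)" "farr (V G) f = farr T (farr (S G) f)"
  by (simp_all add: V_def comp_mfctr_def subst_def)

lemma W_simps [simp]:
  "fst (fobj (W G) F) = fobj (S G) (fst (fobj T F))" "snd (fobj (W G) F) = subst S (deriv T F) G \<otimes> deriv T G"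
  "fst (farr (W G) f) = farr (S G) (fst (farr T f))" "snd (farr (W G) f) = farr (S G) (derivA T f) \<odot> Ide R (deriv T G)"
  by (simp_all add: W_def comp_mfctr_def subst_def deriv_def derivA_def)

lemma trans_simps:
  assumes "monoidal_trans R D (V G) (W G1) \<alpha>" "F \<in> Obj R"
  shows "fst (\<alpha> F) \<in> Arr R" "Dom R (fst (\<alpha> F)) = fst (fobj T (subst S F G))"
    "Cod R (fst (\<alpha> F)) = fobj (S G1) (fst (fobj T F))"
    "snd (\<alpha> F) \<in> Arr R" "Dom R (snd (\<alpha> F)) = deriv T (subst S F G)"
    "Cod R (snd (\<alpha> F)) = subst S (deriv T F) G1 \<otimes> deriv T G1"
proof -
  have "Cod D (\<alpha> F) = (fst (fobj (W G1) F), snd (fobj (W G1) F))"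
    using monoidal_trans_component(3)[OF assms] by (simp only: prod.collapse)
  then show "fst (\<alpha> F) \<in> Arr R" "Dom R (fst (\<alpha> F)) = fst (fobj T (subst S F G))"
    "Cod R (fst (\<alpha> F)) = fobj (S G1) (fst (fobj T F))"
    "snd (\<alpha> F) \<in> Arr R" "Dom R (snd (\<alpha> F)) = deriv T (subst S F G)"
    "Cod R (snd (\<alpha> F)) = subst S (deriv T F) G1 \<otimes> deriv T G1"
    using monoidal_trans_component(1,2)[OF assms]
    unfolding W_simps V_simps dual_Dom dual_Cod by (simp_all add: mem_Times_iff deriv_def prod_eq_iff)
qed

text \<open>The first component of a transformation from \<open>V G\<close> to \<open>W G\<close> is forced as soon as it is known at
  \<open>X\<close>.  After composition with \<open>\<tau>\<close> it becomes a monoidal transformation into \<open>- \<circ> G\<close>, and so is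
  \<open>F \<mapsto> \<tau> (F \<circ> G)\<close>; the two agree at \<open>X\<close>, hence everywhere.\<close>

lemma first_component:
  assumes G: "G \<in> Obj R" and \<alpha>: "monoidal_trans R D (V G) (W G) \<alpha>"
    and X: "farr (S G) (\<tau> X) \<cdot> fst (\<alpha> X) = \<tau> (subst S X G)"
    and F: "F \<in> Obj R"
  shows "farr (S G) (\<tau> F) \<cdot> fst (\<alpha> F) = \<tau> (subst S F G)"
proof -
  interpret H: symmetric_monoidal_functor R R "S G"
    by (rule S_monoidal[OF G])
  let ?P = "comp_mfctr R (dual_proj R) (V G)" and ?Q = "comp_mfctr R (dual_proj R) (W G)"
  have P: "rig_map \<A> R R ?P"
    by (rule comp_rig_map[OF V_rig_map[OF G] proj_rig_map])
  have Q: "rig_map \<A> R R ?Q"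
    by (rule comp_rig_map[OF W_rig_map[OF G] proj_rig_map])
  have M: "symmetric_monoidal_functor R R ?P" "symmetric_monoidal_functor R R ?Q"
    using P Q by (simp_all add: rig_map_def)
  have m: "mmult T a b \<in> Arr D \<and> fst (mmult T a b) \<in> Arr R \<and>
      Dom R (fst (mmult T a b)) = fst (fobj T a) \<otimes> fst (fobj T b) \<and> Cod R (fst (mmult T a b)) = fst (fobj T (a \<otimes> b))"
    if "a \<in> Obj R" "b \<in> Obj R" for a b
  proof -
    obtain a1 a2 b1 b2 where [simp]: "fobj T a = (a1, a2)" "fobj T b = (b1, b2)"
      by (metis surj_pair)
    show ?thesis
      using T.D.invertible_simps(1)[OF T.mmult_simps(1)[OF that]] T.mmult_simps(2,3)[OF that]
      by (auto simp: mem_Times_iff dual_Dom dual_Cod prod_eq_iff)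
  qed
  have u: "munit T \<in> Arr D" "fst (munit T) \<in> Arr R" "Dom R (fst (munit T)) = \<one>" "Cod R (fst (munit T)) = fst (fobj T \<one>)"
    using T.D.invertible_simps(1)[OF T.munit_simps(1)] T.munit_simps(2,3)
    by (auto simp: mem_Times_iff dual_Dom dual_Cod prod_eq_iff)
  note [simp] = u conjunct1[OF conjunct2[OF m]] conjunct1[OF conjunct2[OF conjunct2[OF m]]]
    conjunct2[OF conjunct2[OF conjunct2[OF m]]]
  \<comment> \<open>Composites of the same functors in different bracketings agree on the objects and arrows of \<open>R\<close>.\<close>
  have Q_agree: "mfctr_agree R ?Q (comp_mfctr R (S G) T1)"
    by (simp add: mfctr_agree_def comp_mfctr_def W_def dual_proj_def dual_comp)
  have P_agree: "mfctr_agree R (comp_mfctr R T1 (S G)) ?P"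
    by (simp add: mfctr_agree_def comp_mfctr_def V_def dual_proj_def dual_comp)
  have S_agree: "mfctr_agree R (comp_mfctr R (S G) (id_mfctr R)) (S G)"
    "mfctr_agree R (comp_mfctr R (id_mfctr R) (S G)) (S G)"
    by (simp_all add: mfctr_agree_def comp_mfctr_def id_mfctr_def)
  have refl: "mfctr_agree R K K" for K :: "('o, 'a, 'o, 'a) mfctr"
    by (simp add: mfctr_agree_def)
  have \<alpha>1: "monoidal_trans R R ?P (comp_mfctr R (S G) T1) (\<lambda>a\<in>Obj R. farr (dual_proj R) (\<alpha> a))"
    by (rule monoidal_trans_agree[OF whisker_left[OF V_monoidal[OF G] W_monoidal[OF G] proj_monoidal \<alpha>] refl Q_agree])
  have \<tau>1: "monoidal_trans R R (comp_mfctr R (S G) T1) (S G) (\<lambda>a\<in>Obj R. farr (S G) (\<tau> a))"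
    by (rule monoidal_trans_agree[OF whisker_left[OF T1_monoidal id_monoidal S_monoidal[OF G] \<tau>(1)] refl S_agree(1)])
  have \<tau>2: "monoidal_trans R R ?P (S G) (\<lambda>a\<in>Obj R. \<tau> (fobj (S G) a))"
    by (rule monoidal_trans_agree[OF whisker_right[OF S_monoidal[OF G] T1_monoidal id_monoidal \<tau>(1)] P_agree S_agree(2)])
  note \<beta> = vertical_comp[OF M(1) comp_mfctr_monoidal[OF T1_monoidal S_monoidal[OF G]] S_monoidal[OF G] \<alpha>1 \<tau>1]
  from free_rig_eq[OF free P S_rig_map[OF G] \<beta> \<tau>2] X
  have "(\<lambda>a\<in>Obj R. (\<lambda>a\<in>Obj R. farr (S G) (\<tau> a)) a \<cdot> (\<lambda>a\<in>Obj R. farr (dual_proj R) (\<alpha> a)) a)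
    = (\<lambda>a\<in>Obj R. \<tau> (fobj (S G) a))"
    by (simp add: dual_proj_def subst_def)
  from fun_cong[OF this, of F] F show ?thesis
    by (simp add: dual_proj_def subst_def)
qed

subsection \<open>The canonical transformation\<close>

text \<open>The isomorphism \<open>(X' \<circ> G) \<otimes> G' \<cong> G'\<close> that comes from \<open>X' \<cong> \<one>\<close>.\<close>

definition L where
  "L G = Lun R (deriv T G) \<cdot> (inverse_arr R (munit (S G)) \<odot> Ide R (deriv T G)) \<cdot>
    (farr (S G) (snd t) \<odot> Ide R (deriv T G))"

lemma L_simps [simp]:
  assumes "G \<in> Obj R"
  shows "invertible R (L G)" "Dom R (L G) = subst S (deriv T X) G \<otimes> deriv T G" "Cod R (L G) = deriv T G"
proof -
  interpret H: symmetric_monoidal_functor R R "S G"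
    by (rule S_monoidal[OF assms])
  show "invertible R (L G)" "Dom R (L G) = subst S (deriv T X) G \<otimes> deriv T G" "Cod R (L G) = deriv T G"
    using assms by (simp_all add: L_def subst_def)
qed

text \<open>The prescribed value at \<open>X\<close> of the canonical transformation: the first component is the one that
  canonicity asks for, and the second one is \<open>(X \<circ> G)' \<cong> G' \<cong> (X' \<circ> G) \<otimes> G'\<close>.\<close>

definition at_X where
  "at_X G = (inverse_arr R (farr (S G) (\<tau> X)) \<cdot> \<tau> (subst S X G), inverse_arr R (L G) \<cdot> derivA T (s G))"

lemma at_X:
  assumes G: "G \<in> Obj R"
  shows "at_X G \<in> hom D (fobj (V G) X) (fobj (W G) X)" "invertible D (at_X G)"
proof -
  interpret H: symmetric_monoidal_functor R R "S G"
    by (rule S_monoidal[OF assms])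
  show "at_X G \<in> hom D (fobj (V G) X) (fobj (W G) X)"
    using G unfolding in_dual_hom by (simp add: at_X_def in_hom subst_def deriv_def[of T, symmetric])
  show "invertible D (at_X G)"
    using G by (simp add: at_X_def subst_def)
qed

definition canonical where
  "canonical G = (THE \<alpha>. monoidal_trans R D (V G) (W G) \<alpha> \<and> \<alpha> X = at_X G)"

lemma canonical:
  assumes "G \<in> Obj R"
  shows "monoidal_trans R D (V G) (W G) (canonical G)" "canonical G X = at_X G"
  using theI'[OF free_rig_lift[OF free_dual V_rig_map W_rig_map at_X(1)]] assms
  by (simp_all add: canonical_def)

definition \<phi> where "\<phi> F G = snd (canonical G F)"

lemma canonical_eq:
  assumes G: "G \<in> Obj R"
  shows "canonical G = (\<lambda>F\<in>Obj R. (inverse_arr R (farr (S G) (\<tau> F)) \<cdot> \<tau> (subst S F G), \<phi> F G))"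
proof
  fix F
  interpret H: symmetric_monoidal_functor R R "S G"
    by (rule S_monoidal[OF assms])
  show "canonical G F = (\<lambda>F\<in>Obj R. (inverse_arr R (farr (S G) (\<tau> F)) \<cdot> \<tau> (subst S F G), \<phi> F G)) F"
  proof (cases "F \<in> Obj R")
    case True
    have "farr (S G) (\<tau> F) \<cdot> fst (canonical G F) = \<tau> (subst S F G)"
      by (rule first_component[OF G canonical(1)[OF G] _ True])
        (use G in \<open>simp add: canonical at_X_def subst_def\<close>)
    then have "fst (canonical G F) = inverse_arr R (farr (S G) (\<tau> F)) \<cdot> \<tau> (subst S F G)"
      using trans_simps[OF canonical(1)[OF G] True] True by (intro move_left) simp_all
    then show ?thesis
      using True by (simp add: \<phi>_def prod_eq_iff)
  next
    case False
    then show ?thesis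
      using canonical(1)[OF G] by (simp add: monoidal_trans_def nat_trans_def extensional_def)
  qed
qed

lemma \<phi>_iso:
  assumes "F \<in> Obj R" "G \<in> Obj R"
  shows "iso_between R (\<phi> F G) (deriv T (subst S F G)) (subst S (deriv T F) G \<otimes> deriv T G)"
proof -
  have "invertible D (canonical G F)"
    using free_rig_invertible[OF free_dual V_rig_map W_rig_map canonical(1) _ assms(1)] assms(2) at_X(2)
    by (simp add: canonical(2))
  then have "invertible R (\<phi> F G)"
    by (cases "canonical G F") (simp add: \<phi>_def)
  then show ?thesis
    using trans_simps[OF canonical(1) assms(1)] assms by (simp add: iso_between_iff in_hom \<phi>_def)
qed

text \<open>Canonicity of \<open>\<psi>\<close> says that \<open>\<psi>\<close> is the second component of a monoidal transformation from \<open>V G\<close> to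
  \<open>W G\<close> with value \<open>at_X G\<close> at \<open>X\<close>, and there is only one such transformation.\<close>

lemma canonical_iff:
  assumes G: "G \<in> Obj R"
  shows "canonical_chain_rule R X S s T t G \<psi> \<longleftrightarrow> (\<forall>F\<in>Obj R. \<psi> F = \<phi> F G)"
proof -
  let ?\<alpha> = "\<lambda>\<psi>. (\<lambda>F\<in>Obj R. (inverse_arr R (farr (S G) (\<tau> F)) \<cdot> \<tau> (subst S F G), \<psi> F))"
  interpret H: symmetric_monoidal_functor R R "S G"
    by (rule S_monoidal[OF assms])
  have iff: "canonical_chain_rule R X S s T t G \<psi> \<longleftrightarrow>
      monoidal_trans R D (V G) (W G) (?\<alpha> \<psi>) \<and> ?\<alpha> \<psi> X = at_X G"
  proof (cases "monoidal_trans R D (V G) (W G) (?\<alpha> \<psi>)")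
    case True
    from trans_simps(4-6)[OF this, of X] have [simp]: "\<psi> X \<in> Arr R" "Dom R (\<psi> X) = deriv T (subst S X G)"
      "Cod R (\<psi> X) = subst S (deriv T X) G \<otimes> deriv T G"
      by simp_all
    have "Lun R (deriv T G) \<cdot> (inverse_arr R (munit (S G)) \<odot> Ide R (deriv T G)) \<cdot>
        (farr (S G) (snd t) \<odot> Ide R (deriv T G)) \<cdot> \<psi> X = L G \<cdot> \<psi> X"
      using G by (simp add: L_def subst_def)
    moreover have "L G \<cdot> \<psi> X = derivA T (s G) \<longleftrightarrow> \<psi> X = inverse_arr R (L G) \<cdot> derivA T (s G)"
      using G by (intro comp_eq_iff) simp_all
    ultimately show ?thesis
      using True by (simp add: canonical_chain_rule_def Let_def V_def W_def at_X_def)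
  next
    case False
    then show ?thesis
      by (simp add: canonical_chain_rule_def Let_def V_def W_def)
  qed
  show ?thesis
  proof
    assume "canonical_chain_rule R X S s T t G \<psi>"
    then have "?\<alpha> \<psi> = canonical G"
      unfolding iff using free_rig_eq[OF free_dual V_rig_map[OF G] W_rig_map[OF G], of "?\<alpha> \<psi>" "canonical G"]
        canonical[OF G] by simp
    then have eq: "?\<alpha> \<psi> F = ?\<alpha> (\<lambda>F. \<phi> F G) F" for F
      unfolding canonical_eq[OF G] by (rule fun_cong)
    show "\<forall>F\<in>Obj R. \<psi> F = \<phi> F G"
    proof
      fix F assume "F \<in> Obj R"
      then show "\<psi> F = \<phi> F G"
        using eq[of F] by simp
    qed
  next
    assume *: "\<forall>F\<in>Obj R. \<psi> F = \<phi> F G"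
    have "?\<alpha> \<psi> = canonical G"
      unfolding canonical_eq[OF G] using * by (intro restrict_ext) simp
    then show "canonical_chain_rule R X S s T t G \<psi>"
      unfolding iff using canonical[OF G] by (simp only:)
  qed
qed

subsection \<open>Naturality\<close>

lemma subst_trans:
  assumes "g \<in> Arr R"
  shows "monoidal_trans R R (S (Dom R g)) (S (Cod R g)) (subst_trans R X S s g)"
    and "s (Cod R g) \<cdot> subst_trans R X S s g X = g \<cdot> s (Dom R g)"
proof -
  let ?G = "Dom R g" and ?G1 = "Cod R g"
  have G [simp]: "?G \<in> Obj R" "?G1 \<in> Obj R"
    using assms by simp_all
  interpret H: symmetric_monoidal_functor R R "S ?G"
    by (rule S_monoidal) simp
  interpret H1: symmetric_monoidal_functor R R "S ?G1"
    by (rule S_monoidal) simp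
  let ?f = "inverse_arr R (s ?G1) \<cdot> g \<cdot> s ?G"
  have f: "?f \<in> hom R (fobj (S ?G) X) (fobj (S ?G1) X)"
    using assms by (simp add: in_hom)
  have "(monoidal_trans R R (S ?G) (S ?G1) \<alpha> \<and> s ?G1 \<cdot> \<alpha> X = g \<cdot> s ?G) \<longleftrightarrow>
      (monoidal_trans R R (S ?G) (S ?G1) \<alpha> \<and> \<alpha> X = ?f)" for \<alpha>
  proof (cases "monoidal_trans R R (S ?G) (S ?G1) \<alpha>")
    case True
    from monoidal_trans_component[OF this X_obj] show ?thesis
      using comp_eq_iff[of "s ?G1" "\<alpha> X" "g \<cdot> s ?G"] assms by simp
  qed simp
  then have "\<exists>!\<alpha>. monoidal_trans R R (S ?G) (S ?G1) \<alpha> \<and> s ?G1 \<cdot> \<alpha> X = g \<cdot> s ?G"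
    using free_rig_lift[OF free S_rig_map S_rig_map f] by simp
  from theI'[OF this] show "monoidal_trans R R (S ?G) (S ?G1) (subst_trans R X S s g)"
    "s ?G1 \<cdot> subst_trans R X S s g X = g \<cdot> s ?G"
    by (simp_all add: subst_trans_def)
qed

text \<open>Naturality in the inner argument.  Both sides are second components of monoidal transformations from
  \<open>V G\<close> to \<open>W G1\<close>: on the left the canonical one after \<open>T\<close> applied to \<open>- \<circ> g\<close>, on the right the one
  induced by \<open>- \<circ> g\<close> and \<open>g'\<close> on dual numbers after the canonical one.  Hence it suffices to compare them
  at \<open>X\<close>, where the first components agree by naturality of \<open>\<tau>\<close> and of \<open>- \<circ> g\<close>, and the second ones
  after the isomorphism \<open>L G1\<close>.\<close>

lemma canonical_natural:
  assumes g: "g \<in> Arr R" "Dom R g = G" "Cod R g = G1" and F: "F \<in> Obj R"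
  defines "\<sigma> \<equiv> subst_trans R X S s g"
  shows "\<phi> F G1 \<cdot> derivA T (\<sigma> F) = (\<sigma> (deriv T F) \<odot> derivA T g) \<cdot> \<phi> F G"
proof -
  have G [simp]: "G \<in> Obj R" "G1 \<in> Obj R"
    using g by auto
  interpret H: symmetric_monoidal_functor R R "S G"
    by (rule S_monoidal) simp
  interpret H1: symmetric_monoidal_functor R R "S G1"
    by (rule S_monoidal) simp
  have \<sigma>: "monoidal_trans R R (S G) (S G1) \<sigma>" "s G1 \<cdot> \<sigma> X = g \<cdot> s G"
    using subst_trans[OF g(1)] g by (simp_all add: \<sigma>_def)
  note [simp] = g monoidal_trans_component[OF \<sigma>(1)]
  have \<sigma>n: "\<sigma> (Cod R f) \<cdot> farr (S G) f = farr (S G1) f \<cdot> \<sigma> (Dom R f)" if "f \<in> Arr R" for f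
    by (rule monoidal_trans_natural[OF \<sigma>(1) category_axioms that])
  let ?E = "dual_extension R R (S G) (deriv T G)" and ?E1 = "dual_extension R R (S G1) (deriv T G1)"
  define \<xi> where "\<xi> = (\<lambda>(A, M) \<in> Obj D. (\<sigma> A, \<sigma> M \<odot> derivA T g))"
  have \<xi>: "monoidal_trans D D ?E ?E1 \<xi>"
    unfolding \<xi>_def by (rule dual_extension_trans[OF doctrine S_rig_map S_rig_map D_rig D_rig \<sigma>(1)]) (simp_all add: in_hom)
  have \<xi>T: "\<xi> (fobj T F) = (\<sigma> (fst (fobj T F)), \<sigma> (deriv T F) \<odot> derivA T g)" if "F \<in> Obj R" for F
    using T.fobj_obj[OF that] by (cases "fobj T F") (simp add: \<xi>_def deriv_def)
  have T\<sigma>: "monoidal_trans R D (V G) (V G1) (\<lambda>a\<in>Obj R. farr T (\<sigma> a))"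
    unfolding V_def by (rule whisker_left[OF S_monoidal S_monoidal T_monoidal \<sigma>(1)]) (rule G)+
  have 1: "monoidal_trans R D (V G) (W G1) (\<lambda>a\<in>Obj R. canonical G1 a \<cdot>\<^bsub>D\<^esub> (\<lambda>a\<in>Obj R. farr T (\<sigma> a)) a)"
    by (rule vertical_comp[OF V_monoidal V_monoidal W_monoidal T\<sigma> canonical(1)]) (rule G)+
  have \<xi>W: "monoidal_trans R D (W G) (W G1) (\<lambda>a\<in>Obj R. \<xi> (fobj T a))"
    unfolding W_def by (rule whisker_right[OF T_monoidal extension_monoidal extension_monoidal \<xi>]) (rule G)+
  have 2: "monoidal_trans R D (V G) (W G1) (\<lambda>a\<in>Obj R. (\<lambda>a\<in>Obj R. \<xi> (fobj T a)) a \<cdot>\<^bsub>D\<^esub> canonical G a)"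
    by (rule vertical_comp[OF V_monoidal W_monoidal W_monoidal canonical(1) \<xi>W]) (rule G)+
  \<comment> \<open>The comparison at the generator; the rest is freeness.\<close>
  have "canonical G1 X \<cdot>\<^bsub>D\<^esub> farr T (\<sigma> X) = \<xi> (fobj T X) \<cdot>\<^bsub>D\<^esub> canonical G X"
  proof (rule prod_eqI)
    have n1: "\<tau> (fobj (S G1) X) \<cdot> fst (farr T (\<sigma> X)) = \<sigma> X \<cdot> \<tau> (fobj (S G) X)"
      using monoidal_trans_natural[OF \<tau>(1) category_axioms, of "\<sigma> X"] by simp
    have n2: "\<sigma> X \<cdot> farr (S G) (\<tau> X) = farr (S G1) (\<tau> X) \<cdot> \<sigma> (fst (fobj T X))"
      using \<sigma>n[of "\<tau> X"] by simp
    have n3: "\<sigma> X \<cdot> \<tau> (fobj (S G) X) = farr (S G1) (\<tau> X) \<cdot> \<sigma> (fst (fobj T X)) \<cdot> inverse_arr R (farr (S G) (\<tau> X)) \<cdot> \<tau> (fobj (S G) X)"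
      using rewrite_prefix[OF n2, of "inverse_arr R (farr (S G) (\<tau> X)) \<cdot> \<tau> (fobj (S G) X)"] by simp
    show "fst (canonical G1 X \<cdot>\<^bsub>D\<^esub> farr T (\<sigma> X)) = fst (\<xi> (fobj T X) \<cdot>\<^bsub>D\<^esub> canonical G X)"
      by (simp add: canonical at_X_def \<xi>T dual_comp subst_def n1 n3)
  next
    \<comment> \<open>The unit isomorphisms are natural in \<open>G\<close>, as \<open>- \<circ> g\<close> is monoidal.\<close>
    have L: "L G1 \<cdot> (\<sigma> (deriv T X) \<odot> derivA T g) = derivA T g \<cdot> L G"
    proof -
      have n1: "farr (S G1) (snd t) \<cdot> \<sigma> (deriv T X) = \<sigma> \<one> \<cdot> farr (S G) (snd t)"
        using \<sigma>n[of "snd t"] by simp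
      have n2: "inverse_arr R (munit (S G1)) \<cdot> \<sigma> \<one> = inverse_arr R (munit (S G))"
      proof (rule epi_cancel[of "munit (S G)"])
        show "(inverse_arr R (munit (S G1)) \<cdot> \<sigma> \<one>) \<cdot> munit (S G) = inverse_arr R (munit (S G)) \<cdot> munit (S G)"
          by (simp add: monoidal_trans_coherent(1)[OF \<sigma>(1)])
      qed simp_all
      have n3: "Lun R (deriv T G1) \<cdot> (Ide R \<one> \<odot> derivA T g) = derivA T g \<cdot> Lun R (deriv T G)"
        using lun_natural[of "derivA T g"] by simp
      have "L G1 \<cdot> (\<sigma> (deriv T X) \<odot> derivA T g) = Lun R (deriv T G1) \<cdot>
          ((inverse_arr R (munit (S G1)) \<cdot> farr (S G1) (snd t) \<cdot> \<sigma> (deriv T X)) \<odot> derivA T g)"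
        by (simp add: L_def)
      also have "\<dots> = Lun R (deriv T G1) \<cdot> (((inverse_arr R (munit (S G1)) \<cdot> \<sigma> \<one>) \<cdot> farr (S G) (snd t)) \<odot> derivA T g)"
        by (simp add: n1)
      also have "\<dots> = (Lun R (deriv T G1) \<cdot> (Ide R \<one> \<odot> derivA T g)) \<cdot> ((inverse_arr R (munit (S G)) \<cdot> farr (S G) (snd t)) \<odot> Ide R (deriv T G))"
        unfolding n2 by simp
      also have "\<dots> = derivA T g \<cdot> L G"
        unfolding n3 by (simp add: L_def)
      finally show ?thesis .
    qed
    have "L G1 \<cdot> (inverse_arr R (L G1) \<cdot> derivA T (s G1)) \<cdot> derivA T (\<sigma> X) = derivA T (s G1 \<cdot> \<sigma> X)"
      by (simp add: derivA_comp)
    also have "\<dots> = (derivA T g \<cdot> L G) \<cdot> inverse_arr R (L G) \<cdot> derivA T (s G)"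
      unfolding \<sigma>(2) by (simp add: derivA_comp)
    also have "\<dots> = L G1 \<cdot> (\<sigma> (deriv T X) \<odot> derivA T g) \<cdot> inverse_arr R (L G) \<cdot> derivA T (s G)"
      unfolding L[symmetric] by (simp add: subst_def)
    finally have c: "L G1 \<cdot> (inverse_arr R (L G1) \<cdot> derivA T (s G1)) \<cdot> derivA T (\<sigma> X)
      = L G1 \<cdot> (\<sigma> (deriv T X) \<odot> derivA T g) \<cdot> inverse_arr R (L G) \<cdot> derivA T (s G)" .
    have "(inverse_arr R (L G1) \<cdot> derivA T (s G1)) \<cdot> derivA T (\<sigma> X) =
        (\<sigma> (deriv T X) \<odot> derivA T g) \<cdot> inverse_arr R (L G) \<cdot> derivA T (s G)"
      by (rule mono_cancel[OF _ c]) (simp_all add: subst_def)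
    then show "snd (canonical G1 X \<cdot>\<^bsub>D\<^esub> farr T (\<sigma> X)) = snd (\<xi> (fobj T X) \<cdot>\<^bsub>D\<^esub> canonical G X)"
      by (simp add: canonical at_X_def \<xi>T dual_comp derivA_def)
  qed
  then have "(\<lambda>a\<in>Obj R. canonical G1 a \<cdot>\<^bsub>D\<^esub> (\<lambda>a\<in>Obj R. farr T (\<sigma> a)) a)
      = (\<lambda>a\<in>Obj R. (\<lambda>a\<in>Obj R. \<xi> (fobj T a)) a \<cdot>\<^bsub>D\<^esub> canonical G a)"
    by (intro free_rig_eq[OF free_dual V_rig_map W_rig_map 1 2]) simp_all
  from fun_cong[OF this, of F] F have "canonical G1 F \<cdot>\<^bsub>D\<^esub> farr T (\<sigma> F) = \<xi> (fobj T F) \<cdot>\<^bsub>D\<^esub> canonical G F"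
    by simp
  then show ?thesis
    using F by (simp add: \<xi>T dual_comp \<phi>_def derivA_def)
qed

text \<open>Since \<open>f \<circ> g\<close> is \<open>f \<circ> G\<close> followed by \<open>F1 \<circ> g\<close>, naturality in both arguments splits into
  \<open>canonical_natural\<close> and the naturality in \<open>F\<close> that the canonical transformation has by construction.\<close>

lemma \<phi>_natural:
  assumes f: "f \<in> Arr R" "Dom R f = F" "Cod R f = F1" and g: "g \<in> Arr R" "Dom R g = G" "Cod R g = G1"
  shows "\<phi> F1 G1 \<cdot> derivA T (substA R X S s f g)
    = (substA R X S s (derivA T f) g \<odot> derivA T g) \<cdot> \<phi> F G"
proof -
  have obj [simp]: "G \<in> Obj R" "G1 \<in> Obj R" "F \<in> Obj R" "F1 \<in> Obj R"
    using f g by auto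
  interpret H: symmetric_monoidal_functor R R "S G"
    by (rule S_monoidal) simp
  let ?\<sigma> = "subst_trans R X S s g"
  have \<sigma>: "monoidal_trans R R (S G) (S G1) ?\<sigma>"
    using subst_trans[OF g(1)] g by simp
  note [simp] = f g monoidal_trans_component[OF \<sigma>]
  have \<phi> [simp]: "\<phi> F G \<in> Arr R" "Dom R (\<phi> F G) = deriv T (subst S F G)"
    "Cod R (\<phi> F G) = subst S (deriv T F) G \<otimes> deriv T G" if "F \<in> Obj R" "G \<in> Obj R" for F G
    using \<phi>_iso[OF that] by (simp_all add: iso_between_iff in_hom)
  have n1: "\<phi> F1 G1 \<cdot> derivA T (?\<sigma> F1) = (?\<sigma> (deriv T F1) \<odot> derivA T g) \<cdot> \<phi> F1 G"
    by (rule canonical_natural) simp_all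
  have n2: "\<phi> F1 G \<cdot> derivA T (farr (S G) f) = (farr (S G) (derivA T f) \<odot> Ide R (deriv T G)) \<cdot> \<phi> F G"
    using arg_cong[OF monoidal_trans_natural[OF canonical(1) category_axioms f(1)], of G snd]
    by (simp add: dual_comp \<phi>_def derivA_def)
  show ?thesis
    by (simp add: substA_def derivA_comp rewrite_prefix[OF n1] n2 subst_def)
qed

end

theorem theorem5p18:
  fixes \<A> :: "('j, 'k) cat set"
    and D1 :: "('o, 'a) smcat" and X :: 'o
    and S :: "'o \<Rightarrow> ('o, 'a, 'o, 'a) mfctr" and s :: "'o \<Rightarrow> 'a"
    and T :: "('o, 'a, 'o \<times> 'o, 'a \<times> 'a) mfctr" and t :: "'a \<times> 'a"
  assumes "additive_doctrine \<A>"
    and "free_rig_on \<A> D1 X TYPE('o \<times> 'a)"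
    and "free_rig_on \<A> D1 X TYPE(('o \<times> 'o) \<times> ('a \<times> 'a))"
    and "substitution_product \<A> D1 X S s"
    and "standard_derivation \<A> D1 X T t"
  shows "\<exists>\<phi> :: 'o \<Rightarrow> 'o \<Rightarrow> 'a.
    (\<forall>F\<in>Obj D1. \<forall>G\<in>Obj D1.
       iso_between D1 (\<phi> F G)
         (deriv T (subst S F G)) (subst S (deriv T F) G \<otimes>\<^bsub>D1\<^esub> deriv T G)) \<and>
    (\<forall>F\<in>Obj D1. \<forall>F1\<in>Obj D1. \<forall>G\<in>Obj D1. \<forall>G1\<in>Obj D1. \<forall>f\<in>hom D1 F F1. \<forall>g\<in>hom D1 G G1.
       \<phi> F1 G1 \<cdot>\<^bsub>D1\<^esub> derivA T (substA D1 X S s f g)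
         = (substA D1 X S s (derivA T f) g \<odot>\<^bsub>D1\<^esub> derivA T g) \<cdot>\<^bsub>D1\<^esub> \<phi> F G) \<and>
    (\<forall>G\<in>Obj D1.
       canonical_chain_rule D1 X S s T t G (\<lambda>F. \<phi> F G) \<and>
       (\<forall>\<psi>. canonical_chain_rule D1 X S s T t G \<psi> \<longrightarrow> (\<forall>F\<in>Obj D1. \<psi> F = \<phi> F G)))"
proof -
  interpret chain_rule \<A> D1 X S s T t
    using assms by unfold_locales
  show ?thesis
    by (rule exI[of _ \<phi>]) (auto simp: \<phi>_iso \<phi>_natural canonical_iff in_hom)
qed

end
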